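(* Let $d\geq 2$. There exists a set $P\subset\mathbb{R}^d$ of full Lebesgue measure with $P=-P$ such that for every bounded convex $\mathcal{D}\subset\mathbb{R}^d$ with non-empty interior, every $\alpha\in P$, and every subexponential sequence $(R_i)_{i\geq1}$, we have \[\sup_i L(\alpha,R_i^{-1}\mathcal{D})=\infty\qquad\text{and}\qquad\liminf_{i\to\infty} L(\alpha,R_i^{-1}\mathcal{D})<\infty .\]
   Context: For $\alpha\in\mathbb{R}^d$ and a set $\mathcal{D}\subset\mathbb{R}^d$, for $q\in\mathcal{D}$ the first return time of the toral translation $q\mapsto q+\alpha$ on $\mathbb{T}^d=\mathbb{R}^d/\mathbb{Z}^d$ is $\tau(q,\mathcal{D})=\min\{n\in\mathbb{N}^*\mid q+n\alpha\in\mathcal{D}+\mathbb{Z}^d\}$, where $\mathbb{N}^*=\{1,2,\ldots\}$; $L(\alpha,\mathcal{D})$ denotes the number of distinct values of $\tau(q,\mathcal{D})$ as $q$ ranges over $\mathcal{D}$. For $R>0$, $R^{-1}\mathcal{D}=\{R^{-1}x\mid x\in\mathcal{D}\}$. A sequence $0<R_1<R_2<\cdots$ is subexponential if $R_i\to\infty$ and $R_{i+1}/R_i\to1$. *)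

theory Defs
  imports "HOL-Analysis.Analysis" "HOL-Library.Extended_Nat"
begin

definition int_lattice :: "(real ^ 'n) set" where
  "int_lattice = {z. \<forall>i. z $ i \<in> \<int>}"

definition lattice_lift :: "(real ^ 'n) set \<Rightarrow> (real ^ 'n) set" where
  "lattice_lift D = {x + z | x z. x \<in> D \<and> z \<in> int_lattice}"

definition first_return :: "real ^ 'n \<Rightarrow> (real ^ 'n) set \<Rightarrow> real ^ 'n \<Rightarrow> nat" where
  "first_return \<alpha> D q = (LEAST n::nat. 1 \<le> n \<and> q + real n *\<^sub>R \<alpha> \<in> lattice_lift D)"

definition num_return_times :: "real ^ 'n \<Rightarrow> (real ^ 'n) set \<Rightarrow> enat" where
  "num_return_times \<alpha> D =
     (let S = first_return \<alpha> D ` D in if finite S then enat (card S) else \<infinity>)"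

definition subexponential :: "(nat \<Rightarrow> real) \<Rightarrow> bool" where
  "subexponential R \<longleftrightarrow> 0 < R 0 \<and> strict_mono R \<and> filterlim R at_top sequentially
     \<and> (\<lambda>i. R (Suc i) / R i) \<longlonglongrightarrow> 1"

end

theory Submission
  imports Defs
begin

text \<open>
  Almost every \<open>\<alpha>\<close> is non-singular, hence has infinitely many rational approximations
  \<open>\<beta>\<close> with exact denominator \<open>q\<close> and \<open>|\<alpha> - \<beta>| \<lesssim> q^(-1-1/d)\<close> whose nets
  \<open>\<int>\<beta> + \<int>^d\<close> are separated and, by a packing argument, relatively dense at scale \<open>q^(-1/d)\<close>.
  If \<open>R\<close> is comparable to \<open>q^(1/d)\<close>, this leaves boundedly many return times to \<open>R^(-1) D\<close>,
  which gives the bound on the limit inferior.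

  For the supremum, move \<open>\<alpha>\<close> at the same scale to \<open>\<beta> + \<gamma> / (M q)\<close>, where \<open>\<gamma>\<close> is
  a primitive net vector almost parallel to a prescribed direction \<open>\<theta>\<close>. The rotation then
  drifts by the small vector \<open>\<gamma> / M\<close> every \<open>q\<close> steps, and a point of \<open>R^(-1) D\<close> which has
  left the set comes back only after drifting along all of \<open>\<gamma>\<close>, through the other end of its chord
  in direction \<open>\<theta>\<close>. Its return time thus encodes the length of that chord. With \<open>\<theta>\<close> the
  direction of a diameter of \<open>D\<close>, the chord length is not constant, so there are many return times.
  The good parameters contain a ball of comparable radius near \<open>\<alpha>\<close>, so the exceptional set is
  porous and therefore null. All conditions hold on a range \<open>[R, 2R]\<close> of scales, and a
  subexponential sequence meets every such range far out.
\<close>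

subsection \<open>Porous sets\<close>

text \<open>One null set has to serve uncountably many bodies \<open>D\<close> and sequences
  \<open>R\<close>, so neither may enter the conditions on \<alpha>. This is why
  \<open>tube_return\<close> records only a direction, a tolerance and a length. It is monotone in
  them, so countably many conditions suffice, and only the final choice among these depends on
  \<open>D\<close> and on the number of return times wanted. The shift of \<alpha> and the radius of
  the ball of good parameters must both be of order 1/(N q), the size of the approximation error,
  with factors free of \<open>N\<close>. Non-singularity provides this: along infinitely many
  \<open>N\<close> it makes the separation and the covering radius of the net comparable. The
  factors still depend on \<alpha> through the constant \<open>K\<close> of
  \<open>good_approx\<close>, so porosity has to be used with a pointwise constant. The vector
  \<gamma> is taken primitive so that no net point lies strictly between 0 and \<gamma>; such a
  point would bring the orbit back before it has drifted along all of \<gamma>.\<close>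

lemma porous_imp_negligible_uniform:
  fixes S G :: "'a::euclidean_space set"
  assumes "bounded S" "open G" "S \<inter> G = {}" "0 < c"
    and por: "\<And>x r. \<lbrakk>x \<in> S; 0 < r\<rbrakk> \<Longrightarrow> \<exists>z s. 0 < s \<and> s < r \<and> ball z (c * s) \<subseteq> ball x s \<inter> G"
  shows "negligible S"
proof -
  \<comment> \<open>\<open>S\<close> is not assumed measurable, so its outer measure enters as an
    infimum over measurable covers. An almost optimal open cover is improved by a fixed proportion
    c^d, which forces \<open>\<mu>\<close> to be 0.\<close>
  define \<M> where "\<M> = {T. S \<subseteq> T \<and> T \<in> lmeasurable}"
  define \<mu> where "\<mu> = Inf (measure lebesgue ` \<M>)"
  obtain a b where "S \<subseteq> cbox a b"
    using \<open>bounded S\<close> bounded_subset_cbox_symmetric by metis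
  then have ne: "\<M> \<noteq> {}" by (auto simp: \<M>_def)
  have bdd: "bdd_below (measure lebesgue ` \<M>)"
    by (rule bdd_belowI2[of _ 0]) auto
  have \<mu>_le: "\<mu> \<le> measure lebesgue T" if "T \<in> \<M>" for T
    unfolding \<mu>_def using that bdd by (intro cINF_lower) auto
  have "\<mu> \<ge> 0" unfolding \<mu>_def using ne by (intro cINF_greatest) auto
  let ?d = "DIM('a)"
  have step: "\<mu> + c ^ ?d * \<mu> \<le> \<mu> + 2 * e" if "e > 0" for e
  proof -
    obtain T where T: "T \<in> \<M>" "measure lebesgue T < \<mu> + e"
      using ne bdd \<open>e > 0\<close> unfolding \<mu>_def
      by (metis (no_types, lifting) cINF_less_iff less_add_same_cancel1)
    then have TL: "T \<in> lmeasurable" "S \<subseteq> T" by (auto simp: \<M>_def)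
    obtain U where U: "open U" "T \<subseteq> U" and UT: "U - T \<in> lmeasurable" "emeasure lebesgue (U - T) < ennreal e"
      using sets_lebesgue_outer_open[of T e] TL(1) \<open>e > 0\<close> by auto
    have U_eq: "U = T \<union> (U - T)" using U by auto
    then have Um: "U \<in> lmeasurable" using TL(1) UT(1) by (metis fmeasurable.Un)
    have "measure lebesgue U \<le> measure lebesgue T + measure lebesgue (U - T)"
      using TL(1) UT(1) U_eq by (metis fmeasurableD measure_Un_le)
    moreover have "measure lebesgue (U - T) < e"
      using UT \<open>e > 0\<close> by (simp add: emeasure_eq_measure2 ennreal_less_iff)
    ultimately have mU: "measure lebesgue U < measure lebesgue T + e" by linarith
    note U = U Um mU
    \<comment> \<open>Holes are attached to the balls before the Vitali selection, so every selected
      ball brings its own hole.\<close>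
    define K where "K = {(x, s). 0 < s \<and> ball x s \<subseteq> U \<and> (\<exists>z. ball z (c * s) \<subseteq> ball x s \<inter> G)}"
    have cov: "\<exists>i. i \<in> K \<and> x \<in> ball (fst i) (snd i) \<and> snd i < d" if "x \<in> S" "0 < d" for x d
    proof -
      have "x \<in> U" using that TL U by auto
      then obtain k where k: "k > 0" "ball x k \<subseteq> U" using U(1) openE by blast
      obtain z s where "0 < s" "s < min d k" "ball z (c * s) \<subseteq> ball x s \<inter> G"
        using por[OF \<open>x \<in> S\<close>, of "min d k"] \<open>0 < d\<close> \<open>0 < k\<close> by (metis min_less_iff_conj)
      moreover have "ball x s \<subseteq> ball x k" using \<open>s < min d k\<close> by (simp add: subset_ball)
      ultimately show ?thesis using k by (intro exI[of _ "(x, s)"]) (auto simp: K_def)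
    qed
    obtain C where C: "countable C" "C \<subseteq> K"
      and disj: "pairwise (\<lambda>i j. disjnt (ball (fst i) (snd i)) (ball (fst j) (snd j))) C"
      and neg: "negligible (S - (\<Union>i\<in>C. ball (fst i) (snd i)))"
      using Vitali_covering_theorem_balls[OF cov] by blast
    define B where "B = (\<Union>i\<in>C. ball (fst i) (snd i))"
    have BU: "B \<subseteq> U" using C(2) unfolding B_def K_def by fastforce
    have oB: "open B" by (auto simp: B_def)
    have Bm: "B \<in> lmeasurable"
      by (rule fmeasurableI2[OF U(3) BU]) (use oB in auto)
    have BGm: "B \<inter> G \<in> lmeasurable"
      by (rule fmeasurableI2[OF Bm]) (use oB \<open>open G\<close> in auto)
    have dj: "disjoint_family_on (\<lambda>i. ball (fst i) (snd i)) C"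
      using disj by (auto simp: disjoint_family_on_def pairwise_def disjnt_def)
    then have dj': "disjoint_family_on (\<lambda>i. ball (fst i) (snd i) \<inter> G) C"
      unfolding disjoint_family_on_def by blast
    have ball_le: "ennreal (c ^ ?d) * emeasure lebesgue (ball (fst i) (snd i)) \<le> emeasure lebesgue (ball (fst i) (snd i) \<inter> G)"
      if "i \<in> C" for i
    proof -
      obtain x s where i: "i = (x, s)" by (cases i)
      with \<open>i \<in> C\<close> C(2) obtain z where s: "s > 0" and z: "ball z (c * s) \<subseteq> ball x s \<inter> G"
        by (auto simp: K_def)
      have "ennreal (c ^ ?d) * emeasure lebesgue (ball x s) = emeasure lebesgue (ball z (c * s))"
      proof -
        have "measure lebesgue (ball z (c * s)) = c ^ ?d * measure lebesgue (ball x s)"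
          using \<open>c > 0\<close> s by (simp add: content_ball power_mult_distrib)
        moreover have "emeasure lebesgue (ball y t) = ennreal (measure lebesgue (ball y t))" for y :: 'a and t
          by (intro emeasure_eq_measure2 lmeasurable_ball)
        ultimately show ?thesis
          using \<open>c > 0\<close> by (simp add: ennreal_mult)
      qed
      also have "\<dots> \<le> emeasure lebesgue (ball x s \<inter> G)"
        using z \<open>open G\<close> by (intro emeasure_mono) (auto intro: borel_open)
      finally show ?thesis by (simp add: i)
    qed
    have "ennreal (c ^ ?d) * emeasure lebesgue B
        = ennreal (c ^ ?d) * (\<integral>\<^sup>+ i. emeasure lebesgue (ball (fst i) (snd i)) \<partial>count_space C)"
      unfolding B_def using C(1) dj by (subst emeasure_UN_countable) auto
    also have "\<dots> = (\<integral>\<^sup>+ i. ennreal (c ^ ?d) * emeasure lebesgue (ball (fst i) (snd i)) \<partial>count_space C)"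
      by (rule nn_integral_cmult[symmetric]) auto
    also have "\<dots> \<le> (\<integral>\<^sup>+ i. emeasure lebesgue (ball (fst i) (snd i) \<inter> G) \<partial>count_space C)"
      using ball_le by (intro nn_integral_mono) auto
    also have "\<dots> = emeasure lebesgue (\<Union>i\<in>C. ball (fst i) (snd i) \<inter> G)"
      using C(1) dj' \<open>open G\<close> by (subst emeasure_UN_countable) (auto intro: borel_open)
    also have "(\<Union>i\<in>C. ball (fst i) (snd i) \<inter> G) = B \<inter> G" by (auto simp: B_def)
    finally have "ennreal (c ^ ?d) * ennreal (measure lebesgue B) \<le> ennreal (measure lebesgue (B \<inter> G))"
      using Bm BGm by (simp add: emeasure_eq_measure2)
    then have cB: "c ^ ?d * measure lebesgue B \<le> measure lebesgue (B \<inter> G)"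
      using \<open>c > 0\<close> by (simp flip: ennreal_mult)
    have "B - G \<in> lmeasurable"
      by (rule fmeasurableI2[OF Bm]) (use oB \<open>open G\<close> in auto)
    moreover have "S - B \<in> lmeasurable"
      using neg negligible_imp_measurable unfolding B_def by blast
    \<comment> \<open>\<open>S\<close> avoids \<open>G\<close>, so the holes can be cut out of
      \<open>B\<close> without losing a point of \<open>S\<close>; the null set \<open>S - B\<close>
      restores what the Vitali balls miss.\<close>
    ultimately have "(B - G) \<union> (S - B) \<in> \<M>"
      using \<open>S \<inter> G = {}\<close> by (auto simp: \<M>_def)
    then have "\<mu> \<le> measure lebesgue ((B - G) \<union> (S - B))" by (rule \<mu>_le)
    also have "\<dots> \<le> measure lebesgue (B - G) + measure lebesgue (S - B)"
      using Bm neg \<open>open G\<close> unfolding B_def[symmetric]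
      by (intro measure_Un_le) (auto simp: negligible_imp_sets intro!: borel_open oB)
    also have "measure lebesgue (S - B) = 0" using neg negligible_imp_measure0 B_def by blast
    also have "measure lebesgue (B - G) = measure lebesgue B - measure lebesgue (B \<inter> G)"
      by (metis Bm BGm Diff_Int_distrib2 Diff_Int Diff_cancel Un_empty_right Int_lower1 measurable_measure_Diff fmeasurableD sup_bot_left)
    finally have 1: "\<mu> + c ^ ?d * measure lebesgue B \<le> measure lebesgue B" using cB by linarith
    moreover have "measure lebesgue B \<le> measure lebesgue U"
      using BU U(3) Bm by (intro measure_mono_fmeasurable) auto
    moreover have "\<mu> \<le> measure lebesgue B"
    proof -
      have "0 \<le> c ^ ?d * measure lebesgue B" using \<open>c > 0\<close> by simp
      then show ?thesis using 1 by linarith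
    qed
    ultimately have "\<mu> + c ^ ?d * \<mu> \<le> measure lebesgue U"
      using \<open>c > 0\<close> by (smt (verit) mult_left_mono zero_less_power)
    then show ?thesis using T U by linarith
  qed
  have "c ^ ?d * \<mu> \<le> 0"
  proof (rule field_le_epsilon)
    fix e :: real assume "e > 0"
    then show "c ^ ?d * \<mu> \<le> 0 + e" using step[of "e/2"] by simp
  qed
  then have "\<mu> = 0" using zero_less_power[OF \<open>c > 0\<close>, of ?d] \<open>\<mu> \<ge> 0\<close> by (simp add: mult_le_0_iff)
  show ?thesis
    unfolding negligible_outer
  proof (intro allI impI)
    fix e :: real assume "e > 0"
    then obtain T where "T \<in> \<M>" "measure lebesgue T < e"
      using ne bdd \<open>\<mu> = 0\<close> unfolding \<mu>_def
      by (metis (no_types, lifting) cINF_less_iff)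
    then show "\<exists>T. S \<subseteq> T \<and> T \<in> lmeasurable \<and> measure lebesgue T < e" by (auto simp: \<M>_def)
  qed
qed

text \<open>Points are sorted by the reciprocal of their constant and by their norm. Each of the
  countably many classes is bounded and porous with one constant.\<close>

lemma porous_imp_negligible:
  fixes S G :: "'a::euclidean_space set"
  assumes "open G" "S \<inter> G = {}"
    and por: "\<And>x. x \<in> S \<Longrightarrow> \<exists>c>0. \<forall>r>0. \<exists>z s. 0 < s \<and> s < r \<and> ball z (c * s) \<subseteq> ball x s \<inter> G"
  shows "negligible S"
proof -
  define A where "A k = {x \<in> S. norm x \<le> real k \<and>
     (\<forall>r>0. \<exists>z s. 0 < s \<and> s < r \<and> ball z (inverse (real (Suc k)) * s) \<subseteq> ball x s \<inter> G)}" for k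
  have "negligible (A k)" for k
  proof (rule porous_imp_negligible_uniform)
    show "bounded (A k)" unfolding bounded_iff A_def by auto
    show "open G" "A k \<inter> G = {}" using assms by (auto simp: A_def)
    show "0 < inverse (real (Suc k))" by simp
  qed (auto simp: A_def)
  then have "negligible (\<Union>k. A k)" by (intro negligible_Union_nat)
  moreover have "S \<subseteq> (\<Union>k. A k)"
  proof
    fix x assume "x \<in> S"
    then obtain c where c: "c > 0" "\<forall>r>0. \<exists>z s. 0 < s \<and> s < r \<and> ball z (c * s) \<subseteq> ball x s \<inter> G"
      using por by blast
    obtain k where k: "real k \<ge> max (norm x) (inverse c)" using real_arch_simple by blast
    have "inverse (real (Suc k)) \<le> c"
      using k c(1) by (simp add: field_simps)
    then have "ball z (inverse (real (Suc k)) * s) \<subseteq> ball z (c * s)" if "s > 0" for z :: 'a and s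
      using that by (intro subset_ball mult_right_mono) auto
    then have "x \<in> A k" unfolding A_def using c(2) k \<open>x \<in> S\<close> by (auto, meson order_trans)
    then show "x \<in> (\<Union>k. A k)" by blast
  qed
  ultimately show ?thesis using negligible_subset by blast
qed

subsection \<open>Singular vectors\<close>

text \<open>Dirichlet's theorem gives a bound of order 1/N for every vector and every
  \<open>N\<close>; here it is improved by the factor \<open>B\<close>. Vectors that lie in these
  sets for every \<open>B\<close> and all large \<open>N\<close> are the singular vectors of
  Diophantine approximation.\<close>

definition singular_set :: "nat \<Rightarrow> nat \<Rightarrow> (real ^ 'n) set" where
  "singular_set B N = {\<alpha>. \<exists>n m. 1 \<le> n \<and> n \<le> N ^ CARD('n) \<and> m \<in> int_lattice \<and>
     norm (real n *\<^sub>R \<alpha> + m) < 1 / (real B * real N)}"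

lemma measure_cbox_cube:
  fixes c :: "real ^ 'n"
  assumes "0 \<le> h"
  shows "measure lebesgue (cbox (c - (\<chi> i. h)) (c + (\<chi> i. h))) = (2 * h) ^ CARD('n)"
proof -
  have "c \<in> cbox (c - (\<chi> i. h)) (c + (\<chi> i. h))" using assms by (simp add: mem_box_cart)
  then have "cbox (c - (\<chi> i. h)) (c + (\<chi> i. h)) \<noteq> {}" by blast
  then have "measure lborel (cbox (c - (\<chi> i. h)) (c + (\<chi> i. h))) = (\<Prod>i\<in>(UNIV :: 'n set). 2 * h)"
    by (subst content_cbox_cart) (simp_all add: algebra_simps)
  then show ?thesis by (simp add: prod_constant)
qed

lemma finite_int_vec: "finite {m :: real ^ 'n. m \<in> int_lattice \<and> (\<forall>i. \<bar>m $ i\<bar> \<le> real k)}"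
  and card_int_vec: "card {m :: real ^ 'n. m \<in> int_lattice \<and> (\<forall>i. \<bar>m $ i\<bar> \<le> real k)} \<le> (2 * k + 1) ^ CARD('n)"
proof -
  define A where "A = (UNIV :: 'n set) \<rightarrow>\<^sub>E {- int k .. int k}"
  define f :: "('n \<Rightarrow> int) \<Rightarrow> real ^ 'n" where "f g = (\<chi> i. of_int (g i))" for g
  have fin: "finite A" unfolding A_def by (intro finite_PiE) auto
  have sub: "{m :: real ^ 'n. m \<in> int_lattice \<and> (\<forall>i. \<bar>m $ i\<bar> \<le> real k)} \<subseteq> f ` A"
  proof
    fix m :: "real ^ 'n" assume m: "m \<in> {m. m \<in> int_lattice \<and> (\<forall>i. \<bar>m $ i\<bar> \<le> real k)}"
    have eq: "of_int \<lfloor>m $ i\<rfloor> = m $ i" for i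
      using m by (auto simp: int_lattice_def)
    have "\<lfloor>m $ i\<rfloor> \<in> {- int k .. int k}" for i
    proof -
      have "\<bar>m $ i\<bar> \<le> real k" using m by auto
      then have "\<bar>real_of_int \<lfloor>m $ i\<rfloor>\<bar> \<le> real k" by (simp only: eq)
      then show ?thesis by (simp add: abs_le_iff)
    qed
    then have "(\<lambda>i. \<lfloor>m $ i\<rfloor>) \<in> A" by (auto simp: A_def)
    moreover have "m = f (\<lambda>i. \<lfloor>m $ i\<rfloor>)" by (simp add: f_def vec_eq_iff eq)
    ultimately show "m \<in> f ` A" by blast
  qed
  show "finite {m :: real ^ 'n. m \<in> int_lattice \<and> (\<forall>i. \<bar>m $ i\<bar> \<le> real k)}"
    using sub fin finite_subset by blast
  have "card A = (2 * k + 1) ^ CARD('n)"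
  proof -
    have "nat (2 * int k + 1) = 2 * k + 1" by simp
    then show ?thesis unfolding A_def by (subst card_PiE) simp_all
  qed
  moreover have "card {m :: real ^ 'n. m \<in> int_lattice \<and> (\<forall>i. \<bar>m $ i\<bar> \<le> real k)} \<le> card A"
    using sub fin by (meson card_image_le card_mono finite_imageI order_trans)
  ultimately show "card {m :: real ^ 'n. m \<in> int_lattice \<and> (\<forall>i. \<bar>m $ i\<bar> \<le> real k)} \<le> (2 * k + 1) ^ CARD('n)"
    by simp
qed

text \<open>For a fixed \<open>n\<close> there are O(n^d) admissible centres -m/n, each with a cube
  of side 2/(B N n), so the volume is O((B N)^(-d)) whatever \<open>n\<close> is. Summing over N^d
  values of \<open>n\<close> cancels \<open>N\<close>: the bound is uniform in \<open>N\<close> and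
  small for large \<open>B\<close>.\<close>

lemma singular_set_cover:
  fixes r B N :: nat
  assumes "0 < B" "0 < N"
  obtains T :: "(real ^ 'n) set" where "singular_set B N \<inter> ball 0 (real r) \<subseteq> T" "T \<in> lmeasurable"
    "measure lebesgue T \<le> ((4 * real r + 6) / real B) ^ CARD('n)"
proof -
  let ?d = "CARD('n)"
  define I where "I n = {m :: real ^ 'n. m \<in> int_lattice \<and> (\<forall>i. \<bar>m $ i\<bar> \<le> real (n * (r + 1)))}" for n
  define h where "h n = 1 / (real B * real N * real n)" for n
  define Q where "Q n m = cbox ((- (1 / real n)) *\<^sub>R m - (\<chi> i. h n)) ((- (1 / real n)) *\<^sub>R m + (\<chi> i. h n))" for n and m :: "real ^ 'n"
  define T where "T = (\<Union>n\<in>{1..N ^ ?d}. \<Union>m\<in>I n. Q n m)"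
  have fin: "finite (I n)" for n unfolding I_def by (rule finite_int_vec)
  show thesis
  proof
    show "singular_set B N \<inter> ball 0 (real r) \<subseteq> T"
    proof
      fix \<alpha> :: "real ^ 'n" assume "\<alpha> \<in> singular_set B N \<inter> ball 0 (real r)"
      then obtain n m where nm: "1 \<le> n" "n \<le> N ^ ?d" "m \<in> int_lattice"
        "norm (real n *\<^sub>R \<alpha> + m) < 1 / (real B * real N)" and \<alpha>: "norm \<alpha> < real r"
        by (auto simp: singular_set_def)
      have small: "1 / (real B * real N) \<le> 1"
        using assms by (simp add: divide_le_eq mult_ge1_I)
      have "norm m \<le> norm (real n *\<^sub>R \<alpha> + m) + norm (real n *\<^sub>R \<alpha>)"
        by (metis add_diff_cancel_left' add.commute norm_triangle_ineq4)
      also have "\<dots> \<le> 1 + real n * real r" using nm small \<alpha> by (intro add_mono) auto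
      also have "\<dots> \<le> real (n * (r + 1))" using nm by (simp add: algebra_simps)
      finally have "m \<in> I n" using nm component_le_norm_cart[of m] unfolding I_def by (auto intro: order_trans)
      moreover have "\<alpha> \<in> Q n m"
      proof -
        have bnd: "\<bar>\<alpha> $ i - (- (1 / real n)) * m $ i\<bar> \<le> h n" for i
        proof -
          have "real n * \<bar>\<alpha> $ i - (- (1 / real n)) * m $ i\<bar> = \<bar>(real n *\<^sub>R \<alpha> + m) $ i\<bar>"
            using nm by (simp add: field_simps flip: abs_mult_pos)
          also have "\<dots> \<le> 1 / (real B * real N)"
            using nm(4) component_le_norm_cart[of "real n *\<^sub>R \<alpha> + m" i] by linarith
          finally show ?thesis using nm assms by (simp add: h_def field_simps)
        qed
        then show ?thesis
          unfolding Q_def mem_box_cart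
        proof (intro allI)
          fix i
          show "((- (1 / real n)) *\<^sub>R m - (\<chi> i. h n)) $ i \<le> \<alpha> $ i \<and>
            \<alpha> $ i \<le> ((- (1 / real n)) *\<^sub>R m + (\<chi> i. h n)) $ i"
            using bnd[of i] by (simp add: abs_le_iff)
        qed
      qed
      ultimately show "\<alpha> \<in> T" using nm by (auto simp: T_def)
    qed
    show "T \<in> lmeasurable" unfolding T_def Q_def using fin by (intro fmeasurable.finite_UN) auto
    have "measure lebesgue T \<le> (\<Sum>n\<in>{1..N ^ ?d}. measure lebesgue (\<Union>m\<in>I n. Q n m))"
      unfolding T_def Q_def using fin by (intro measure_UNION_le) auto
    also have "\<dots> \<le> (\<Sum>n\<in>{1..N ^ ?d}. ((4 * real r + 6) / (real B * real N)) ^ ?d)"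
    proof (rule sum_mono)
      fix n assume n: "n \<in> {1..N ^ ?d}"
      have "measure lebesgue (\<Union>m\<in>I n. Q n m) \<le> (\<Sum>m\<in>I n. measure lebesgue (Q n m))"
        unfolding Q_def using fin by (intro measure_UNION_le) auto
      also have "\<dots> = real (card (I n)) * (2 * h n) ^ ?d"
        unfolding Q_def by (subst measure_cbox_cube) (auto simp: h_def)
      also have "\<dots> \<le> real ((2 * (n * (r + 1)) + 1) ^ ?d) * (2 * h n) ^ ?d"
        unfolding I_def by (intro mult_right_mono of_nat_mono card_int_vec) (auto simp: h_def)
      also have "\<dots> = (real (2 * (n * (r + 1)) + 1) * (2 * h n)) ^ ?d"
        by (simp add: power_mult_distrib)
      also have "\<dots> \<le> ((real n * (2 * real r + 3)) * (2 * h n)) ^ ?d"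
        using n by (intro power_mono mult_right_mono) (auto simp: h_def algebra_simps)
      also have "(real n * (2 * real r + 3)) * (2 * h n) = (4 * real r + 6) / (real B * real N)"
        using n assms by (simp add: h_def divide_simps)
      finally show "measure lebesgue (\<Union>m\<in>I n. Q n m) \<le> ((4 * real r + 6) / (real B * real N)) ^ ?d" .
    qed
    also have "\<dots> = real N ^ ?d * ((4 * real r + 6) / (real B * real N)) ^ ?d" by simp
    also have "\<dots> = (real N * ((4 * real r + 6) / (real B * real N))) ^ ?d" by (simp only: power_mult_distrib)
    also have "real N * ((4 * real r + 6) / (real B * real N)) = (4 * real r + 6) / real B"
      using assms by (simp add: field_simps)
    finally show "measure lebesgue T \<le> ((4 * real r + 6) / real B) ^ ?d" .
  qed
qed

text \<open>The inner intersections increase with the index, so their union is as small as each of them.\<close>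
lemma negligible_singular:
  "negligible {\<alpha> :: real ^ 'n. \<forall>B>0. \<exists>N0. \<forall>N\<ge>N0. \<alpha> \<in> singular_set B N}"
proof -
  let ?S = "{\<alpha> :: real ^ 'n. \<forall>B>0. \<exists>N0. \<forall>N\<ge>N0. \<alpha> \<in> singular_set B N}"
  let ?d = "CARD('n)"
  have "negligible (?S \<inter> ball 0 (real r))" for r :: nat
    unfolding negligible_outer_le
  proof (intro allI impI)
    fix e :: real assume "e > 0"
    \<comment> \<open>With \<open>min 1 e\<close> the ratio is at most 1, so its d-th power does not
      exceed the ratio itself, which is at most \<open>e\<close>.\<close>
    obtain B :: nat where B: "real B > (4 * real r + 6) / min 1 e"
      using reals_Archimedean2 by blast
    then have "B > 0" using \<open>e > 0\<close>
      by (metis divide_nonneg_nonneg gr0I less_eq_real_def linorder_not_less min_def of_nat_0 of_nat_0_le_iff add_nonneg_nonneg mult_nonneg_nonneg zero_le_numeral zero_le_one)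
    have Bd: "((4 * real r + 6) / real B) ^ ?d \<le> e"
    proof -
      have "(4 * real r + 6) / real B \<le> min 1 e"
      proof -
        have "4 * real r + 6 < real B * min 1 e" using B \<open>e > 0\<close> by (simp add: pos_divide_less_eq)
        then have "4 * real r + 6 \<le> min 1 e * real B" by (simp only: mult.commute[of "min 1 e"] less_imp_le)
        then show ?thesis using \<open>B > 0\<close> by (simp only: pos_divide_le_eq of_nat_0_less_iff)
      qed
      then have "((4 * real r + 6) / real B) ^ ?d \<le> ((4 * real r + 6) / real B) ^ 1"
        by (intro power_decreasing) (auto simp: Suc_leI)
      then show ?thesis using \<open>(4 * real r + 6) / real B \<le> min 1 e\<close> by simp
    qed
    have "\<exists>T :: (real ^ 'n) set. 0 < N \<longrightarrow> singular_set B N \<inter> ball 0 (real r) \<subseteq> T \<and> T \<in> lmeasurable \<and> measure lebesgue T \<le> e" for N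
    proof (cases "0 < N")
      case True
      obtain T :: "(real ^ 'n) set" where "singular_set B N \<inter> ball 0 (real r) \<subseteq> T" "T \<in> lmeasurable"
        "measure lebesgue T \<le> ((4 * real r + 6) / real B) ^ ?d"
        using singular_set_cover[OF \<open>B > 0\<close> True] by metis
      then show ?thesis using Bd by (intro exI[of _ T]) auto
    qed auto
    then have "\<exists>T. \<forall>N. 0 < N \<longrightarrow> singular_set B N \<inter> ball 0 (real r) \<subseteq> T N \<and> T N \<in> lmeasurable \<and> measure lebesgue (T N :: (real ^ 'n) set) \<le> e"
      by (intro choice allI)
    then obtain T :: "nat \<Rightarrow> (real ^ 'n) set"
      where T: "\<And>N. 0 < N \<Longrightarrow> singular_set B N \<inter> ball 0 (real r) \<subseteq> T N"
        "\<And>N. 0 < N \<Longrightarrow> T N \<in> lmeasurable" "\<And>N. 0 < N \<Longrightarrow> measure lebesgue (T N) \<le> e" by auto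
    define V where "V k = (\<Inter>N\<in>{Suc k..}. T N)" for k
    have Vs: "V k \<in> sets lebesgue" for k
      unfolding V_def using T(2) by (intro sets.countable_INT) (auto simp: fmeasurableD)
    have "emeasure lebesgue (V k) \<le> ennreal e" for k
    proof -
      have "emeasure lebesgue (V k) \<le> emeasure lebesgue (T (Suc k))"
        using T(2) by (intro emeasure_mono) (auto simp: V_def fmeasurableD)
      also have "\<dots> = ennreal (measure lebesgue (T (Suc k)))" using T(2) by (simp add: emeasure_eq_measure2)
      also have "\<dots> \<le> ennreal e" using T(3) by (intro ennreal_leI) auto
      finally show ?thesis .
    qed
    moreover have "incseq V" unfolding V_def by (intro monoI INF_superset_mono) auto
    ultimately have le: "emeasure lebesgue (\<Union>k. V k) \<le> ennreal e"
      using Vs by (subst SUP_emeasure_incseq[symmetric]) (auto intro!: SUP_least)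
    then have fin: "(\<Union>k. V k) \<in> lmeasurable"
      using Vs by (intro fmeasurableI) (auto simp: less_top[symmetric] top_unique)
    moreover have "measure lebesgue (\<Union>k. V k) \<le> e"
      using le fin \<open>e > 0\<close> by (simp add: emeasure_eq_measure2)
    moreover have "?S \<inter> ball 0 (real r) \<subseteq> (\<Union>k. V k)"
    proof
      fix \<alpha> :: "real ^ 'n" assume a: "\<alpha> \<in> ?S \<inter> ball 0 (real r)"
      then obtain N0 where "\<forall>N\<ge>N0. \<alpha> \<in> singular_set B N" using \<open>B > 0\<close> by blast
      have "\<alpha> \<in> T N" if "N \<ge> Suc N0" for N
        using a \<open>\<forall>N\<ge>N0. \<alpha> \<in> singular_set B N\<close> T(1)[of N] that by auto
      then have "\<alpha> \<in> V N0" unfolding V_def by blast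
      then show "\<alpha> \<in> (\<Union>k. V k)" by blast
    qed
    ultimately show "\<exists>T. ?S \<inter> ball 0 (real r) \<subseteq> T \<and> T \<in> lmeasurable \<and> measure lebesgue T \<le> e" by blast
  qed
  then have "negligible (\<Union>r. ?S \<inter> ball 0 (real r))" by (rule negligible_Union_nat)
  moreover have "?S \<subseteq> (\<Union>r. ?S \<inter> ball 0 (real r))"
  proof
    fix \<alpha> :: "real ^ 'n" assume "\<alpha> \<in> ?S"
    moreover obtain r :: nat where "norm \<alpha> < real r" using reals_Archimedean2 by blast
    ultimately show "\<alpha> \<in> (\<Union>r. ?S \<inter> ball 0 (real r))" by (simp, blast)
  qed
  ultimately show ?thesis using negligible_subset by blast
qed

subsection \<open>Nets of rational approximations\<close>

lemma int_lattice_0 [simp]: "0 \<in> int_lattice"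
  by (simp add: int_lattice_def)

lemma int_lattice_add: "a \<in> int_lattice \<Longrightarrow> b \<in> int_lattice \<Longrightarrow> a + b \<in> int_lattice"
  by (simp add: int_lattice_def)

lemma int_lattice_diff: "a \<in> int_lattice \<Longrightarrow> b \<in> int_lattice \<Longrightarrow> a - b \<in> int_lattice"
  by (simp add: int_lattice_def)

lemma int_lattice_minus: "a \<in> int_lattice \<Longrightarrow> - a \<in> int_lattice"
  by (simp add: int_lattice_def)

lemma int_lattice_scale: "a \<in> int_lattice \<Longrightarrow> of_int k *\<^sub>R a \<in> int_lattice"
  by (simp add: int_lattice_def)

lemma int_lattice_scale_nat: "a \<in> int_lattice \<Longrightarrow> real k *\<^sub>R a \<in> int_lattice"
  by (simp add: int_lattice_def)

lemma int_lattice_norm_ge_1: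
  assumes "m \<in> int_lattice" "m \<noteq> 0"
  shows "1 \<le> norm m"
proof -
  obtain i where "m $ i \<noteq> 0" using assms(2) by (auto simp: vec_eq_iff)
  then have "1 \<le> \<bar>m $ i\<bar>" using assms(1) Ints_nonzero_abs_ge1 by (auto simp: int_lattice_def)
  then show ?thesis using component_le_norm_cart[of m i] by linarith
qed

definition rational_net :: "real ^ 'n \<Rightarrow> (real ^ 'n) set" where
  "rational_net \<beta> = {of_int n *\<^sub>R \<beta> + m | n m. m \<in> int_lattice}"

lemma rational_netI: "m \<in> int_lattice \<Longrightarrow> of_int n *\<^sub>R \<beta> + m \<in> rational_net \<beta>"
  unfolding rational_net_def by blast

lemma rational_netI_nat: "m \<in> int_lattice \<Longrightarrow> real n *\<^sub>R \<beta> + m \<in> rational_net \<beta>"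
  using rational_netI[of m "int n"] by simp

lemma rational_net_0 [simp]: "0 \<in> rational_net \<beta>"
  using rational_netI[of 0 0] by simp

lemma rational_net_diff: "a \<in> rational_net \<beta> \<Longrightarrow> b \<in> rational_net \<beta> \<Longrightarrow> a - b \<in> rational_net \<beta>"
proof -
  assume "a \<in> rational_net \<beta>" "b \<in> rational_net \<beta>"
  then obtain n m n' m' where *: "m \<in> int_lattice" "m' \<in> int_lattice"
    "a = of_int n *\<^sub>R \<beta> + m" "b = of_int n' *\<^sub>R \<beta> + m'" unfolding rational_net_def by blast
  then have "a - b = of_int (n - n') *\<^sub>R \<beta> + (m - m')" by (simp add: algebra_simps)
  then show ?thesis using * rational_netI int_lattice_diff by metis
qed

lemma rational_net_minus: "a \<in> rational_net \<beta> \<Longrightarrow> - a \<in> rational_net \<beta>"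
  using rational_net_diff[of 0] by simp

lemma rational_net_add: "a \<in> rational_net \<beta> \<Longrightarrow> b \<in> rational_net \<beta> \<Longrightarrow> a + b \<in> rational_net \<beta>"
  using rational_net_diff[of a \<beta> "- b"] rational_net_minus[of b \<beta>] by simp

lemma rational_net_scale: "a \<in> rational_net \<beta> \<Longrightarrow> of_int k *\<^sub>R a \<in> rational_net \<beta>"
proof -
  assume "a \<in> rational_net \<beta>"
  then obtain n m where *: "m \<in> int_lattice" "a = of_int n *\<^sub>R \<beta> + m" by (auto simp: rational_net_def)
  then have "of_int k *\<^sub>R a = of_int (k * n) *\<^sub>R \<beta> + of_int k *\<^sub>R m" by (simp add: algebra_simps)
  then show ?thesis using rational_netI[OF int_lattice_scale[OF *(1)]] by metis
qed

text \<open>The equivalence says that \<beta> has exact order \<open>q\<close> modulo the integer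
  lattice, so the net has \<open>q\<close> points per unit cube. The length scale is 1/N: during
  \<open>q\<close> steps the orbits of \<alpha> and \<beta> differ by at most 1/N, and distinct net
  points are at least 1/(K N) apart. \<open>K\<close> stays fixed while \<open>N\<close>
  grows.\<close>

definition good_approx :: "real \<Rightarrow> nat \<Rightarrow> nat \<Rightarrow> real ^ 'n \<Rightarrow> real ^ 'n \<Rightarrow> bool" where
  "good_approx K N q \<beta> \<alpha> \<longleftrightarrow> 0 < N \<and> 0 < q \<and> N ^ CARD('n) \<le> q \<and>
     (\<forall>n::int. of_int n *\<^sub>R \<beta> \<in> int_lattice \<longleftrightarrow> int q dvd n) \<and>
     (\<forall>\<gamma>\<in>rational_net \<beta>. \<gamma> \<noteq> 0 \<longrightarrow> 1 / (K * real N) \<le> norm \<gamma>) \<and>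
     norm (\<alpha> - \<beta>) \<le> 1 / (real N * real q)"

text \<open>The factor \<open>CARD('n)\<close> comes from bounding the Euclidean norm by the sum of
  the coordinates.\<close>

lemma Dirichlet_approx_vec:
  fixes \<alpha> :: "real ^ 'n"
  assumes "0 < N"
  obtains n m where "1 \<le> n" "n \<le> N ^ CARD('n)" "m \<in> int_lattice"
    "norm (real n *\<^sub>R \<alpha> + m) \<le> real CARD('n) / real N"
proof -
  obtain h where h: "bij_betw h {0..<CARD('n)} (UNIV :: 'n set)"
    using ex_bij_betw_nat_finite[OF finite_class.finite_UNIV] by blast
  obtain q p where qp: "0 < q" "q \<le> int (N ^ CARD('n))"
    "\<And>i. i < CARD('n) \<Longrightarrow> \<bar>of_int q * \<alpha> $ h i - of_int (p i)\<bar> < 1 / real N"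
    using Dirichlet_approx_simult[OF assms, of "CARD('n)" "\<lambda>i. \<alpha> $ h i"] by blast
  define g where "g = inv_into {0..<CARD('n)} h"
  have g: "g i < CARD('n)" "h (g i) = i" for i
    using h bij_betw_inv_into_right[OF h, of i] bij_betw_apply[OF bij_betw_inv_into[OF h], of i]
    by (auto simp: g_def)
  define m :: "real ^ 'n" where "m = (\<chi> i. - of_int (p (g i)))"
  have "norm (real (nat q) *\<^sub>R \<alpha> + m) \<le> (\<Sum>i\<in>UNIV. \<bar>(real (nat q) *\<^sub>R \<alpha> + m) $ i\<bar>)"
    by (rule norm_le_l1_cart)
  also have "\<dots> \<le> (\<Sum>i\<in>(UNIV :: 'n set). 1 / real N)"
    using qp(1) qp(3)[OF g(1)] by (intro sum_mono) (auto simp: m_def g(2) less_imp_le)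
  finally have "norm (real (nat q) *\<^sub>R \<alpha> + m) \<le> real CARD('n) / real N" by simp
  moreover have "m \<in> int_lattice" by (simp add: m_def int_lattice_def)
  moreover have "1 \<le> nat q" "nat q \<le> N ^ CARD('n)" using qp(1,2) by (auto simp: nat_le_iff)
  ultimately show thesis using that by blast
qed

text \<open>Take for \<open>q\<close> the least denominator with error at most 1/(2 B N). Dirichlet
  bounds it above by J N^d, and \<alpha> being outside the singular set bounds it below by N^d.
  Minimality makes the order of \<beta> exact. A net vector that is too short would, multiplied by
  some k <= J, yield a denominator of size at most N^d approximating \<alpha> too well.\<close>

lemma good_approx_exists:
  fixes \<alpha> :: "real ^ 'n"
  assumes \<alpha>: "\<alpha> \<notin> singular_set B N" and "0 < B" "0 < N"
  defines "J \<equiv> (2 * CARD('n) * B) ^ CARD('n)"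
  obtains q \<beta> where "good_approx (real (2 * J * B)) N q \<beta> \<alpha>"
proof -
  let ?d = "CARD('n)"
  \<comment> \<open>Half the threshold of \<open>singular_set B N\<close>: two errors of this size,
    one of them strict, still contradict the choice of \<alpha>.\<close>
  let ?\<epsilon> = "1 / (2 * real B * real N)"
  define R where "R n \<longleftrightarrow> 1 \<le> n \<and> (\<exists>m\<in>int_lattice. norm (real n *\<^sub>R \<alpha> + m) \<le> ?\<epsilon>)" for n :: nat
  have "J > 0" using \<open>0 < B\<close> by (simp add: J_def)
  have "0 < 2 * ?d * B * N" using assms(2,3) by simp
  then obtain n0 m0 where n0: "1 \<le> n0" "n0 \<le> (2 * ?d * B * N) ^ ?d" "m0 \<in> int_lattice"
    "norm (real n0 *\<^sub>R \<alpha> + m0) \<le> real ?d / real (2 * ?d * B * N)"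
    by (rule Dirichlet_approx_vec)
  have "real ?d / real (2 * ?d * B * N) = ?\<epsilon>" by (simp add: field_simps)
  then have Rn0: "R n0" unfolding R_def using n0(1,3,4) by metis
  define q where "q = (LEAST n. R n)"
  have Rq: "R q" unfolding q_def using Rn0 by (rule LeastI)
  have q_min: "\<not> R n" if "n < q" for n using that unfolding q_def by (rule not_less_Least)
  have "q \<le> n0" unfolding q_def using Rn0 by (rule Least_le)
  then have qJ: "q \<le> J * N ^ ?d" using n0(2) by (simp add: J_def power_mult_distrib)
  obtain p where p: "p \<in> int_lattice" "norm (real q *\<^sub>R \<alpha> + p) \<le> ?\<epsilon>" and "q \<ge> 1" using Rq by (auto simp: R_def)
  have far: "1 / (real B * real N) \<le> norm (real n *\<^sub>R \<alpha> + m)"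
    if "1 \<le> n" "n \<le> N ^ ?d" "m \<in> int_lattice" for n m
    using \<alpha> that unfolding singular_set_def by (auto simp: not_less)
  have far': "1 / (real B * real N) \<le> norm (of_int n *\<^sub>R \<alpha> + m)"
    if "n \<noteq> 0" "\<bar>n\<bar> \<le> int (N ^ ?d)" "m \<in> int_lattice" for n :: int and m
  proof (cases "n > 0")
    case True
    then have "real (nat n) = of_int n" by simp
    moreover have "1 \<le> nat n" "nat n \<le> N ^ ?d" using that True by linarith+
    ultimately show ?thesis using far[of "nat n" m] that by metis
  next
    case False
    then have "real (nat (- n)) = - of_int n" using that by simp
    moreover have "1 \<le> nat (- n)" "nat (- n) \<le> N ^ ?d" using that False by linarith+
    ultimately have "1 / (real B * real N) \<le> norm ((- of_int n) *\<^sub>R \<alpha> + - m)"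
      using far[of "nat (- n)" "- m"] that int_lattice_minus by metis
    also have "(- of_int n) *\<^sub>R \<alpha> + - m = - (of_int n *\<^sub>R \<alpha> + m)" by simp
    finally show ?thesis by (simp only: norm_minus_cancel)
  qed
  have \<epsilon>_less: "?\<epsilon> < 1 / (real B * real N)" using assms by (simp add: field_simps)
  have Nq: "N ^ ?d \<le> q"
  proof (rule ccontr)
    assume "\<not> N ^ ?d \<le> q"
    then have "1 / (real B * real N) \<le> ?\<epsilon>" using far[of q p] p \<open>q \<ge> 1\<close> by linarith
    then show False using \<epsilon>_less by linarith
  qed
  define \<beta> where "\<beta> = (- 1 / real q) *\<^sub>R p"
  have q\<beta>: "real q *\<^sub>R \<beta> = - p" using \<open>q \<ge> 1\<close> by (simp add: \<beta>_def)
  have q\<alpha>\<beta>: "real q * norm (\<alpha> - \<beta>) \<le> ?\<epsilon>"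
  proof -
    have "real q *\<^sub>R (\<alpha> - \<beta>) = real q *\<^sub>R \<alpha> + p" by (simp add: scaleR_diff_right q\<beta>)
    then have "real q * norm (\<alpha> - \<beta>) = norm (real q *\<^sub>R \<alpha> + p)"
      by (metis norm_scaleR abs_of_nat)
    then show ?thesis using p by simp
  qed
  have \<beta>_int: "of_int n *\<^sub>R \<beta> \<in> int_lattice \<longleftrightarrow> int q dvd n" for n :: int
  proof
    assume "int q dvd n"
    then obtain k where "n = int q * k" by (auto elim: dvdE)
    then have "of_int n *\<^sub>R \<beta> = of_int k *\<^sub>R (real q *\<^sub>R \<beta>)" by (simp add: mult.commute)
    then show "of_int n *\<^sub>R \<beta> \<in> int_lattice"
      using q\<beta> int_lattice_scale[OF int_lattice_minus[OF p(1)]] by metis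
  next
    assume n: "of_int n *\<^sub>R \<beta> \<in> int_lattice"
    define r where "r = nat (n mod int q)"
    have r: "int r = n mod int q" "r < q" using \<open>q \<ge> 1\<close> by (auto simp: r_def nat_less_iff)
    have "real r = of_int n - of_int (n div int q) * real q"
      by (metis r(1) minus_div_mult_eq_mod of_int_diff of_int_mult of_int_of_nat_eq)
    then have "real r *\<^sub>R \<beta> = of_int n *\<^sub>R \<beta> - of_int (n div int q) *\<^sub>R (real q *\<^sub>R \<beta>)"
      by (simp add: scaleR_left_diff_distrib)
    then have r\<beta>: "real r *\<^sub>R \<beta> \<in> int_lattice"
      using n q\<beta> p int_lattice_diff int_lattice_scale int_lattice_minus by metis
    show "int q dvd n"
    proof (cases "r = 0")
      case False
      have "norm (real r *\<^sub>R \<alpha> + - (real r *\<^sub>R \<beta>)) = real r * norm (\<alpha> - \<beta>)"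
        by (metis norm_scaleR abs_of_nat scaleR_diff_right diff_conv_add_uminus)
      also have "\<dots> \<le> real q * norm (\<alpha> - \<beta>)" using r(2) by (intro mult_right_mono) auto
      also have "\<dots> \<le> ?\<epsilon>" by (rule q\<alpha>\<beta>)
      finally have "R r" unfolding R_def using False int_lattice_minus[OF r\<beta>] by (auto intro!: bexI)
      then show ?thesis using q_min r(2) by blast
    qed (use r(1) in auto)
  qed
  have sep: "1 / (real (2 * J * B) * real N) \<le> norm \<gamma>" if \<gamma>_in: "\<gamma> \<in> rational_net \<beta>" and "\<gamma> \<noteq> 0" for \<gamma>
  proof (rule ccontr)
    assume small: "\<not> 1 / (real (2 * J * B) * real N) \<le> norm \<gamma>"
    obtain n m where \<gamma>: "m \<in> int_lattice" "\<gamma> = of_int n *\<^sub>R \<beta> + m"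
      using \<gamma>_in unfolding rational_net_def by blast
    \<comment> \<open>Multiplication by \<open>k\<close> brings \<open>n\<close> within q/J <= N^d
      of a multiple of \<open>q\<close>, the range in which \<open>far'\<close> applies, while k <=
      J keeps k\<gamma> shorter than the tolerance.\<close>
    obtain h k where hk: "0 < k" "k \<le> int J" "\<bar>of_int k * (of_int n / real q) - of_int h\<bar> < 1 / real J"
      using Dirichlet_approx[OF \<open>J > 0\<close>] by metis
    define n' where "n' = k * n - h * int q"
    define m' where "m' = of_int k *\<^sub>R m - of_int h *\<^sub>R p"
    have m': "m' \<in> int_lattice" unfolding m'_def
      using \<gamma> p by (intro int_lattice_diff int_lattice_scale)
    have k\<gamma>: "of_int k *\<^sub>R \<gamma> = of_int n' *\<^sub>R \<beta> + m'"
    proof -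
      have "of_int n' *\<^sub>R \<beta> = of_int (k * n) *\<^sub>R \<beta> - of_int h *\<^sub>R (real q *\<^sub>R \<beta>)"
        by (simp add: n'_def algebra_simps)
      then show ?thesis by (simp add: q\<beta> \<gamma> m'_def algebra_simps)
    qed
    have "norm (of_int k *\<^sub>R \<gamma>) \<le> real J * norm \<gamma>"
      using hk by (simp add: mult_right_mono)
    also have "\<dots> < real J * (1 / (real (2 * J * B) * real N))"
      using small \<open>J > 0\<close> by (intro mult_strict_left_mono) auto
    also have "\<dots> = ?\<epsilon>" using \<open>J > 0\<close> by (simp add: field_simps)
    finally have k\<gamma>_less: "norm (of_int k *\<^sub>R \<gamma>) < ?\<epsilon>" .
    have "\<bar>of_int n'\<bar> * real J < real q"
    proof -
      have "of_int n' = real q * (of_int k * (of_int n / real q) - of_int h)"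
        using \<open>q \<ge> 1\<close> by (simp add: n'_def field_simps)
      then have "\<bar>of_int n'\<bar> = real q * \<bar>of_int k * (of_int n / real q) - of_int h\<bar>"
        by (simp add: abs_mult)
      also have "\<dots> < real q * (1 / real J)" using hk \<open>q \<ge> 1\<close> by (intro mult_strict_left_mono) auto
      finally show ?thesis using \<open>J > 0\<close> by (simp add: field_simps)
    qed
    then have "real_of_int (\<bar>n'\<bar> * int J) < real_of_int (int q)" by simp
    then have n'J: "\<bar>n'\<bar> * int J < int q" by (simp only: of_int_less_iff)
    show False
    proof (cases "n' = 0")
      case True
      then have "m' \<noteq> 0" using k\<gamma> \<open>\<gamma> \<noteq> 0\<close> hk(1) by auto
      then have "1 \<le> norm (of_int k *\<^sub>R \<gamma>)" using True k\<gamma> m' int_lattice_norm_ge_1 by auto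
      moreover have "?\<epsilon> \<le> 1"
      proof -
        have "1 \<le> 2 * B * N" using assms by (simp add: Suc_le_eq)
        then have "1 \<le> 2 * real B * real N" by (metis of_nat_1 of_nat_le_iff of_nat_mult of_nat_numeral)
        then show ?thesis by (simp add: divide_le_eq)
      qed
      ultimately show False using k\<gamma>_less by linarith
    next
      case False
      have "\<bar>n'\<bar> * int J < int (N ^ ?d) * int J"
        using n'J qJ by (metis mult.commute of_nat_le_iff of_nat_mult order_less_le_trans)
      then have le: "\<bar>n'\<bar> \<le> int (N ^ ?d)" using \<open>J > 0\<close> by simp
      have "1 / (real B * real N) \<le> norm (of_int n' *\<^sub>R \<alpha> + m')" by (rule far'[OF False le m'])
      also have "of_int n' *\<^sub>R \<alpha> + m' = of_int k *\<^sub>R \<gamma> + of_int n' *\<^sub>R (\<alpha> - \<beta>)"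
        by (simp add: k\<gamma> algebra_simps)
      also have "norm \<dots> \<le> norm (of_int k *\<^sub>R \<gamma>) + \<bar>of_int n'\<bar> * norm (\<alpha> - \<beta>)"
        by (metis norm_scaleR norm_triangle_ineq)
      also have "\<bar>of_int n'\<bar> * norm (\<alpha> - \<beta>) \<le> real q * norm (\<alpha> - \<beta>)"
      proof (intro mult_right_mono)
        have "\<bar>n'\<bar> * 1 \<le> \<bar>n'\<bar> * int J" using \<open>J > 0\<close> by (intro mult_left_mono) auto
        then have "\<bar>n'\<bar> \<le> int q" using n'J by linarith
        then show "\<bar>of_int n'\<bar> \<le> real q" by (metis of_int_abs of_int_le_iff of_int_of_nat_eq)
      qed auto
      also have "\<dots> \<le> ?\<epsilon>" by (rule q\<alpha>\<beta>)
      finally have "1 / (real B * real N) < ?\<epsilon> + ?\<epsilon>" using k\<gamma>_less by linarith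
      then show False by (simp add: field_simps)
    qed
  qed
  have "norm (\<alpha> - \<beta>) \<le> 1 / (real N * real q)"
  proof -
    have "?\<epsilon> \<le> 1 / real N" using assms by (simp add: field_simps)
    then have "real q * norm (\<alpha> - \<beta>) \<le> 1 / real N" using q\<alpha>\<beta> by linarith
    then show ?thesis using \<open>q \<ge> 1\<close> \<open>0 < N\<close> by (simp add: field_simps)
  qed
  then have "good_approx (real (2 * J * B)) N q \<beta> \<alpha>"
    unfolding good_approx_def using \<open>0 < N\<close> \<open>q \<ge> 1\<close> Nq \<beta>_int sep by auto
  then show thesis using that by blast
qed

text \<open>Cut the box into cells of side a/(d + 1). Two points in one cell differ by at most that
  much in each of the d coordinates, hence by less than \<open>a\<close>, so each cell serves at
  most one index.\<close>

lemma separated_card_le: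
  fixes f :: "'i \<Rightarrow> real ^ 'n"
  assumes "finite I" "0 < a" "0 \<le> s"
    and box: "\<And>i k. i \<in> I \<Longrightarrow> 0 \<le> f i $ k \<and> f i $ k \<le> s"
    and sep: "\<And>i j. i \<in> I \<Longrightarrow> j \<in> I \<Longrightarrow> i \<noteq> j \<Longrightarrow> a \<le> norm (f i - f j)"
  shows "real (card I) \<le> ((real CARD('n) + 1) * s / a + 1) ^ CARD('n)"
proof -
  let ?d = "CARD('n)"
  define t where "t = (real ?d + 1) / a"
  have "t > 0" using \<open>0 < a\<close> by (simp add: t_def)
  define g where "g i = (\<lambda>k. \<lfloor>f i $ k * t\<rfloor>)" for i
  define A where "A = (UNIV :: 'n set) \<rightarrow>\<^sub>E {0..\<lfloor>s * t\<rfloor>}"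
  have finA: "finite A" unfolding A_def by (intro finite_PiE) auto
  have "g ` I \<subseteq> A"
  proof
    fix h assume "h \<in> g ` I"
    then obtain i where i: "i \<in> I" "h = g i" by blast
    have "0 \<le> \<lfloor>f i $ k * t\<rfloor>" "\<lfloor>f i $ k * t\<rfloor> \<le> \<lfloor>s * t\<rfloor>" for k
      using box[OF i(1), of k] \<open>t > 0\<close> by (auto intro!: floor_mono mult_right_mono)
    then show "h \<in> A" by (auto simp: i g_def A_def)
  qed
  moreover have "inj_on g I"
  proof (rule inj_onI, rule ccontr)
    fix i j assume ij: "i \<in> I" "j \<in> I" "g i = g j" "i \<noteq> j"
    have "\<bar>(f i - f j) $ k\<bar> \<le> 1 / t" for k
    proof -
      have "\<lfloor>f i $ k * t\<rfloor> = \<lfloor>f j $ k * t\<rfloor>" using fun_cong[OF ij(3), of k] by (simp add: g_def)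
      then have "\<bar>f i $ k * t - f j $ k * t\<bar> \<le> 1" by linarith
      then have "\<bar>f i $ k - f j $ k\<bar> * t \<le> 1"
        using \<open>t > 0\<close> by (simp add: left_diff_distrib abs_mult_pos flip: left_diff_distrib)
      then show ?thesis using \<open>t > 0\<close> by (simp add: field_simps)
    qed
    then have "norm (f i - f j) \<le> (\<Sum>k\<in>(UNIV :: 'n set). 1 / t)"
      by (intro order_trans[OF norm_le_l1_cart] sum_mono) auto
    also have "\<dots> = real ?d * a / (real ?d + 1)" by (simp add: t_def)
    also have "\<dots> < a" using \<open>0 < a\<close> by (simp add: field_simps)
    finally show False using sep[OF ij(1,2,4)] by linarith
  qed
  ultimately have "card I \<le> card A" using finA card_inj_on_le by blast
  moreover have "real (card A) = (real_of_int \<lfloor>s * t\<rfloor> + 1) ^ ?d"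
  proof -
    have "0 \<le> \<lfloor>s * t\<rfloor>" using \<open>t > 0\<close> \<open>0 \<le> s\<close> by simp
    then have "real (card {0..\<lfloor>s * t\<rfloor>}) = real_of_int \<lfloor>s * t\<rfloor> + 1" by simp
    then show ?thesis unfolding A_def by (subst card_PiE) (simp_all del: card_atLeastAtMost_int)
  qed
  moreover have "(real_of_int \<lfloor>s * t\<rfloor> + 1) ^ ?d \<le> (s * t + 1) ^ ?d"
    using \<open>t > 0\<close> \<open>0 \<le> s\<close> by (intro power_mono) auto
  moreover have "s * t = (real ?d + 1) * s / a" by (simp add: t_def)
  ultimately show ?thesis by (metis of_nat_mono order_trans)
qed

lemma infdist_translate_le:
  assumes "\<And>a. a \<in> A \<Longrightarrow> a + c \<in> A"
  shows "infdist (x + c) A \<le> infdist (x :: 'a::real_normed_vector) A"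
proof (cases "A = {}")
  case False
  show ?thesis unfolding infdist_notempty[OF False, of x]
  proof (rule cINF_greatest[OF False])
    fix a assume "a \<in> A"
    then have "infdist (x + c) A \<le> dist (x + c) (a + c)" using assms by (intro infdist_le)
    then show "infdist (x + c) A \<le> dist x a" by simp
  qed
qed (simp add: infdist_def)

text \<open>The power bounds the number of distance levels that fit in the packing argument; the
  divisor \<open>K\<close> comes from their spacing 1/(K N), measured in units of 1/N.\<close>

definition covering_const :: "nat \<Rightarrow> real \<Rightarrow> real" where
  "covering_const d K = ((real d + 1) * K + 1) ^ d / K"

text \<open>If \<open>z\<close> is far from the net, then points of the segment from \<open>0\<close> to \<open>z\<close> at distances
  \<open>0, a, 2a, \<dots>\<close> from the net have pairwise disjoint and separated net translates, of which
  there is no room for more than a bounded number.\<close>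
lemma rational_net_covering:
  fixes z :: "real ^ 'n"
  assumes ga: "good_approx K N q \<beta> \<alpha>" and "0 < K"
  obtains \<gamma> where "\<gamma> \<in> rational_net \<beta>" "norm (z - \<gamma>) < covering_const CARD('n) K / real N"
proof -
  let ?d = "CARD('n)" and ?G = "rational_net \<beta>"
  have N: "0 < N" "0 < q" "N ^ ?d \<le> q"
    and dvd: "\<And>n::int. of_int n *\<^sub>R \<beta> \<in> int_lattice \<longleftrightarrow> int q dvd n"
    and sep: "\<And>\<gamma>. \<gamma> \<in> ?G \<Longrightarrow> \<gamma> \<noteq> 0 \<Longrightarrow> 1 / (K * real N) \<le> norm \<gamma>"
    using ga by (auto simp: good_approx_def)
  define a where "a = 1 / (K * real N)"
  have "a > 0" using N \<open>0 < K\<close> by (simp add: a_def)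
  define J where "J = nat \<lfloor>infdist z ?G / a\<rfloor>"
  have J: "real J * a \<le> infdist z ?G"
  proof -
    have "real J \<le> infdist z ?G / a" using \<open>a > 0\<close> by (simp add: J_def infdist_nonneg)
    then show ?thesis using \<open>a > 0\<close> by (simp add: field_simps)
  qed
  have "\<exists>y. infdist y ?G = real j * a" if "j \<le> J" for j
  proof -
    have "real j * a \<le> infdist (1 *\<^sub>R z) ?G"
      using that J \<open>a > 0\<close> by (simp, meson mult_right_mono of_nat_mono order_trans less_imp_le)
    moreover have "infdist (0 *\<^sub>R z) ?G \<le> real j * a" using \<open>a > 0\<close> by simp
    moreover have "continuous_on {0..1} (\<lambda>t. infdist (t *\<^sub>R z) ?G)" by (intro continuous_intros)
    ultimately obtain t where "infdist (t *\<^sub>R z) ?G = real j * a"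
      using IVT'[of "\<lambda>t. infdist (t *\<^sub>R z) ?G" 0 "real j * a" 1] by auto
    then show ?thesis by blast
  qed
  then obtain y where y: "\<And>j. j \<le> J \<Longrightarrow> infdist (y j) ?G = real j * a" by metis
  \<comment> \<open>The distance to the net is 1-Lipschitz and does not grow under net translations,
    so points on different levels stay \<open>a\<close> apart after any such translation.\<close>
  have y_sep: "a \<le> norm (y i - y j - \<gamma>)" if "i \<le> J" "j < i" "\<gamma> \<in> ?G" for i j \<gamma>
  proof -
    have "infdist (y i) ?G \<le> infdist (y j + \<gamma>) ?G + dist (y i) (y j + \<gamma>)" by (rule infdist_triangle)
    also have "infdist (y j + \<gamma>) ?G \<le> infdist (y j) ?G"
      using that rational_net_add by (intro infdist_translate_le) auto
    finally have "real i * a - real j * a \<le> dist (y i) (y j + \<gamma>)" using y that by simp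
    moreover have "1 * a \<le> (real i - real j) * a"
      using that \<open>a > 0\<close> by (intro mult_right_mono) auto
    ultimately show ?thesis by (simp add: dist_norm algebra_simps)
  qed
  \<comment> \<open>The points y j + n\<beta> with n < q are reduced modulo integers into the unit
    cube. All (J + 1) q of them are \<open>a\<close>-separated: on one level by the separation of
    the net, on different levels by \<open>y_sep\<close>.\<close>
  define f :: "nat \<times> nat \<Rightarrow> real ^ 'n" where "f = (\<lambda>(j, n). \<chi> k. frac ((y j + real n *\<^sub>R \<beta>) $ k))"
  have f_eq: "\<exists>m\<in>int_lattice. f (j, n) = y j + real n *\<^sub>R \<beta> + m" for j n
    by (rule bexI[of _ "\<chi> k. - of_int \<lfloor>(y j + real n *\<^sub>R \<beta>) $ k\<rfloor>"])
      (auto simp: f_def frac_def vec_eq_iff int_lattice_def)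
  have f_diff: "\<exists>\<gamma>\<in>?G. f (j, n) - f (j', n') = y j - y j' - \<gamma> \<and> (j = j' \<longrightarrow> n < q \<longrightarrow> n' < q \<longrightarrow> n \<noteq> n' \<longrightarrow> \<gamma> \<noteq> 0)"
    for j n j' n'
  proof -
    obtain m where m: "m \<in> int_lattice" "f (j, n) = y j + real n *\<^sub>R \<beta> + m" using f_eq by blast
    obtain m' where m': "m' \<in> int_lattice" "f (j', n') = y j' + real n' *\<^sub>R \<beta> + m'" using f_eq by blast
    define \<gamma> where "\<gamma> = of_int (int n' - int n) *\<^sub>R \<beta> + (m' - m)"
    have "\<gamma> \<in> ?G" unfolding \<gamma>_def using m m' by (intro rational_netI int_lattice_diff)
    moreover have "f (j, n) - f (j', n') = y j - y j' - \<gamma>"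
      by (simp add: m m' \<gamma>_def algebra_simps)
    moreover have "\<gamma> \<noteq> 0" if "n < q" "n' < q" "n \<noteq> n'"
    proof
      assume "\<gamma> = 0"
      then have "of_int (int n' - int n) *\<^sub>R \<beta> = m - m'" by (simp add: \<gamma>_def algebra_simps)
      then have "int q dvd int n' - int n" using dvd m m' int_lattice_diff by metis
      moreover have "0 < \<bar>int n' - int n\<bar>" "\<bar>int n' - int n\<bar> < int q" using that by linarith+
      ultimately show False using zdvd_not_zless[of "\<bar>int n' - int n\<bar>" "int q"] by simp
    qed
    ultimately show ?thesis by blast
  qed
  have "real (card ({..J} \<times> {..<q})) \<le> ((real ?d + 1) * 1 / a + 1) ^ ?d"
  proof (rule separated_card_le[where f = f])
    fix i k show "0 \<le> f i $ k \<and> f i $ k \<le> 1"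
      by (cases i) (auto simp: f_def frac_lt_1 less_imp_le)
  next
    fix u v assume uv: "u \<in> {..J} \<times> {..<q}" "v \<in> {..J} \<times> {..<q}" "u \<noteq> v"
    obtain j n j' n' where eq: "u = (j, n)" "v = (j', n')" by (cases u, cases v)
    obtain \<gamma> where \<gamma>: "\<gamma> \<in> ?G" "f (j, n) - f (j', n') = y j - y j' - \<gamma>"
      "j = j' \<longrightarrow> n < q \<longrightarrow> n' < q \<longrightarrow> n \<noteq> n' \<longrightarrow> \<gamma> \<noteq> 0" using f_diff by blast
    consider "j = j'" | "j' < j" | "j < j'" by linarith
    then show "a \<le> norm (f u - f v)"
    proof cases
      case 1
      then have "\<gamma> \<noteq> 0" using uv \<gamma>(3) by (auto simp: eq)
      then show ?thesis using sep[OF \<gamma>(1)] \<gamma>(2) 1 by (simp add: eq a_def)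
    next
      case 2
      then show ?thesis using y_sep[OF _ 2 \<gamma>(1)] uv by (auto simp: eq \<gamma>(2))
    next
      case 3
      have "norm (y j - y j' - \<gamma>) = norm (y j' - y j - (- \<gamma>))"
        by (metis minus_diff_eq minus_diff_commute norm_minus_cancel diff_minus_eq_add add.commute diff_conv_add_uminus)
      then show ?thesis using y_sep[OF _ 3 rational_net_minus[OF \<gamma>(1)]] uv by (auto simp: eq \<gamma>(2))
    qed
  qed (use \<open>a > 0\<close> in auto)
  \<comment> \<open>Since N >= 1, the additive 1 is absorbed into the multiple of \<open>N\<close>.
    Then N^d <= q produces a factor \<open>q\<close> on the right, which cancels against the
    \<open>q\<close> points of each level.\<close>
  also have "\<dots> \<le> (real N * ((real ?d + 1) * K + 1)) ^ ?d"
  proof (rule power_mono)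
    have "(real ?d + 1) * 1 / a + 1 \<le> (real ?d + 1) * (K * real N) + real N"
      using N by (simp add: a_def)
    then show "(real ?d + 1) * 1 / a + 1 \<le> real N * ((real ?d + 1) * K + 1)" by (simp add: algebra_simps)
  qed (use \<open>a > 0\<close> in auto)
  also have "\<dots> = real (N ^ ?d) * ((real ?d + 1) * K + 1) ^ ?d" by (simp add: power_mult_distrib)
  also have "\<dots> \<le> real q * ((real ?d + 1) * K + 1) ^ ?d"
    using N(3) \<open>0 < K\<close> by (intro mult_right_mono) (auto simp flip: of_nat_power)
  finally have "real q * real (J + 1) \<le> real q * ((real ?d + 1) * K + 1) ^ ?d"
    by (simp only: card_cartesian_product card_atMost card_lessThan of_nat_mult Suc_eq_plus1 mult.commute)
  then have "real (J + 1) \<le> ((real ?d + 1) * K + 1) ^ ?d"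
    using N(2) by (simp only: mult_le_cancel_left_pos of_nat_0_less_iff)
  moreover have "infdist z ?G / a < real (J + 1)"
  proof -
    have "0 \<le> \<lfloor>infdist z ?G / a\<rfloor>" using infdist_nonneg[of z ?G] \<open>a > 0\<close> by simp
    then have "real (J + 1) = real_of_int \<lfloor>infdist z ?G / a\<rfloor> + 1" by (simp add: J_def)
    then show ?thesis using real_of_int_floor_add_one_gt by metis
  qed
  ultimately have "infdist z ?G / a < ((real ?d + 1) * K + 1) ^ ?d" by linarith
  then have "infdist z ?G < covering_const ?d K / real N"
    using N \<open>0 < K\<close> by (simp add: a_def covering_const_def field_simps)
  moreover have "?G \<noteq> {}" using rational_net_0 by blast
  ultimately obtain \<gamma> where "\<gamma> \<in> ?G" "dist z \<gamma> < covering_const ?d K / real N"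
    unfolding infdist_notempty[OF \<open>?G \<noteq> {}\<close>] by (auto simp: cINF_less_iff)
  then show thesis using that by (simp add: dist_norm)
qed

section \<open>Boundedly many return times at the scale of a rational approximation\<close>

lemma mem_lattice_lift: "x \<in> lattice_lift D \<longleftrightarrow> (\<exists>z\<in>int_lattice. x + z \<in> D)"
proof
  assume "x \<in> lattice_lift D"
  then obtain y z where "x = y + z" "y \<in> D" "z \<in> int_lattice" by (auto simp: lattice_lift_def)
  then show "\<exists>z\<in>int_lattice. x + z \<in> D" using int_lattice_minus by (intro bexI[of _ "- z"]) auto
next
  assume "\<exists>z\<in>int_lattice. x + z \<in> D"
  then obtain z where "z \<in> int_lattice" "x + z \<in> D" by blast
  then have "x = (x + z) + (- z)" "- z \<in> int_lattice" using int_lattice_minus by auto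
  then show "x \<in> lattice_lift D" using \<open>x + z \<in> D\<close> unfolding lattice_lift_def by blast
qed

lemma mem_scaled: "R > 0 \<Longrightarrow> x \<in> (\<lambda>x. inverse R *\<^sub>R x) ` D \<longleftrightarrow> R *\<^sub>R (x :: 'a::real_vector) \<in> D"
  by (force simp: image_iff)

text \<open>The scaled body contains a ball of radius at least (C + 1)/N, where C is the covering
  constant: C/N pays for the covering radius of the net and 1/N for the distance between the two
  orbits, so every point returns within \<open>q\<close> steps. A return moves the point by at most
  \<Delta>/(c N), so it comes from a net vector of length O(1/N), and the separation of the net
  leaves boundedly many of these.\<close>

lemma num_return_times_le:
  fixes D :: "(real ^ 'n) set"
  assumes ga: "good_approx K N q \<beta> \<alpha>" and "0 < K"
    and D: "cball y\<^sub>0 r \<subseteq> D" "0 < r" "\<And>x y. x \<in> D \<Longrightarrow> y \<in> D \<Longrightarrow> norm (x - y) \<le> \<Delta>"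
    and R: "0 < c" "c * real N \<le> R" "R * (covering_const CARD('n) K + 1) \<le> r * real N"
  defines "b \<equiv> ((real CARD('n) + 1) * (2 * (\<Delta> / c + 1)) * K + 1) ^ CARD('n)"
  shows "num_return_times \<alpha> ((\<lambda>x. inverse R *\<^sub>R x) ` D) \<le> enat (nat \<lfloor>b\<rfloor>)"
proof -
  let ?d = "CARD('n)" and ?G = "rational_net \<beta>" and ?D = "(\<lambda>x. inverse R *\<^sub>R x) ` D"
  let ?C = "covering_const CARD('n) K"
  have N: "0 < N" "0 < q" "N ^ ?d \<le> q"
    and dvd: "\<And>n::int. of_int n *\<^sub>R \<beta> \<in> int_lattice \<longleftrightarrow> int q dvd n"
    and sep: "\<And>\<gamma>. \<gamma> \<in> ?G \<Longrightarrow> \<gamma> \<noteq> 0 \<Longrightarrow> 1 / (K * real N) \<le> norm \<gamma>"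
    and \<alpha>\<beta>: "norm (\<alpha> - \<beta>) \<le> 1 / (real N * real q)"
    using ga by (auto simp: good_approx_def)
  have "R > 0" using R N by (smt (verit) mult_pos_pos of_nat_0_less_iff)
  have "y\<^sub>0 \<in> D" using D by auto
  then have "\<Delta> \<ge> 0" using D(3)[of y\<^sub>0 y\<^sub>0] by simp
  define s where "s = (\<Delta> / c + 1) / real N"
  have "s > 0" using N R \<open>\<Delta> \<ge> 0\<close> by (auto simp: s_def intro!: divide_pos_pos add_nonneg_pos)
  define T where "T = {n. 1 \<le> n \<and> n \<le> q \<and> (\<exists>m\<in>int_lattice. norm (real n *\<^sub>R \<beta> + m) \<le> s)}"
  have "finite T" by (rule finite_subset[of _ "{..q}"]) (auto simp: T_def)
  have close: "norm (real n *\<^sub>R \<alpha> - real n *\<^sub>R \<beta>) \<le> 1 / real N" if "n \<le> q" for n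
  proof -
    have "norm (real n *\<^sub>R \<alpha> - real n *\<^sub>R \<beta>) = real n * norm (\<alpha> - \<beta>)"
      by (metis norm_scaleR abs_of_nat scaleR_diff_right)
    also have "\<dots> \<le> real q * (1 / (real N * real q))"
      using \<alpha>\<beta> that by (intro mult_mono) auto
    also have "\<dots> = 1 / real N" using N by simp
    finally show ?thesis .
  qed
  have "first_return \<alpha> ?D x \<in> T" if "x \<in> ?D" for x
  proof -
    have x: "R *\<^sub>R x \<in> D" using that mem_scaled[OF \<open>R > 0\<close>] by blast
    define P where "P n \<longleftrightarrow> 1 \<le> n \<and> x + real n *\<^sub>R \<alpha> \<in> lattice_lift ?D" for n :: nat
    obtain \<gamma> where \<gamma>: "\<gamma> \<in> ?G" "norm (inverse R *\<^sub>R y\<^sub>0 - x - \<gamma>) < ?C / real N"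
      by (rule rational_net_covering[OF ga \<open>0 < K\<close>])
    obtain k m where k: "m \<in> int_lattice" "\<gamma> = of_int k *\<^sub>R \<beta> + m" using \<gamma>(1) unfolding rational_net_def by blast
    \<comment> \<open>The residue of \<open>k\<close> is taken in 1..q instead of 0..q-1, because a
      return time is at least 1.\<close>
    define n where "n = nat ((k - 1) mod int q) + 1"
    have n: "1 \<le> n" "n \<le> q" and "int q dvd k - int n"
    proof -
      have "(k - 1) mod int q < int q" "0 \<le> (k - 1) mod int q" using N by auto
      then show "1 \<le> n" "n \<le> q" by (auto simp: n_def)
      have "k - int n = (k - 1) - (k - 1) mod int q"
        using \<open>0 \<le> (k - 1) mod int q\<close> by (simp add: n_def)
      then show "int q dvd k - int n" by (simp add: minus_mod_eq_mult_div)
    qed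
    define m' where "m' = m + of_int (k - int n) *\<^sub>R \<beta>"
    have m': "m' \<in> int_lattice" unfolding m'_def
      using k(1) \<open>int q dvd k - int n\<close> dvd int_lattice_add by blast
    have \<gamma>_eq: "\<gamma> = real n *\<^sub>R \<beta> + m'" by (simp add: k(2) m'_def algebra_simps)
    have "norm (inverse R *\<^sub>R y\<^sub>0 - (x + real n *\<^sub>R \<alpha> + m'))
        \<le> norm (inverse R *\<^sub>R y\<^sub>0 - x - \<gamma>) + norm (real n *\<^sub>R \<alpha> - real n *\<^sub>R \<beta>)"
    proof -
      have "inverse R *\<^sub>R y\<^sub>0 - (x + real n *\<^sub>R \<alpha> + m') = (inverse R *\<^sub>R y\<^sub>0 - x - \<gamma>) - (real n *\<^sub>R \<alpha> - real n *\<^sub>R \<beta>)"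
        by (simp add: \<gamma>_eq)
      then show ?thesis by (metis norm_triangle_ineq4)
    qed
    also have "\<dots> \<le> (?C + 1) / real N" using \<gamma>(2) close[OF n(2)] by (simp add: add_divide_distrib)
    finally have "R * norm (inverse R *\<^sub>R y\<^sub>0 - (x + real n *\<^sub>R \<alpha> + m')) \<le> R * ((?C + 1) / real N)"
      using \<open>R > 0\<close> by (intro mult_left_mono) auto
    also have "\<dots> \<le> r" using R N by (simp add: field_simps)
    finally have "norm (R *\<^sub>R (inverse R *\<^sub>R y\<^sub>0 - (x + real n *\<^sub>R \<alpha> + m'))) \<le> r" using \<open>R > 0\<close> by simp
    then have "R *\<^sub>R (x + real n *\<^sub>R \<alpha> + m') \<in> cball y\<^sub>0 r"
      using \<open>R > 0\<close> by (simp add: dist_norm scaleR_diff_right)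
    then have "P n" unfolding P_def mem_lattice_lift mem_scaled[OF \<open>R > 0\<close>]
      using n(1) m' D(1) by blast
    define l where "l = first_return \<alpha> ?D x"
    have l: "l = (LEAST n. P n)" by (simp add: l_def first_return_def P_def)
    then have "P l" "l \<le> n" using \<open>P n\<close> LeastI Least_le by metis+
    then obtain m where m: "1 \<le> l" "m \<in> int_lattice" "R *\<^sub>R (x + real l *\<^sub>R \<alpha> + m) \<in> D"
      unfolding P_def mem_lattice_lift mem_scaled[OF \<open>R > 0\<close>] by blast
    have "R * norm (real l *\<^sub>R \<alpha> + m) = norm (R *\<^sub>R (x + real l *\<^sub>R \<alpha> + m) - R *\<^sub>R x)"
      using \<open>R > 0\<close> by (simp add: abs_of_pos flip: scaleR_diff_right)
    also have "\<dots> \<le> \<Delta>" by (rule D(3)[OF m(3) x])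
    finally have "norm (real l *\<^sub>R \<alpha> + m) \<le> \<Delta> / R" using \<open>R > 0\<close> by (simp add: field_simps)
    also have "\<dots> \<le> \<Delta> / (c * real N)"
      using R N \<open>\<Delta> \<ge> 0\<close> \<open>R > 0\<close> by (intro divide_left_mono) auto
    finally have "norm (real l *\<^sub>R \<alpha> + m) \<le> \<Delta> / (c * real N)" .
    moreover have "norm (real l *\<^sub>R \<alpha> - real l *\<^sub>R \<beta>) \<le> 1 / real N" using close \<open>l \<le> n\<close> n(2) by simp
    moreover have "norm (real l *\<^sub>R \<beta> + m) \<le> norm (real l *\<^sub>R \<alpha> + m) + norm (real l *\<^sub>R \<alpha> - real l *\<^sub>R \<beta>)"
    proof -
      have "real l *\<^sub>R \<beta> + m = (real l *\<^sub>R \<alpha> + m) - (real l *\<^sub>R \<alpha> - real l *\<^sub>R \<beta>)" by simp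
      then show ?thesis by (metis norm_triangle_ineq4)
    qed
    ultimately have "norm (real l *\<^sub>R \<beta> + m) \<le> s" by (simp add: s_def add_divide_distrib)
    then show ?thesis unfolding T_def using m \<open>l \<le> n\<close> n(2) l_def by auto
  qed
  then have sub: "first_return \<alpha> ?D ` ?D \<subseteq> T" by blast
  have "\<forall>n\<in>T. \<exists>m\<in>int_lattice. norm (real n *\<^sub>R \<beta> + m) \<le> s" by (auto simp: T_def)
  then obtain m where m: "\<And>n. n \<in> T \<Longrightarrow> m n \<in> int_lattice \<and> norm (real n *\<^sub>R \<beta> + m n) \<le> s" by metis
  \<comment> \<open>The shift moves the coordinates into [0, 2s], as
    \<open>separated_card_le\<close> expects, and leaves differences unchanged.\<close>
  define f where "f n = (real n *\<^sub>R \<beta> + m n) + (\<chi> k. s)" for n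
  have "real (card T) \<le> ((real ?d + 1) * (2 * s) / (1 / (K * real N)) + 1) ^ ?d"
  proof (rule separated_card_le[where f = f])
    fix n k assume "n \<in> T"
    then have "\<bar>(real n *\<^sub>R \<beta> + m n) $ k\<bar> \<le> s" using m component_le_norm_cart order_trans by blast
    then show "0 \<le> f n $ k \<and> f n $ k \<le> 2 * s" by (auto simp: f_def abs_le_iff)
  next
    fix n n' assume nn: "n \<in> T" "n' \<in> T" "n \<noteq> n'"
    define \<gamma> where "\<gamma> = of_int (int n - int n') *\<^sub>R \<beta> + (m n - m n')"
    have "f n - f n' = \<gamma>" by (simp add: f_def \<gamma>_def algebra_simps)
    moreover have "\<gamma> \<in> ?G" unfolding \<gamma>_def using m nn by (intro rational_netI int_lattice_diff) auto
    moreover have "\<gamma> \<noteq> 0"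
    proof
      assume "\<gamma> = 0"
      then have "of_int (int n - int n') *\<^sub>R \<beta> = m n' - m n" by (simp add: \<gamma>_def algebra_simps)
      then have "int q dvd int n - int n'" using dvd m nn int_lattice_diff by metis
      moreover have "0 < \<bar>int n - int n'\<bar>" "\<bar>int n - int n'\<bar> < int q" using nn by (auto simp: T_def)
      ultimately show False using zdvd_not_zless[of "\<bar>int n - int n'\<bar>" "int q"] by simp
    qed
    ultimately show "1 / (K * real N) \<le> norm (f n - f n')" using sep by simp
  qed (use \<open>s > 0\<close> \<open>finite T\<close> \<open>0 < K\<close> N in auto)
  also have "(real ?d + 1) * (2 * s) / (1 / (K * real N)) = (real ?d + 1) * (2 * (\<Delta> / c + 1)) * K"
    using N by (simp add: s_def)
  finally have "real (card T) \<le> b" by (simp add: b_def)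
  then have "card T \<le> nat \<lfloor>b\<rfloor>" by linarith
  moreover have "finite (first_return \<alpha> ?D ` ?D)" "card (first_return \<alpha> ?D ` ?D) \<le> card T"
    using sub \<open>finite T\<close> finite_subset card_mono by blast+
  ultimately show ?thesis by (simp add: num_return_times_def Let_def)
qed

subsection \<open>Tubes around primitive net vectors\<close>

text \<open>The factor 2 counts the displacement from l\<theta> once directly and once through the
  change of length that it causes.\<close>

lemma normalize_diff_le:
  fixes \<theta> x :: "'a::real_normed_vector"
  assumes "norm \<theta> = 1" "0 < l" "x \<noteq> 0"
  shows "norm (x /\<^sub>R norm x - \<theta>) \<le> 2 * norm (x - l *\<^sub>R \<theta>) / l"
proof -
  have "l *\<^sub>R (x /\<^sub>R norm x - \<theta>) = (x - l *\<^sub>R \<theta>) + (l - norm x) *\<^sub>R (x /\<^sub>R norm x)"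
    using assms by (simp add: algebra_simps)
  then have "l * norm (x /\<^sub>R norm x - \<theta>) \<le> norm (x - l *\<^sub>R \<theta>) + norm ((l - norm x) *\<^sub>R (x /\<^sub>R norm x))"
    using assms(2) by (metis abs_of_pos norm_scaleR norm_triangle_ineq)
  also have "norm ((l - norm x) *\<^sub>R (x /\<^sub>R norm x)) = \<bar>norm (l *\<^sub>R \<theta>) - norm x\<bar>"
  proof -
    have "norm (x /\<^sub>R norm x) = 1" using assms by simp
    then show ?thesis using assms by (simp only: norm_scaleR abs_of_pos mult_1_right)
  qed
  also have "\<dots> \<le> norm (x - l *\<^sub>R \<theta>)"
    by (metis norm_minus_commute norm_triangle_ineq3)
  finally show ?thesis using assms(2) by (simp add: field_simps)
qed

text \<open>A net point near a long multiple of \<theta> has almost the direction of \<theta>. The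
  conditions on direction and length survive shrinking, so an essentially shortest net vector
  satisfying them is primitive.\<close>

lemma rational_net_primitive_in_cone:
  fixes \<theta> :: "real ^ 'n"
  assumes ga: "good_approx K N q \<beta> \<alpha>" and "0 < K" and "norm \<theta> = 1" "0 < \<eta>" "\<eta> \<le> 1"
  obtains \<gamma> where "\<gamma> \<in> rational_net \<beta>" "\<gamma> \<noteq> 0" "norm (\<gamma> /\<^sub>R norm \<gamma> - \<theta>) \<le> \<eta> / 4"
    "norm \<gamma> \<le> (8 / \<eta> + 1) * covering_const CARD('n) K / real N"
    "\<And>t. 0 < t \<Longrightarrow> t < 1 \<Longrightarrow> t *\<^sub>R \<gamma> \<notin> rational_net \<beta>"
proof -
  let ?G = "rational_net \<beta>" and ?C = "covering_const CARD('n) K"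
  have N: "0 < N" and sep: "\<And>\<gamma>. \<gamma> \<in> ?G \<Longrightarrow> \<gamma> \<noteq> 0 \<Longrightarrow> 1 / (K * real N) \<le> norm \<gamma>"
    using ga by (auto simp: good_approx_def)
  have "?C > 0" using \<open>0 < K\<close> unfolding covering_const_def
    by (intro divide_pos_pos zero_less_power add_nonneg_pos) auto
  \<comment> \<open>With this length the covering radius C/N equals (\<eta>/8) l, and normalising at
    most doubles the relative error, which gives \<eta>/4.\<close>
  define l where "l = 8 * ?C / (\<eta> * real N)"
  have "l > 0" using \<open>?C > 0\<close> assms N by (simp add: l_def)
  define S where "S = {\<gamma> \<in> ?G. \<gamma> \<noteq> 0 \<and> norm (\<gamma> /\<^sub>R norm \<gamma> - \<theta>) \<le> \<eta> / 4
    \<and> norm \<gamma> \<le> (8 / \<eta> + 1) * ?C / real N}"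
  obtain \<gamma>\<^sub>1 where \<gamma>\<^sub>1: "\<gamma>\<^sub>1 \<in> ?G" "norm (l *\<^sub>R \<theta> - \<gamma>\<^sub>1) < ?C / real N"
    by (rule rational_net_covering[OF ga \<open>0 < K\<close>])
  have Cl: "?C / real N = \<eta> / 8 * l" using assms N by (simp add: l_def)
  have nl: "norm (l *\<^sub>R \<theta>) = l" using assms \<open>l > 0\<close> by simp
  have "\<gamma>\<^sub>1 \<noteq> 0"
  proof
    assume "\<gamma>\<^sub>1 = 0"
    then have "l < \<eta> / 8 * l" using \<gamma>\<^sub>1(2) nl Cl by simp
    moreover have "\<eta> / 8 * l \<le> 1 * l" using assms \<open>l > 0\<close> by (intro mult_right_mono) auto
    ultimately show False by simp
  qed
  moreover have "norm (\<gamma>\<^sub>1 /\<^sub>R norm \<gamma>\<^sub>1 - \<theta>) \<le> \<eta> / 4"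
  proof -
    have "norm (\<gamma>\<^sub>1 /\<^sub>R norm \<gamma>\<^sub>1 - \<theta>) \<le> 2 * norm (\<gamma>\<^sub>1 - l *\<^sub>R \<theta>) / l"
      by (rule normalize_diff_le[OF \<open>norm \<theta> = 1\<close> \<open>l > 0\<close> \<open>\<gamma>\<^sub>1 \<noteq> 0\<close>])
    also have "\<dots> \<le> 2 * (\<eta> / 8 * l) / l"
      using \<gamma>\<^sub>1(2) \<open>l > 0\<close> by (intro divide_right_mono mult_left_mono) (auto simp: norm_minus_commute Cl)
    finally show ?thesis using \<open>l > 0\<close> by simp
  qed
  moreover have "norm \<gamma>\<^sub>1 \<le> (8 / \<eta> + 1) * ?C / real N"
  proof -
    have "norm \<gamma>\<^sub>1 \<le> norm (l *\<^sub>R \<theta>) + norm (l *\<^sub>R \<theta> - \<gamma>\<^sub>1)"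
      by (metis norm_minus_commute norm_triangle_sub)
    also have "\<dots> \<le> l + ?C / real N" using nl \<gamma>\<^sub>1(2) by linarith
    also have "\<dots> = (8 / \<eta> + 1) * ?C / real N" using assms N by (simp add: l_def field_simps)
    finally show ?thesis .
  qed
  ultimately have "\<gamma>\<^sub>1 \<in> S" using \<gamma>\<^sub>1 by (simp add: S_def)
  \<comment> \<open>Length rounded to an integer in units of the separation, so that a minimum
    exists. If \<gamma> and t\<gamma> are in the net, so is (1 - t)\<gamma>; hence t\<gamma> is
    shorter than \<gamma> by at least one unit and \<open>\<mu>\<close> drops.\<close>
  define \<mu> where "\<mu> \<gamma> = nat \<lfloor>norm \<gamma> * (K * real N)\<rfloor>" for \<gamma> :: "real ^ 'n"
  obtain \<gamma> where "\<gamma> \<in> S" and \<gamma>_min: "\<And>\<gamma>'. \<gamma>' \<in> S \<Longrightarrow> \<mu> \<gamma> \<le> \<mu> \<gamma>'"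
    using ex_has_least_nat[of "\<lambda>\<gamma>. \<gamma> \<in> S" \<gamma>\<^sub>1 \<mu>] \<open>\<gamma>\<^sub>1 \<in> S\<close> by blast
  have KN: "K * real N > 0" using \<open>0 < K\<close> N by simp
  have "t *\<^sub>R \<gamma> \<notin> ?G" if t: "0 < t" "t < 1" for t
  proof
    assume tG: "t *\<^sub>R \<gamma> \<in> ?G"
    have \<gamma>: "\<gamma> \<in> ?G" "\<gamma> \<noteq> 0" using \<open>\<gamma> \<in> S\<close> by (auto simp: S_def)
    have "(1 - t) *\<^sub>R \<gamma> \<in> ?G" using rational_net_diff[OF \<gamma>(1) tG] by (simp add: algebra_simps)
    then have "1 / (K * real N) \<le> norm ((1 - t) *\<^sub>R \<gamma>)" using t \<gamma> by (intro sep) auto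
    moreover have "norm ((1 - t) *\<^sub>R \<gamma>) = (1 - t) * norm \<gamma>" using t by (simp only: norm_scaleR)
    ultimately have 1: "1 \<le> (1 - t) * (norm \<gamma> * (K * real N))"
      by (simp only: pos_divide_le_eq[OF KN] mult.assoc)
    have "t *\<^sub>R \<gamma> \<in> S"
    proof -
      have "(t *\<^sub>R \<gamma>) /\<^sub>R norm (t *\<^sub>R \<gamma>) = \<gamma> /\<^sub>R norm \<gamma>" using t by simp
      moreover have "norm (t *\<^sub>R \<gamma>) \<le> norm \<gamma>" using t by (simp add: mult_left_le_one_le)
      moreover have "norm \<gamma> \<le> (8 / \<eta> + 1) * ?C / real N" "norm (\<gamma> /\<^sub>R norm \<gamma> - \<theta>) \<le> \<eta> / 4"
        using \<open>\<gamma> \<in> S\<close> by (auto simp: S_def)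
      moreover have "t *\<^sub>R \<gamma> \<noteq> 0" using t \<gamma> by simp
      ultimately show ?thesis using tG unfolding S_def mem_Collect_eq by (metis order_trans)
    qed
    then have "\<mu> \<gamma> \<le> \<mu> (t *\<^sub>R \<gamma>)" by (rule \<gamma>_min)
    moreover have "\<mu> (t *\<^sub>R \<gamma>) < \<mu> \<gamma>"
    proof -
      have "norm (t *\<^sub>R \<gamma>) * (K * real N) \<le> norm \<gamma> * (K * real N) - 1"
        using 1 t by (simp add: algebra_simps)
      then have "\<lfloor>norm (t *\<^sub>R \<gamma>) * (K * real N)\<rfloor> \<le> \<lfloor>norm \<gamma> * (K * real N)\<rfloor> - 1"
        by (metis floor_diff_one floor_mono)
      moreover have "0 \<le> \<lfloor>norm (t *\<^sub>R \<gamma>) * (K * real N)\<rfloor>" using KN by simp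
      ultimately show ?thesis unfolding \<mu>_def by linarith
    qed
    ultimately show False by simp
  qed
  then show thesis using that \<open>\<gamma> \<in> S\<close> by (auto simp: S_def)
qed

text \<open>Net points near the line through a primitive net point lie on the line: otherwise Dirichlet's
  theorem yields a nonzero net point that is too short.\<close>
lemma rational_net_near_line:
  fixes \<gamma> \<gamma>' :: "real ^ 'n"
  assumes ga: "good_approx K N q \<beta> \<alpha>" and "0 < K" and "0 < J"
    and \<gamma>: "\<gamma> \<in> rational_net \<beta>" "2 * K * real N * norm \<gamma> \<le> real J"
    and prim: "\<And>t. 0 < t \<Longrightarrow> t < 1 \<Longrightarrow> t *\<^sub>R \<gamma> \<notin> rational_net \<beta>"
    and \<gamma>': "\<gamma>' \<in> rational_net \<beta>" "norm (\<gamma>' - s *\<^sub>R \<gamma>) < 1 / (2 * K * real J * real N)"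
  obtains i :: int where "\<gamma>' = of_int i *\<^sub>R \<gamma>"
proof -
  let ?G = "rational_net \<beta>"
  have N: "0 < N" and sep: "\<And>\<gamma>. \<gamma> \<in> ?G \<Longrightarrow> \<gamma> \<noteq> 0 \<Longrightarrow> 1 / (K * real N) \<le> norm \<gamma>"
    using ga by (auto simp: good_approx_def)
  \<comment> \<open>In \<open>v\<close> below, the deviation of \<gamma>' from the line and the
    error of h/k as an approximation of \<open>s\<close> each contribute at most half the separation
    1/(K N), the former strictly less.\<close>
  obtain h k where hk: "0 < k" "k \<le> int J" "\<bar>of_int k * s - of_int h\<bar> < 1 / real J"
    using Dirichlet_approx[OF \<open>0 < J\<close>] by metis
  define v where "v = of_int k *\<^sub>R \<gamma>' - of_int h *\<^sub>R \<gamma>"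
  have "v \<in> ?G" unfolding v_def using \<gamma> \<gamma>' by (intro rational_net_diff rational_net_scale)
  have "v = of_int k *\<^sub>R (\<gamma>' - s *\<^sub>R \<gamma>) + (of_int k * s - of_int h) *\<^sub>R \<gamma>"
    by (simp add: v_def algebra_simps)
  then have "norm v \<le> of_int k * norm (\<gamma>' - s *\<^sub>R \<gamma>) + \<bar>of_int k * s - of_int h\<bar> * norm \<gamma>"
    using hk(1) norm_triangle_ineq[of "of_int k *\<^sub>R (\<gamma>' - s *\<^sub>R \<gamma>)" "(of_int k * s - of_int h) *\<^sub>R \<gamma>"] by simp
  also have "\<dots> < 1 / (2 * K * real N) + 1 / (2 * K * real N)"
  proof (rule add_less_le_mono)
    have "of_int k * norm (\<gamma>' - s *\<^sub>R \<gamma>) < of_int k * (1 / (2 * K * real J * real N))"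
      using hk(1) \<gamma>'(2) by (intro mult_strict_left_mono) auto
    also have "\<dots> \<le> real J * (1 / (2 * K * real J * real N))"
      using hk(2) \<open>0 < K\<close> by (intro mult_right_mono) auto
    also have "\<dots> = 1 / (2 * K * real N)" using \<open>0 < J\<close> by simp
    finally show "of_int k * norm (\<gamma>' - s *\<^sub>R \<gamma>) < 1 / (2 * K * real N)" .
    have "\<bar>of_int k * s - of_int h\<bar> * norm \<gamma> \<le> 1 / real J * norm \<gamma>"
      using hk(3) by (intro mult_right_mono) auto
    also have "\<dots> \<le> 1 / (2 * K * real N)"
      using \<gamma>(2) \<open>0 < K\<close> \<open>0 < J\<close> N by (simp add: field_simps)
    finally show "\<bar>of_int k * s - of_int h\<bar> * norm \<gamma> \<le> 1 / (2 * K * real N)" .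
  qed
  also have "\<dots> = 1 / (K * real N)" by (simp add: field_simps)
  finally have "v = 0" using sep[OF \<open>v \<in> ?G\<close>] by linarith
  then have eq: "of_int k *\<^sub>R \<gamma>' = of_int h *\<^sub>R \<gamma>" by (simp add: v_def)
  define x where "x = real_of_int h / of_int k"
  have \<gamma>'_eq: "\<gamma>' = x *\<^sub>R \<gamma>"
  proof -
    have "\<gamma>' = (1 / of_int k) *\<^sub>R (of_int k *\<^sub>R \<gamma>')" using hk(1) by simp
    then show ?thesis unfolding eq by (simp add: x_def)
  qed
  \<comment> \<open>Removing the integer part leaves a net point on the segment from 0 to \<gamma>,
    which primitivity allows only at 0.\<close>
  then have "frac x *\<^sub>R \<gamma> = \<gamma>' - of_int \<lfloor>x\<rfloor> *\<^sub>R \<gamma>" by (simp add: frac_def algebra_simps)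
  then have "frac x *\<^sub>R \<gamma> \<in> ?G" using \<gamma> \<gamma>' by (auto intro!: rational_net_diff rational_net_scale)
  then have "frac x = 0" using prim[of "frac x"] frac_ge_0[of x] frac_lt_1[of x] by fastforce
  then have "\<gamma>' = of_int \<lfloor>x\<rfloor> *\<^sub>R \<gamma>" using \<gamma>'_eq by (simp add: frac_def)
  then show thesis by (rule that)
qed

text \<open>The rotation drifts by \<open>e\<close> every \<open>q\<close> steps, roughly in direction \<open>\<theta>\<close>, until it
  comes back through \<open>w\<close> after about \<open>M\<close> drifts; there are no other short vectors up to that time.\<close>
definition tube_return :: "real ^ 'n \<Rightarrow> real \<Rightarrow> real ^ 'n \<Rightarrow> real \<Rightarrow> real \<Rightarrow> bool" where
  "tube_return \<alpha> R \<theta> \<eta> \<Delta> \<longleftrightarrow> (\<exists>q n\<^sub>2 M :: nat. \<exists>p m\<^sub>2 e w. 0 < q \<and> p \<in> int_lattice \<and> m\<^sub>2 \<in> int_lattice \<and>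
     e = R *\<^sub>R (real q *\<^sub>R \<alpha> + p) \<and> w = R *\<^sub>R (real n\<^sub>2 *\<^sub>R \<alpha> + m\<^sub>2) \<and>
     norm e < \<eta> \<and> norm (e /\<^sub>R norm e - \<theta>) < \<eta> \<and> norm (w + real M *\<^sub>R e) < \<eta> \<and>
     \<Delta> + 1 < real M * norm e \<and>
     (\<forall>n m. 1 \<le> n \<longrightarrow> n \<le> n\<^sub>2 + M * q \<longrightarrow> m \<in> int_lattice \<longrightarrow> norm (R *\<^sub>R (real n *\<^sub>R \<alpha> + m)) \<le> \<Delta> \<longrightarrow>
        (\<exists>k. n = k * q \<and> m = real k *\<^sub>R p) \<or> (\<exists>k. n = n\<^sub>2 + k * q \<and> m = m\<^sub>2 + real k *\<^sub>R p)))"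

text \<open>The constants are chosen in the order \<open>J\<close>, \<open>R\<^sub>0\<close>,
  \<open>M\<close>, \<open>c\<close>, and no condition on them involves \<open>N\<close> or
  \<open>q\<close>. \<open>J\<close> is what \<open>rational_net_near_line\<close> needs for a
  vector of length L/N. \<open>R\<^sub>0\<close> puts vectors of scaled length at most \<Delta>
  within the tolerance of that lemma. \<open>M\<close> makes one drift shorter than \<eta>.
  \<open>c\<close> keeps the perturbation harmless over (M + 1) q steps.\<close>

lemma tube_returnI:
  fixes \<alpha> :: "real ^ 'n"
  assumes ga: "good_approx K N q \<beta> \<alpha>" and K: "1 \<le> K" and \<eta>: "0 < \<eta>" "\<eta> \<le> 1" and "0 < \<Delta>"
    and \<gamma>: "\<gamma> \<in> rational_net \<beta>" "\<gamma> \<noteq> 0" "norm (\<gamma> /\<^sub>R norm \<gamma> - \<theta>) \<le> \<eta> / 4" "norm \<gamma> \<le> L / real N"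
      "\<And>t. 0 < t \<Longrightarrow> t < 1 \<Longrightarrow> t *\<^sub>R \<gamma> \<notin> rational_net \<beta>"
    and J: "0 < J" "2 * K * L \<le> real J"
    and R0: "R\<^sub>0 = 8 * K * real J * (\<Delta> + 4)"
    and M: "2 \<le> M" "16 * R\<^sub>0 * L / \<eta> \<le> real M"
    and c: "c = \<eta> / (16 * R\<^sub>0 * (real M + 1) * K * real J)"
    and \<alpha>': "norm (\<alpha>' - (\<beta> + (1 / (real M * real q)) *\<^sub>R \<gamma>)) < c / (real N * real q)"
    and R: "R\<^sub>0 * real N \<le> R" "R \<le> 2 * R\<^sub>0 * real N"
  shows "tube_return \<alpha>' R \<theta> \<eta> \<Delta>"
proof -
  let ?G = "rational_net \<beta>"
  have N: "0 < N" "0 < q"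
    and dvd: "\<And>n::int. of_int n *\<^sub>R \<beta> \<in> int_lattice \<longleftrightarrow> int q dvd n"
    and sep: "\<And>\<gamma>. \<gamma> \<in> ?G \<Longrightarrow> \<gamma> \<noteq> 0 \<Longrightarrow> 1 / (K * real N) \<le> norm \<gamma>"
    using ga by (auto simp: good_approx_def)
  have "norm \<gamma> > 0" using \<gamma> by simp
  then have "L > 0" using \<gamma>(4) N by (smt (verit) divide_nonpos_pos of_nat_0_less_iff)
  have Jr: "1 \<le> real J" using J by simp
  have KJ: "1 \<le> K * real J" using K Jr by (metis mult_1 mult_mono' order_trans zero_le_one)
  have R0': "32 \<le> R\<^sub>0"
  proof -
    have "8 * 1 * 4 \<le> 8 * (K * real J) * (\<Delta> + 4)" using KJ \<open>0 < \<Delta>\<close> by (intro mult_mono) auto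
    then show ?thesis by (simp add: R0)
  qed
  have Mr: "real M \<ge> 2" using M by simp
  have "c > 0" using \<eta> R0' K Jr by (simp add: c)
  have c_eq: "16 * R\<^sub>0 * (real M + 1) * K * real J * c = \<eta>" using R0' K Jr by (simp add: c)
  have i1: "2 * R\<^sub>0 * L / real M \<le> \<eta> / 8" using M(2) Mr \<eta> by (simp add: field_simps)
  have i2: "2 * R\<^sub>0 * ((real M + 1) * c) \<le> \<eta> / 8"
  proof -
    have "2 * R\<^sub>0 * ((real M + 1) * c) * 1 \<le> 2 * R\<^sub>0 * ((real M + 1) * c) * (K * real J)"
      using KJ R0' \<open>c > 0\<close> by (intro mult_left_mono) auto
    also have "\<dots> = \<eta> / 8" using c_eq by (simp add: algebra_simps)
    finally show ?thesis by simp
  qed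
  have KMc: "K * real J * ((real M + 1) * c) \<le> 1 / 512"
  proof -
    have "512 * (K * real J * ((real M + 1) * c)) \<le> 16 * R\<^sub>0 * (K * real J * ((real M + 1) * c))"
      using R0' K Jr \<open>c > 0\<close> by (intro mult_right_mono) auto
    also have "\<dots> \<le> 1" using c_eq \<eta>(2) by (simp add: algebra_simps)
    finally show ?thesis by simp
  qed
  have i3: "K * (real M * c) \<le> \<eta> / 512"
  proof -
    have "512 * (K * (real M * c)) \<le> 16 * R\<^sub>0 * (K * real J * ((real M + 1) * c))"
    proof (rule mult_mono)
      show "K * (real M * c) \<le> K * real J * ((real M + 1) * c)"
        using K Jr \<open>c > 0\<close> by (intro mult_mono) auto
    qed (use R0' K Jr \<open>c > 0\<close> in auto)
    also have "\<dots> = \<eta>" using c_eq by (simp add: algebra_simps)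
    finally show ?thesis by simp
  qed
  have \<gamma>_ge: "1 / (K * real N) \<le> norm \<gamma>" using sep \<gamma> by simp
  have \<gamma>_ge': "1 \<le> K * real N * norm \<gamma>" using \<gamma>_ge K N by (simp add: field_simps)
  have \<gamma>_le: "real N * norm \<gamma> \<le> L" using \<gamma>(4) N by (simp add: field_simps)
  have "R > 0" using R R0' N by (smt (verit) mult_pos_pos of_nat_0_less_iff)
  \<comment> \<open>\<alpha>' is \<beta> plus the drift \<omega> plus an error \<epsilon>. Over
    \<open>q\<close> steps \<omega> adds up to \<gamma>/M, over M q steps to all of
    \<gamma>.\<close>
  define \<omega> where "\<omega> = (1 / (real M * real q)) *\<^sub>R \<gamma>"
  define \<epsilon> where "\<epsilon> = \<alpha>' - (\<beta> + \<omega>)"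
  have \<alpha>'_eq: "\<alpha>' = \<beta> + \<omega> + \<epsilon>" by (simp add: \<epsilon>_def)
  have \<epsilon>: "real N * (real q * norm \<epsilon>) < c" using \<alpha>' N by (simp add: \<epsilon>_def \<omega>_def field_simps)
  have n\<epsilon>: "real N * norm (real n *\<^sub>R \<epsilon>) \<le> (real M + 1) * c" if "n \<le> (M + 1) * q" for n
  proof -
    have "real n \<le> real ((M + 1) * q)" using that by (simp only: of_nat_le_iff)
    then have "real N * (real n * norm \<epsilon>) \<le> real N * (real ((M + 1) * q) * norm \<epsilon>)"
      by (intro mult_left_mono mult_right_mono) auto
    also have "\<dots> = (real M + 1) * (real N * (real q * norm \<epsilon>))" by (simp add: algebra_simps)
    also have "\<dots> \<le> (real M + 1) * c" using \<epsilon> by (intro mult_left_mono) auto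
    finally show ?thesis by simp
  qed
  have q\<omega>: "real q *\<^sub>R \<omega> = (1 / real M) *\<^sub>R \<gamma>" using N by (simp add: \<omega>_def)
  define p where "p = - (real q *\<^sub>R \<beta>)"
  have p: "p \<in> int_lattice" unfolding p_def using dvd[of "int q"] int_lattice_minus by simp
  have "- \<gamma> \<in> ?G" using \<gamma>(1) by (rule rational_net_minus)
  then obtain k0 m0 where k0: "m0 \<in> int_lattice" "- \<gamma> = of_int k0 *\<^sub>R \<beta> + m0"
    unfolding rational_net_def by blast
  \<comment> \<open>At this time below \<open>q\<close> the rotation by \<beta> jumps to -\<gamma>;
    the next \<open>M\<close> drifts compensate the jump.\<close>
  define n\<^sub>2 where "n\<^sub>2 = nat (k0 mod int q)"
  define m\<^sub>2 where "m\<^sub>2 = m0 + of_int (k0 - int n\<^sub>2) *\<^sub>R \<beta>"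
  have n\<^sub>2: "n\<^sub>2 < q" "int q dvd k0 - int n\<^sub>2"
    using N by (auto simp: n\<^sub>2_def nat_less_iff minus_mod_eq_mult_div)
  have m\<^sub>2: "m\<^sub>2 \<in> int_lattice" unfolding m\<^sub>2_def using k0(1) n\<^sub>2(2) dvd int_lattice_add by blast
  have \<gamma>_eq: "- \<gamma> = real n\<^sub>2 *\<^sub>R \<beta> + m\<^sub>2" by (simp add: k0(2) m\<^sub>2_def algebra_simps)
  define e where "e = R *\<^sub>R (real q *\<^sub>R \<alpha>' + p)"
  define w where "w = R *\<^sub>R (real n\<^sub>2 *\<^sub>R \<alpha>' + m\<^sub>2)"
  have e0: "real q *\<^sub>R \<alpha>' + p = (1 / real M) *\<^sub>R \<gamma> + real q *\<^sub>R \<epsilon>"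
    by (simp add: \<alpha>'_eq p_def q\<omega> scaleR_add_right)
  have w0: "real n\<^sub>2 *\<^sub>R \<alpha>' + m\<^sub>2 = - \<gamma> + (real n\<^sub>2 *\<^sub>R \<omega> + real n\<^sub>2 *\<^sub>R \<epsilon>)"
    by (simp add: \<alpha>'_eq \<gamma>_eq scaleR_add_right)
  \<comment> \<open>\<open>Rle\<close> and \<open>Rge\<close> turn bounds in units of 1/N into
    bounds at the scale \<open>R\<close>, one for each end of the window for
    \<open>R\<close>.\<close>
  have Rle: "R * x \<le> 2 * R\<^sub>0 * y" if "real N * x \<le> y" "0 \<le> x" for x y
  proof -
    have "R * x \<le> (2 * R\<^sub>0 * real N) * x" using R(2) that(2) by (rule mult_right_mono)
    also have "\<dots> = 2 * R\<^sub>0 * (real N * x)" by simp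
    also have "\<dots> \<le> 2 * R\<^sub>0 * y" using that(1) R0' by (intro mult_left_mono) auto
    finally show ?thesis .
  qed
  have Rge: "R\<^sub>0 * y \<le> R * x" if "y \<le> real N * x" "0 \<le> x" for x y
  proof -
    have "R\<^sub>0 * y \<le> R\<^sub>0 * (real N * x)" using that(1) R0' by (intro mult_left_mono) auto
    also have "\<dots> = (R\<^sub>0 * real N) * x" by simp
    also have "\<dots> \<le> R * x" using R(1) that(2) by (rule mult_right_mono)
    finally show ?thesis .
  qed
  have q\<epsilon>: "real N * norm (real q *\<^sub>R \<epsilon>) \<le> c" using \<epsilon> by simp
  have "norm e < \<eta>"
  proof -
    have "norm (real q *\<^sub>R \<alpha>' + p) \<le> norm \<gamma> / real M + norm (real q *\<^sub>R \<epsilon>)"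
      unfolding e0 by (rule order_trans[OF norm_triangle_ineq]) simp
    then have "real N * norm (real q *\<^sub>R \<alpha>' + p) \<le> real N * (norm \<gamma> / real M + norm (real q *\<^sub>R \<epsilon>))"
      by (rule mult_left_mono) simp
    also have "\<dots> = (real N * norm \<gamma>) / real M + real N * norm (real q *\<^sub>R \<epsilon>)" by (simp add: algebra_simps)
    also have "\<dots> \<le> L / real M + (real M + 1) * c"
      using \<gamma>_le n\<epsilon>[of q] by (intro add_mono divide_right_mono) auto
    finally have "norm e \<le> 2 * R\<^sub>0 * (L / real M + (real M + 1) * c)"
      unfolding e_def using Rle \<open>R > 0\<close> by simp
    also have "\<dots> = 2 * R\<^sub>0 * L / real M + 2 * R\<^sub>0 * ((real M + 1) * c)" by (simp add: algebra_simps)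
    also have "\<dots> < \<eta>" using i1 i2 \<eta> by linarith
    finally show ?thesis .
  qed
  moreover have Me: "\<Delta> + 1 < real M * norm e"
  proof -
    have "real M *\<^sub>R (real q *\<^sub>R \<alpha>' + p) = \<gamma> + real M *\<^sub>R (real q *\<^sub>R \<epsilon>)"
      using Mr by (simp add: e0 scaleR_add_right)
    then have "norm \<gamma> \<le> real M * norm (real q *\<^sub>R \<alpha>' + p) + real M * norm (real q *\<^sub>R \<epsilon>)"
      by (metis add_diff_cancel_right' norm_scaleR norm_triangle_ineq4 abs_of_nat)
    then have "K * real N * norm \<gamma> \<le> K * real N * (real M * norm (real q *\<^sub>R \<alpha>' + p) + real M * norm (real q *\<^sub>R \<epsilon>))"
      using K by (intro mult_left_mono) auto
    also have "\<dots> = K * (real N * (real M * norm (real q *\<^sub>R \<alpha>' + p))) + K * (real M * (real N * norm (real q *\<^sub>R \<epsilon>)))"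
      by (simp add: algebra_simps)
    also have "K * (real M * (real N * norm (real q *\<^sub>R \<epsilon>))) \<le> K * (real M * c)"
      using q\<epsilon> K by (intro mult_left_mono) auto
    finally have "1 / 2 \<le> K * (real N * (real M * norm (real q *\<^sub>R \<alpha>' + p)))"
      using \<gamma>_ge' i3 \<eta> by linarith
    then have "1 / (2 * K) \<le> real N * (real M * norm (real q *\<^sub>R \<alpha>' + p))" using K by (simp add: field_simps)
    then have "R\<^sub>0 * (1 / (2 * K)) \<le> R * (real M * norm (real q *\<^sub>R \<alpha>' + p))" by (intro Rge) auto
    also have "\<dots> = real M * norm e" using \<open>R > 0\<close> by (simp add: e_def)
    also have "R\<^sub>0 * (1 / (2 * K)) = 4 * real J * (\<Delta> + 4)" using K by (simp add: R0)
    finally have *: "4 * real J * (\<Delta> + 4) \<le> real M * norm e" .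
    have "4 * 1 * (\<Delta> + 4) \<le> 4 * real J * (\<Delta> + 4)" using Jr \<open>0 < \<Delta>\<close> by (intro mult_right_mono mult_left_mono) auto
    then have "4 * 1 * (\<Delta> + 4) \<le> real M * norm e" using * by (rule order_trans)
    then show ?thesis using \<open>0 < \<Delta>\<close> by simp
  qed
  moreover have "norm (e /\<^sub>R norm e - \<theta>) < \<eta>"
  proof -
    define v where "v = real q *\<^sub>R \<alpha>' + p"
    have "e \<noteq> 0" using Me \<open>0 < \<Delta>\<close> by auto
    then have "v \<noteq> 0" by (auto simp: e_def v_def)
    have "e /\<^sub>R norm e = v /\<^sub>R norm v" using \<open>R > 0\<close> by (simp add: e_def v_def[symmetric])
    have "norm (v /\<^sub>R norm v - \<gamma> /\<^sub>R norm \<gamma>) \<le> 2 * norm (v - (norm \<gamma> / real M) *\<^sub>R (\<gamma> /\<^sub>R norm \<gamma>)) / (norm \<gamma> / real M)"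
      using \<gamma>(2) Mr \<open>v \<noteq> 0\<close> by (intro normalize_diff_le) auto
    also have "v - (norm \<gamma> / real M) *\<^sub>R (\<gamma> /\<^sub>R norm \<gamma>) = real q *\<^sub>R \<epsilon>"
      using \<gamma>(2) by (simp add: v_def e0)
    also have "2 * norm (real q *\<^sub>R \<epsilon>) / (norm \<gamma> / real M) \<le> 2 * K * (real M * c)"
    proof -
      have "norm (real q *\<^sub>R \<epsilon>) * 1 \<le> norm (real q *\<^sub>R \<epsilon>) * (K * real N * norm \<gamma>)"
        using \<gamma>_ge' by (intro mult_left_mono) auto
      also have "\<dots> = K * norm \<gamma> * (real N * norm (real q *\<^sub>R \<epsilon>))" by (simp add: algebra_simps)
      also have "\<dots> \<le> K * norm \<gamma> * c" using q\<epsilon> K by (intro mult_left_mono) auto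
      finally have "norm (real q *\<^sub>R \<epsilon>) \<le> K * norm \<gamma> * c" by simp
      then have "2 * norm (real q *\<^sub>R \<epsilon>) / (norm \<gamma> / real M) \<le> 2 * (K * norm \<gamma> * c) / (norm \<gamma> / real M)"
        by (intro divide_right_mono mult_left_mono) auto
      also have "\<dots> = 2 * K * (real M * c)" using \<gamma>(2) by simp
      finally show ?thesis .
    qed
    finally have *: "norm (v /\<^sub>R norm v - \<gamma> /\<^sub>R norm \<gamma>) \<le> \<eta> / 8" using i3 \<eta> by linarith
    have "norm (v /\<^sub>R norm v - \<theta>) \<le> norm (v /\<^sub>R norm v - \<gamma> /\<^sub>R norm \<gamma>) + norm (\<gamma> /\<^sub>R norm \<gamma> - \<theta>)"
      using norm_triangle_ineq[of "v /\<^sub>R norm v - \<gamma> /\<^sub>R norm \<gamma>" "\<gamma> /\<^sub>R norm \<gamma> - \<theta>"] by simp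
    then show ?thesis unfolding \<open>e /\<^sub>R norm e = v /\<^sub>R norm v\<close> using * \<gamma>(3) \<eta> by linarith
  qed
  moreover have "norm (w + real M *\<^sub>R e) < \<eta>"
  proof -
    \<comment> \<open>The jump by -\<gamma> and \<open>M\<close> drifts cancel. What remains is the
      part of \<omega> gathered during the first \<open>n\<^sub>2\<close> < \<open>q\<close> steps,
      less than one drift, and the accumulated error.\<close>
    define u where "u = real n\<^sub>2 *\<^sub>R \<omega> + (real (n\<^sub>2 + M * q)) *\<^sub>R \<epsilon>"
    have "w + real M *\<^sub>R e = R *\<^sub>R ((real n\<^sub>2 *\<^sub>R \<alpha>' + m\<^sub>2) + real M *\<^sub>R (real q *\<^sub>R \<alpha>' + p))"
      by (simp only: e_def w_def scaleR_add_right scaleR_left_commute)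
    also have "(real n\<^sub>2 *\<^sub>R \<alpha>' + m\<^sub>2) + real M *\<^sub>R (real q *\<^sub>R \<alpha>' + p) = u"
      unfolding e0 w0 u_def using Mr by (simp add: scaleR_add_right scaleR_add_left)
    finally have eq: "norm (w + real M *\<^sub>R e) = R * norm u" using \<open>R > 0\<close> by simp
    have "norm u \<le> norm (real n\<^sub>2 *\<^sub>R \<omega>) + norm (real (n\<^sub>2 + M * q) *\<^sub>R \<epsilon>)"
      unfolding u_def by (rule norm_triangle_ineq)
    also have "norm (real n\<^sub>2 *\<^sub>R \<omega>) \<le> norm (real q *\<^sub>R \<omega>)"
      using n\<^sub>2(1) by (simp add: mult_right_mono)
    also have "norm (real q *\<^sub>R \<omega>) = norm \<gamma> / real M" by (simp add: q\<omega>)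
    finally have "real N * norm u \<le> real N * (norm \<gamma> / real M + norm (real (n\<^sub>2 + M * q) *\<^sub>R \<epsilon>))"
      by (intro mult_left_mono) auto
    also have "\<dots> = (real N * norm \<gamma>) / real M + real N * norm (real (n\<^sub>2 + M * q) *\<^sub>R \<epsilon>)" by (simp add: algebra_simps)
    also have "\<dots> \<le> L / real M + (real M + 1) * c"
      using \<gamma>_le n\<epsilon>[of "n\<^sub>2 + M * q"] n\<^sub>2(1) by (intro add_mono divide_right_mono) auto
    finally have "R * norm u \<le> 2 * R\<^sub>0 * (L / real M + (real M + 1) * c)" by (rule Rle) simp
    also have "\<dots> = 2 * R\<^sub>0 * L / real M + 2 * R\<^sub>0 * ((real M + 1) * c)" by (simp add: algebra_simps)
    also have "\<dots> < \<eta>" using i1 i2 \<eta> by linarith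
    finally show ?thesis by (simp add: eq)
  qed
  moreover have "(\<exists>k. n = k * q \<and> m = real k *\<^sub>R p) \<or> (\<exists>k. n = n\<^sub>2 + k * q \<and> m = m\<^sub>2 + real k *\<^sub>R p)"
    if n: "1 \<le> n" "n \<le> n\<^sub>2 + M * q" and m: "m \<in> int_lattice" and short: "norm (R *\<^sub>R (real n *\<^sub>R \<alpha>' + m)) \<le> \<Delta>" for n m
  proof -
    \<comment> \<open>The fraction of \<gamma> covered by the drift after \<open>n\<close> steps, at
      most (M + 1)/M <= 3/2. If the displacement by \<alpha>' is short, its \<beta>-part must lie
      near -t\<gamma>.\<close>
    define t where "t = real n / (real M * real q)"
    define \<gamma>' where "\<gamma>' = real n *\<^sub>R \<beta> + m"
    have nle: "n \<le> (M + 1) * q" using n n\<^sub>2(1) by simp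
    have "t > 0" using n N Mr by (simp add: t_def)
    have "t \<le> 3 / 2"
    proof -
      have "real n \<le> (real M + 1) * real q"
        using nle by (metis of_nat_1 of_nat_add of_nat_le_iff of_nat_mult)
      also have "\<dots> \<le> (3 / 2 * real M) * real q" using Mr by (intro mult_right_mono) auto
      finally show ?thesis using N Mr by (simp add: t_def field_simps)
    qed
    have "\<gamma>' \<in> ?G" unfolding \<gamma>'_def using m by (rule rational_netI_nat)
    have near: "K * real J * (real N * norm (\<gamma>' - (- t) *\<^sub>R \<gamma>)) \<le> 3 / 8"
    proof -
      have "\<gamma>' - (- t) *\<^sub>R \<gamma> = (real n *\<^sub>R \<alpha>' + m) - real n *\<^sub>R \<epsilon>"
        by (simp add: \<gamma>'_def t_def \<alpha>'_eq \<omega>_def scaleR_add_right)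
      then have "norm (\<gamma>' - (- t) *\<^sub>R \<gamma>) \<le> norm (real n *\<^sub>R \<alpha>' + m) + norm (real n *\<^sub>R \<epsilon>)"
        by (metis norm_triangle_ineq4)
      then have "K * real J * (real N * norm (\<gamma>' - (- t) *\<^sub>R \<gamma>)) \<le> K * real J * (real N * (norm (real n *\<^sub>R \<alpha>' + m) + norm (real n *\<^sub>R \<epsilon>)))"
        using K by (intro mult_left_mono) auto
      also have "\<dots> = K * real J * (real N * norm (real n *\<^sub>R \<alpha>' + m)) + K * real J * (real N * norm (real n *\<^sub>R \<epsilon>))"
        by (simp add: algebra_simps)
      also have "K * real J * (real N * norm (real n *\<^sub>R \<epsilon>)) \<le> K * real J * ((real M + 1) * c)"
        using n\<epsilon>[OF nle] K by (intro mult_left_mono) auto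
      also have "K * real J * (real N * norm (real n *\<^sub>R \<alpha>' + m)) \<le> 1 / 8"
      proof -
        have "R\<^sub>0 * (real N * norm (real n *\<^sub>R \<alpha>' + m)) \<le> R * norm (real n *\<^sub>R \<alpha>' + m)" by (rule Rge) auto
        also have "\<dots> \<le> \<Delta> + 4" using short \<open>R > 0\<close> by simp
        finally have "8 * (K * real J * (real N * norm (real n *\<^sub>R \<alpha>' + m))) * (\<Delta> + 4) \<le> 1 * (\<Delta> + 4)"
          by (simp add: R0 algebra_simps)
        then have "8 * (K * real J * (real N * norm (real n *\<^sub>R \<alpha>' + m))) \<le> 1"
          using \<open>0 < \<Delta>\<close> by (simp only: mult_le_cancel_right_pos add_pos_pos zero_less_numeral)
        then show ?thesis by simp
      qed
      finally show ?thesis using KMc by linarith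
    qed
    have "norm (\<gamma>' - (- t) *\<^sub>R \<gamma>) < 1 / (2 * K * real J * real N)"
    proof -
      have "(2 * K * real J * real N) * norm (\<gamma>' - (- t) *\<^sub>R \<gamma>) < 1" using near by (simp add: algebra_simps)
      then show ?thesis using K Jr N by (simp add: field_simps)
    qed
    moreover have "2 * K * real N * norm \<gamma> \<le> real J"
    proof -
      have "2 * K * (real N * norm \<gamma>) \<le> 2 * K * L" using \<gamma>_le K by (intro mult_left_mono) auto
      then show ?thesis using J(2) by (simp add: algebra_simps)
    qed
    ultimately obtain i where i: "\<gamma>' = of_int i *\<^sub>R \<gamma>"
      using rational_net_near_line[OF ga _ J(1) \<gamma>(1) _ \<gamma>(5) \<open>\<gamma>' \<in> ?G\<close>] K by (metis less_le_trans zero_less_one)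
    have "\<bar>of_int i + t\<bar> \<le> 3 / 8"
    proof -
      have "\<gamma>' - (- t) *\<^sub>R \<gamma> = (of_int i + t) *\<^sub>R \<gamma>" by (simp add: i scaleR_add_left)
      then have "K * real J * (real N * (\<bar>of_int i + t\<bar> * norm \<gamma>)) \<le> 3 / 8" using near by simp
      moreover have "1 * \<bar>of_int i + t\<bar> \<le> (real J * (K * real N * norm \<gamma>)) * \<bar>of_int i + t\<bar>"
        using Jr \<gamma>_ge' by (intro mult_right_mono) (metis mult_1 mult_mono' order_trans zero_le_one, simp)
      ultimately show ?thesis by (simp add: algebra_simps)
    qed
    \<comment> \<open>Since \<open>i\<close> is within 3/8 of -t, only 0 and -1 are possible: pure
      drift, or the jump followed by drift.\<close>
    then have "real_of_int i < 1" "- 2 < real_of_int i" using \<open>t > 0\<close> \<open>t \<le> 3 / 2\<close> by linarith+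
    then have "i = 0 \<or> i = - 1" by linarith
    then show ?thesis
    proof
      assume "i = 0"
      then have mn: "m = - (real n *\<^sub>R \<beta>)" using i by (simp add: \<gamma>'_def add_eq_0_iff)
      then have "of_int (int n) *\<^sub>R \<beta> \<in> int_lattice" using m int_lattice_minus[of m] by simp
      then have "q dvd n" using dvd by (metis int_dvd_int_iff)
      then obtain k where k: "n = k * q" by (metis dvd_def mult.commute)
      moreover have "m = real k *\<^sub>R p" by (simp add: mn k p_def)
      ultimately show ?thesis by blast
    next
      assume "i = - 1"
      then have "real n *\<^sub>R \<beta> + m = real n\<^sub>2 *\<^sub>R \<beta> + m\<^sub>2" using i \<gamma>_eq by (simp add: \<gamma>'_def)
      then have eq: "of_int (int n - int n\<^sub>2) *\<^sub>R \<beta> = m\<^sub>2 - m" by (simp add: algebra_simps)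
      then have "int q dvd int n - int n\<^sub>2" using dvd m m\<^sub>2 int_lattice_diff by metis
      then obtain k where k: "int n - int n\<^sub>2 = int q * k" by (auto elim: dvdE)
      have "k \<ge> 0"
      proof (rule ccontr)
        assume "\<not> k \<ge> 0"
        then have "int q * k \<le> int q * (- 1)" by (intro mult_left_mono) auto
        then show False using k n\<^sub>2(1) n(1) by linarith
      qed
      then have "int n = int (n\<^sub>2 + nat k * q)" using k by (simp add: mult.commute)
      then have n_eq: "n = n\<^sub>2 + nat k * q" by (simp only: of_nat_eq_iff)
      have "m\<^sub>2 - m = real (nat k) *\<^sub>R (real q *\<^sub>R \<beta>)" by (simp add: eq[symmetric] n_eq)
      then have "m = m\<^sub>2 + real (nat k) *\<^sub>R p" by (simp add: p_def algebra_simps)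
      then show ?thesis using n_eq by blast
    qed
  qed
  ultimately show ?thesis unfolding tube_return_def using N(2) p m\<^sub>2 e_def w_def by blast
qed

subsection \<open>Chords of convex bodies\<close>

text \<open>The part of the chord ahead of \<open>p\<close>: for compact \<open>C\<close>,
  \<open>p\<close> in \<open>C\<close> and a unit vector \<theta>, the chord through
  \<open>p\<close> has length \<open>reach C \<theta> p + reach C (- \<theta>) p\<close>.\<close>

definition reach :: "'a::euclidean_space set \<Rightarrow> 'a \<Rightarrow> 'a \<Rightarrow> real" where
  "reach C \<theta> p = Sup {s. p + s *\<^sub>R \<theta> \<in> C}"

lemma reach_mem:
  fixes C :: "'a::euclidean_space set"
  assumes "compact C" "p \<in> C" "norm \<theta> = 1"
  shows "p + reach C \<theta> p *\<^sub>R \<theta> \<in> C" and "p + s *\<^sub>R \<theta> \<in> C \<Longrightarrow> s \<le> reach C \<theta> p" and "0 \<le> reach C \<theta> p"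
proof -
  let ?A = "{s. p + s *\<^sub>R \<theta> \<in> C}"
  have "closed ((\<lambda>s. p + s *\<^sub>R \<theta>) -` C)"
    using compact_imp_closed[OF assms(1)] by (intro closed_vimage continuous_intros)
  then have "closed ?A" by (simp add: vimage_def)
  moreover have "bounded ?A"
  proof -
    obtain B where B: "\<And>x. x \<in> C \<Longrightarrow> norm x \<le> B" using compact_imp_bounded[OF assms(1)] bounded_iff by metis
    have "\<bar>s\<bar> \<le> B + norm p" if "p + s *\<^sub>R \<theta> \<in> C" for s
      using B[OF that] norm_triangle_ineq4[of "p + s *\<^sub>R \<theta>" p] assms(3) by simp
    then show ?thesis unfolding bounded_iff by auto
  qed
  ultimately have "compact ?A" by (simp add: compact_eq_bounded_closed)
  moreover have "0 \<in> ?A" using assms by simp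
  ultimately obtain s\<^sub>0 where s0: "s\<^sub>0 \<in> ?A" "\<And>s. s \<in> ?A \<Longrightarrow> s \<le> s\<^sub>0" using compact_attains_sup[of ?A] by blast
  then have "reach C \<theta> p = s\<^sub>0" unfolding reach_def by (intro cSup_eq_maximum) auto
  then show "p + reach C \<theta> p *\<^sub>R \<theta> \<in> C" "p + s *\<^sub>R \<theta> \<in> C \<Longrightarrow> s \<le> reach C \<theta> p" "0 \<le> reach C \<theta> p"
    using s0 \<open>0 \<in> ?A\<close> by auto
qed

text \<open>Convexity of \<open>C\<close> makes the reach concave, and a concave function is
  continuous on an open convex set.\<close>

lemma continuous_on_reach:
  fixes C :: "'a::euclidean_space set"
  assumes "compact C" "convex C" "norm \<theta> = 1" "open S" "convex S" "S \<subseteq> C"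
  shows "continuous_on S (reach C \<theta>)"
proof -
  have "convex_on S (\<lambda>p. - reach C \<theta> p)"
  proof (rule convex_onI)
    fix t :: real and x y assume t: "0 < t" "t < 1" and xy: "x \<in> S" "y \<in> S"
    define z where "z = (1 - t) *\<^sub>R x + t *\<^sub>R y"
    have "z \<in> S" unfolding z_def using \<open>convex S\<close> xy t by (auto simp: convex_alt)
    have "x + reach C \<theta> x *\<^sub>R \<theta> \<in> C" "y + reach C \<theta> y *\<^sub>R \<theta> \<in> C"
      using reach_mem(1)[OF \<open>compact C\<close> _ \<open>norm \<theta> = 1\<close>] xy \<open>S \<subseteq> C\<close> by blast+
    then have "(1 - t) *\<^sub>R (x + reach C \<theta> x *\<^sub>R \<theta>) + t *\<^sub>R (y + reach C \<theta> y *\<^sub>R \<theta>) \<in> C"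
      using t by (intro convexD_alt[OF \<open>convex C\<close>]) auto
    then have "z + ((1 - t) * reach C \<theta> x + t * reach C \<theta> y) *\<^sub>R \<theta> \<in> C"
      by (simp add: z_def algebra_simps)
    then have "(1 - t) * reach C \<theta> x + t * reach C \<theta> y \<le> reach C \<theta> z"
      using reach_mem(2)[OF \<open>compact C\<close> _ \<open>norm \<theta> = 1\<close>] \<open>z \<in> S\<close> \<open>S \<subseteq> C\<close> by blast
    then show "- reach C \<theta> ((1 - t) *\<^sub>R x + t *\<^sub>R y) \<le> (1 - t) * - reach C \<theta> x + t * - reach C \<theta> y"
      by (simp add: z_def)
  qed (use assms in auto)
  then have "continuous_on S (\<lambda>p. - (- reach C \<theta> p))"
    using convex_on_continuous[OF \<open>open S\<close>] continuous_on_minus by blast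
  then show ?thesis by simp
qed

text \<open>In the direction of a diameter, no chord off the diameter has full length.\<close>
lemma chord_length_nonconstant:
  fixes C :: "'a::euclidean_space set"
  assumes "compact C" "convex C" "interior C \<noteq> {}" "2 \<le> DIM('a)"
  obtains \<theta> y z where "norm \<theta> = 1" "y \<in> interior C" "z \<in> interior C"
    "reach C \<theta> y + reach C (- \<theta>) y < reach C \<theta> z + reach C (- \<theta>) z"
proof -
  obtain y\<^sub>0 where y0: "y\<^sub>0 \<in> interior C" using assms by blast
  then obtain r where r: "r > 0" "ball y\<^sub>0 r \<subseteq> interior C" using open_interior openE by blast
  have "C \<noteq> {}" using assms interior_subset by blast
  then obtain u v where uv: "u \<in> C" "v \<in> C" "dist u v = diameter C"
    using diameter_compact_attained[OF \<open>compact C\<close>] by blast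
  have diam: "dist x y \<le> diameter C" if "x \<in> C" "y \<in> C" for x y
    using that diameter_bounded_bound compact_imp_bounded[OF \<open>compact C\<close>] by blast
  define d where "d = diameter C"
  obtain b :: 'a where "b \<in> Basis" by (meson nonempty_Basis ex_in_conv)
  have "d > 0"
  proof -
    have "norm b = 1" using \<open>b \<in> Basis\<close> by simp
    then have "y\<^sub>0 + (r / 2) *\<^sub>R b \<in> ball y\<^sub>0 r" using r by (simp add: dist_norm)
    then have "y\<^sub>0 + (r / 2) *\<^sub>R b \<in> C" using r interior_subset by blast
    then have "dist (y\<^sub>0 + (r / 2) *\<^sub>R b) y\<^sub>0 \<le> d"
      unfolding d_def using diam y0 interior_subset by blast
    then show ?thesis using r \<open>norm b = 1\<close> by (simp add: dist_norm)
  qed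
  define \<theta> where "\<theta> = (v - u) /\<^sub>R d"
  have \<theta>1: "norm \<theta> = 1" using uv \<open>d > 0\<close> by (simp add: \<theta>_def d_def dist_norm norm_minus_commute)
  have v_eq: "v = u + d *\<^sub>R \<theta>" using \<open>d > 0\<close> by (simp add: \<theta>_def)
  define \<l> where "\<l> p = reach C \<theta> p + reach C (- \<theta>) p" for p
  have \<theta>1': "norm (- \<theta>) = 1" using \<theta>1 by simp
  have long: "\<exists>s. p = u + s *\<^sub>R \<theta>" if p: "p \<in> interior C" "d \<le> \<l> p" for p
  proof -
    have pC: "p \<in> C" using p interior_subset by blast
    define x where "x = p - reach C (- \<theta>) p *\<^sub>R \<theta>"
    have xC: "x \<in> C" using reach_mem(1)[OF \<open>compact C\<close> pC \<theta>1'] by (simp add: x_def)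
    have "x + \<l> p *\<^sub>R \<theta> \<in> C"
      using reach_mem(1)[OF \<open>compact C\<close> pC \<theta>1] by (simp add: x_def \<l>_def algebra_simps)
    moreover have "\<l> p \<le> d"
    proof -
      have "dist (x + \<l> p *\<^sub>R \<theta>) x \<le> d" unfolding d_def using diam xC \<open>x + \<l> p *\<^sub>R \<theta> \<in> C\<close> by blast
      then show ?thesis using \<theta>1 by (simp add: dist_norm)
    qed
    ultimately have xd: "x + d *\<^sub>R \<theta> \<in> C" using p(2) by (metis order_antisym)
    \<comment> \<open>Let \<open>x\<close> be the start of a chord of length \<open>d\<close>.
      Comparing its ends crosswise with those of the diameter gives |z + d\<theta>| <= d and |z -
      d\<theta>| <= d, and the parallelogram law forces z = 0.\<close>
    define z where "z = x - u"
    have "norm (z + d *\<^sub>R \<theta>) \<le> d" using diam[OF xd uv(1)] by (simp add: z_def d_def dist_norm algebra_simps)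
    then have 1: "(z + d *\<^sub>R \<theta>) \<bullet> (z + d *\<^sub>R \<theta>) \<le> d\<^sup>2"
      using \<open>d > 0\<close> by (metis dot_square_norm norm_ge_zero power_mono)
    have "norm (z - d *\<^sub>R \<theta>) \<le> d" using diam[OF xC uv(2)] by (simp add: z_def d_def dist_norm v_eq algebra_simps)
    then have 2: "(z - d *\<^sub>R \<theta>) \<bullet> (z - d *\<^sub>R \<theta>) \<le> d\<^sup>2"
      using \<open>d > 0\<close> by (metis dot_square_norm norm_ge_zero power_mono)
    have "\<theta> \<bullet> \<theta> = 1" using \<theta>1 by (simp add: norm_eq_1)
    then have "z \<bullet> z \<le> 0" using 1 2
      by (simp add: inner_add_left inner_add_right inner_diff_left inner_diff_right power2_eq_square inner_commute)
    then have "z = 0" by (metis inner_eq_zero_iff inner_ge_zero order_antisym)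
    then have "p = u + reach C (- \<theta>) p *\<^sub>R \<theta>" by (simp add: z_def x_def algebra_simps)
    then show ?thesis by blast
  qed
  \<comment> \<open>Two interior points that differ by a vector orthogonal to \<theta> cannot both
    lie on the line of the diameter, so one of them has a shorter chord.\<close>
  obtain a where a: "a \<noteq> 0" "orthogonal \<theta> a" using orthogonal_to_vector_exists[OF \<open>2 \<le> DIM('a)\<close>] by blast
  define y\<^sub>1 where "y\<^sub>1 = y\<^sub>0 + (r / (2 * norm a)) *\<^sub>R a"
  have y1: "y\<^sub>1 \<in> interior C" using r a by (intro subsetD[OF r(2)]) (simp add: y\<^sub>1_def dist_norm)
  obtain y where y: "y \<in> interior C" "\<l> y < d"
  proof (cases "\<l> y\<^sub>0 < d \<or> \<l> y\<^sub>1 < d")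
    case True
    then show ?thesis using that y0 y1 by blast
  next
    case False
    then obtain s s' where "y\<^sub>0 = u + s *\<^sub>R \<theta>" "y\<^sub>1 = u + s' *\<^sub>R \<theta>"
      using long[OF y0] long[OF y1] by (auto simp: not_less)
    then have "(r / (2 * norm a)) *\<^sub>R a = (s' - s) *\<^sub>R \<theta>" by (simp add: y\<^sub>1_def algebra_simps)
    then have "(r / (2 * norm a)) *\<^sub>R a \<bullet> a = 0" using a(2) by (simp add: orthogonal_def)
    then show ?thesis using r a by simp
  qed
  \<comment> \<open>The diameter may lie in the boundary, so it is shrunk towards the interior point
    \<open>y\<close>. This \<open>t\<close> leaves the length (1 - t) d halfway between the chord
    length at \<open>y\<close> and \<open>d\<close>.\<close>
  define t where "t = (d - \<l> y) / (2 * d)"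
  have \<l>y: "0 \<le> \<l> y" unfolding \<l>_def
    using reach_mem(3)[OF \<open>compact C\<close> _ \<theta>1] reach_mem(3)[OF \<open>compact C\<close> _ \<theta>1'] y(1) interior_subset
    by (meson add_nonneg_nonneg subsetD)
  have t: "0 < t" "t \<le> 1" using y \<open>d > 0\<close> \<l>y by (auto simp: t_def field_simps)
  have shrink: "x - t *\<^sub>R (x - y) \<in> interior C" if "x \<in> C" for x
    using that by (intro mem_interior_closure_convex_shrink[OF \<open>convex C\<close> y(1) _ t]) (simp add: closure_subset[THEN subsetD])
  define z where "z = u - t *\<^sub>R (u - y)"
  have z: "z \<in> interior C" unfolding z_def using shrink uv by blast
  then have zC: "z \<in> C" using interior_subset by blast
  have "z + ((1 - t) * d) *\<^sub>R \<theta> = v - t *\<^sub>R (v - y)" by (simp add: z_def v_eq algebra_simps)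
  then have "z + ((1 - t) * d) *\<^sub>R \<theta> \<in> C" using shrink[OF uv(2)] interior_subset by auto
  then have "(1 - t) * d \<le> reach C \<theta> z" by (rule reach_mem(2)[OF \<open>compact C\<close> zC \<theta>1])
  also have "\<dots> \<le> \<l> z" using reach_mem(3)[OF \<open>compact C\<close> zC \<theta>1'] by (simp add: \<l>_def)
  finally have "(1 - t) * d \<le> \<l> z" .
  moreover have "\<l> y < (1 - t) * d" using y \<open>d > 0\<close> by (simp add: t_def field_simps)
  ultimately have "\<l> y < \<l> z" by simp
  then show thesis using that[OF \<theta>1 y(1) z] by (simp add: \<l>_def)
qed

lemma convex_line_between:
  fixes D :: "'a::real_vector set"
  assumes "convex D" "y + u\<^sub>1 *\<^sub>R e \<in> D" "y + u\<^sub>2 *\<^sub>R e \<in> D" "u\<^sub>1 \<le> u" "u \<le> u\<^sub>2"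
  shows "y + u *\<^sub>R e \<in> D"
proof (cases "u\<^sub>1 = u\<^sub>2")
  case False
  define t where "t = (u - u\<^sub>1) / (u\<^sub>2 - u\<^sub>1)"
  have t: "0 \<le> t" "t \<le> 1" using assms False by (auto simp: t_def field_simps)
  have "(1 - t) *\<^sub>R (y + u\<^sub>1 *\<^sub>R e) + t *\<^sub>R (y + u\<^sub>2 *\<^sub>R e) \<in> D"
    using assms t by (auto simp: convex_alt)
  also have "(1 - t) *\<^sub>R (y + u\<^sub>1 *\<^sub>R e) + t *\<^sub>R (y + u\<^sub>2 *\<^sub>R e) = y + (u\<^sub>1 + t * (u\<^sub>2 - u\<^sub>1)) *\<^sub>R e"
    by (simp add: algebra_simps)
  also have "u\<^sub>1 + t * (u\<^sub>2 - u\<^sub>1) = u" using False by (simp add: t_def)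
  finally show ?thesis .
qed (use assms in auto)

text \<open>The point at parameter b - g is interior to \<open>D\<close> and the one at b + g is
  outside its closure, both open conditions. Beyond b + g convexity takes over: a later point of
  \<open>D\<close> on the ray would put the point at b + g into \<open>D\<close>.\<close>

lemma reach_stable:
  fixes D :: "'a::euclidean_space set"
  assumes "bounded D" "convex D" "p \<in> interior D" "norm \<theta> = 1"
    and "0 < g" "g \<le> reach (closure D) \<theta> p"
  obtains \<eta> where "0 < \<eta>"
    "\<And>\<delta> e. norm \<delta> < \<eta> \<Longrightarrow> norm (e - \<theta>) < \<eta> \<Longrightarrow> p + \<delta> + (reach (closure D) \<theta> p - g) *\<^sub>R e \<in> D"
    "\<And>\<delta> e s. norm \<delta> < \<eta> \<Longrightarrow> norm (e - \<theta>) < \<eta> \<Longrightarrow> reach (closure D) \<theta> p + g \<le> s \<Longrightarrow> p + \<delta> + s *\<^sub>R e \<notin> D"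
proof -
  define b where "b = reach (closure D) \<theta> p"
  have C: "compact (closure D)" using assms(1) by (simp add: compact_closure)
  have pC: "p \<in> closure D" using assms(3) interior_subset closure_subset by blast
  note reach = reach_mem[OF C pC \<open>norm \<theta> = 1\<close>, folded b_def]
  have b: "0 < g" "g \<le> b" using assms by (auto simp: b_def)
  have "(p + b *\<^sub>R \<theta>) - (g / b) *\<^sub>R ((p + b *\<^sub>R \<theta>) - p) \<in> interior D"
    using b reach(1) by (intro mem_interior_closure_convex_shrink[OF assms(2,3)]) auto
  moreover have "(p + b *\<^sub>R \<theta>) - (g / b) *\<^sub>R ((p + b *\<^sub>R \<theta>) - p) = p + (b - g) *\<^sub>R \<theta>"
    using b by (simp add: algebra_simps)
  ultimately obtain r\<^sub>1 where r1: "r\<^sub>1 > 0" "ball (p + (b - g) *\<^sub>R \<theta>) r\<^sub>1 \<subseteq> D"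
    by (metis mem_interior)
  have "p + (b + g) *\<^sub>R \<theta> \<in> - closure D" using reach(2)[of "b + g"] b by auto
  then obtain r\<^sub>2 where r2: "r\<^sub>2 > 0" "ball (p + (b + g) *\<^sub>R \<theta>) r\<^sub>2 \<subseteq> - closure D"
    by (rule openE[of "- closure D", rotated]) auto
  obtain r\<^sub>3 where r3: "r\<^sub>3 > 0" "ball p r\<^sub>3 \<subseteq> D" using assms(3) by (metis mem_interior)
  define r where "r = min r\<^sub>1 (min r\<^sub>2 r\<^sub>3)"
  have "r > 0" using r1 r2 r3 by (simp add: r_def)
  \<comment> \<open>A shift of the base point costs \<eta>, a change of direction at most (b +
    g)\<eta> up to parameter b + g; together they stay below \<open>r\<close>.\<close>
  define \<eta> where "\<eta> = r / (1 + b + g)"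
  have \<eta>: "0 < \<eta>" "\<eta> * (1 + b + g) = r" using \<open>r > 0\<close> b by (auto simp: \<eta>_def)
  have close: "dist (p + s *\<^sub>R \<theta>) (p + \<delta> + s *\<^sub>R e) < r"
    if "norm \<delta> < \<eta>" "norm (e - \<theta>) < \<eta>" "0 \<le> s" "s \<le> b + g" for \<delta> e s
  proof -
    have "dist (p + s *\<^sub>R \<theta>) (p + \<delta> + s *\<^sub>R e) = norm (\<delta> + s *\<^sub>R (e - \<theta>))"
      by (subst dist_commute) (simp add: dist_norm algebra_simps)
    also have "\<dots> \<le> norm \<delta> + s * norm (e - \<theta>)"
      using norm_triangle_ineq[of \<delta> "s *\<^sub>R (e - \<theta>)"] that by simp
    also have "\<dots> < \<eta> + (b + g) * \<eta>"
      using that b by (intro add_less_le_mono mult_mono) auto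
    also have "\<dots> = r" using \<eta>(2) by (simp add: algebra_simps)
    finally show ?thesis .
  qed
  have far: "p + \<delta> + s *\<^sub>R e \<notin> D" if "norm \<delta> < \<eta>" "norm (e - \<theta>) < \<eta>" "b + g \<le> s" for \<delta> e s
  proof
    assume "p + \<delta> + s *\<^sub>R e \<in> D"
    moreover have "p + \<delta> + 0 *\<^sub>R e \<in> D"
      using close[OF that(1,2), of 0] b r3 by (auto simp: r_def)
    ultimately have "p + \<delta> + (b + g) *\<^sub>R e \<in> D"
      using convex_line_between[OF assms(2), of "p + \<delta>" 0 e s "b + g"] that b by auto
    then have "p + \<delta> + (b + g) *\<^sub>R e \<in> closure D" using closure_subset by blast
    moreover have "p + \<delta> + (b + g) *\<^sub>R e \<in> ball (p + (b + g) *\<^sub>R \<theta>) r\<^sub>2"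
      using close[OF that(1,2), of "b + g"] b by (auto simp: r_def)
    ultimately show False using r2 by blast
  qed
  have near: "p + \<delta> + (b - g) *\<^sub>R e \<in> D" if "norm \<delta> < \<eta>" "norm (e - \<theta>) < \<eta>" for \<delta> e
    using close[OF that, of "b - g"] b r1 by (auto simp: r_def)
  show thesis using that \<eta>(1) near far unfolding b_def by blast
qed

text \<open>The starting point is the last one on the chord through \<open>p\<close>; it re-enters \<open>D\<close> through the
  other end of that chord, so the re-entry step is determined by the chord length up to a small error.\<close>
lemma chord_entry_step:
  fixes D :: "'a::euclidean_space set"
  assumes D: "convex D" "p \<in> D" and e: "e \<noteq> 0" "norm e \<le> g / 2" "u = e /\<^sub>R norm e"
    and g: "2 * g \<le> a" "2 * g \<le> b" "a + b \<le> real M * norm e"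
    and exit: "p + (b - g) *\<^sub>R u \<in> D" "\<And>s. b + g \<le> s \<Longrightarrow> p + s *\<^sub>R u \<notin> D"
    and entry: "p + (w + real M *\<^sub>R e) + (b - g) *\<^sub>R u \<in> D" "p + (w + real M *\<^sub>R e) - (a - g) *\<^sub>R u \<in> D"
      "\<And>s. a + g \<le> s \<Longrightarrow> p + (w + real M *\<^sub>R e) - s *\<^sub>R u \<notin> D"
  obtains x k where "x \<in> D" "\<And>i. 1 \<le> i \<Longrightarrow> x + real i *\<^sub>R e \<notin> D" "x + w + real k *\<^sub>R e \<in> D"
    "\<And>i. i < k \<Longrightarrow> x + w + real i *\<^sub>R e \<notin> D" "k \<le> M" "\<bar>real k * norm e - (real M * norm e - (a + b))\<bar> \<le> 3 * g"
proof -
  define h where "h = norm e"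
  have h: "0 < h" "h \<le> g / 2" using e by (auto simp: h_def)
  have e_eq: "e = h *\<^sub>R u" using e by (simp add: h_def)
  define A where "A = {i :: nat. p + (real i * h) *\<^sub>R u \<in> D}"
  have "i \<le> nat \<lceil>(b + g) / h\<rceil>" if "i \<in> A" for i
  proof -
    have "real i * h < b + g" using exit(2) that not_less by (auto simp: A_def)
    then have "real i < (b + g) / h" using h by (simp add: field_simps)
    then show ?thesis by linarith
  qed
  then have "finite A" using finite_nat_set_iff_bounded_le by blast
  moreover have "0 \<in> A" using D by (simp add: A_def)
  ultimately have m: "Max A \<in> A" "\<And>i. i \<in> A \<Longrightarrow> i \<le> Max A" by (auto intro: Max_in)
  define m where "m = Max A"
  define x where "x = p + (real m * h) *\<^sub>R u"
  have "x \<in> D" using m(1) by (simp add: A_def m_def x_def)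
  have x_add: "x + real i *\<^sub>R e = p + (real (m + i) * h) *\<^sub>R u" for i
    by (simp add: x_def e_eq algebra_simps)
  have x_out: "x + real i *\<^sub>R e \<notin> D" if "1 \<le> i" for i
  proof
    assume "x + real i *\<^sub>R e \<in> D"
    then have "m + i \<in> A" unfolding x_add A_def by simp
    then have "m + i \<le> m" unfolding m_def by (rule m(2))
    then show False using that by simp
  qed
  have m_less: "real m * h < b + g" using exit(2) \<open>x \<in> D\<close> not_less by (auto simp: x_def)
  have m_greater: "b - g - h < real m * h"
  proof (rule ccontr)
    assume "\<not> b - g - h < real m * h"
    then have "real (m + 1) * h \<le> b - g" by (simp add: algebra_simps)
    moreover have "p + 0 *\<^sub>R u \<in> D" using D by simp
    moreover have "0 \<le> real (m + 1) * h" using h by simp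
    ultimately have "p + (real (m + 1) * h) *\<^sub>R u \<in> D"
      using convex_line_between[OF D(1) _ exit(1)] by blast
    then show False using x_out[of 1] x_add[of 1] by simp
  qed
  define z where "z = p + (w + real M *\<^sub>R e)"
  \<comment> \<open>The position along \<open>u\<close>, relative to \<open>z\<close>, after the
    jump and \<open>k\<close> drifts. On this line \<open>D\<close> contains the range from -(a - g)
    to b - g and nothing at or before -(a + g).\<close>
  define \<rho> where "\<rho> k = (real m + real k - real M) * h" for k :: nat
  have xw: "x + w + real k *\<^sub>R e = z + \<rho> k *\<^sub>R u" for k
    by (simp add: x_def z_def \<rho>_def e_eq algebra_simps)
  \<comment> \<open>The real solution of \<open>\<rho> y = - (a - g)\<close>. Rounding costs at most
    one step here and one in \<open>m\<close>; with steps of length at most g/2 and an uncertainty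
    \<open>g\<close> at either end of the chord, the total is 3g.\<close>
  define y where "y = (real M * h - real m * h - (a - g)) / h"
  have yh: "y * h = real M * h - real m * h - (a - g)" using h by (simp add: y_def)
  have "y \<ge> 0" using g m_less h by (auto simp: y_def h_def intro!: divide_nonneg_pos)
  define k\<^sub>0 where "k\<^sub>0 = nat \<lceil>y\<rceil>"
  have k0: "y \<le> real k\<^sub>0" "real k\<^sub>0 \<le> y + 1" using \<open>y \<ge> 0\<close> by (auto simp: k\<^sub>0_def)
  have k0h: "y * h \<le> real k\<^sub>0 * h" "real k\<^sub>0 * h \<le> y * h + h"
    using mult_right_mono[OF k0(1), of h] mult_right_mono[OF k0(2), of h] h by (auto simp: algebra_simps)
  have "- (a - g) \<le> \<rho> k\<^sub>0" using k0h(1) yh by (simp add: \<rho>_def algebra_simps)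
  have "\<rho> k\<^sub>0 \<le> b - g"
  proof -
    have "\<rho> k\<^sub>0 \<le> - (a - g) + h" using k0h(2) yh by (simp add: \<rho>_def algebra_simps)
    then show ?thesis using h g by linarith
  qed
  have k0D: "x + w + real k\<^sub>0 *\<^sub>R e \<in> D"
  proof -
    have "z + (- (a - g)) *\<^sub>R u \<in> D" using entry(2) by (simp only: z_def scaleR_minus_left add_uminus_conv_diff)
    moreover have "z + (b - g) *\<^sub>R u \<in> D" using entry(1) by (simp only: z_def)
    ultimately show ?thesis
      unfolding xw using \<open>- (a - g) \<le> \<rho> k\<^sub>0\<close> \<open>\<rho> k\<^sub>0 \<le> b - g\<close> convex_line_between[OF D(1)] by blast
  qed
  define k where "k = (LEAST k. x + w + real k *\<^sub>R e \<in> D)"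
  have kD: "x + w + real k *\<^sub>R e \<in> D" unfolding k_def using k0D by (rule LeastI)
  have "k \<le> k\<^sub>0" unfolding k_def using k0D by (rule Least_le)
  have "- (a + g) < \<rho> k"
  proof (rule ccontr)
    assume "\<not> - (a + g) < \<rho> k"
    then have "z - (- \<rho> k) *\<^sub>R u \<notin> D" unfolding z_def by (intro entry(3)) simp
    then show False using kD unfolding xw by simp
  qed
  then have lower: "real M * h - (a + b) - 2 * g < real k * h"
    using m_less by (simp add: \<rho>_def algebra_simps)
  have "real k * h \<le> real k\<^sub>0 * h" using \<open>k \<le> k\<^sub>0\<close> h by (intro mult_right_mono) auto
  then have upper: "real k * h < real M * h - (a + b) + 3 * g" using k0h(2) yh m_greater h by linarith
  show thesis
  proof (rule that[OF \<open>x \<in> D\<close> x_out kD])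
    show "x + w + real i *\<^sub>R e \<notin> D" if "i < k" for i using not_less_Least that unfolding k_def by blast
    have "real k * h < real M * h" using upper g h by linarith
    then show "k \<le> M" using h by simp
    show "\<bar>real k * norm e - (real M * norm e - (a + b))\<bar> \<le> 3 * g"
      using lower upper g h unfolding h_def[symmetric] by (simp add: abs_le_iff)
  qed
qed

section \<open>From chord lengths to return times\<close>

lemma first_return_tube:
  fixes D :: "(real ^ 'n) set"
  assumes "0 < R" "0 < q" "p \<in> int_lattice" "m\<^sub>2 \<in> int_lattice"
    and e: "e = R *\<^sub>R (real q *\<^sub>R \<alpha> + p)" and w: "w = R *\<^sub>R (real n\<^sub>2 *\<^sub>R \<alpha> + m\<^sub>2)"
    and short: "\<And>n m. 1 \<le> n \<Longrightarrow> n \<le> n\<^sub>2 + M * q \<Longrightarrow> m \<in> int_lattice \<Longrightarrow> norm (R *\<^sub>R (real n *\<^sub>R \<alpha> + m)) \<le> \<Delta> \<Longrightarrow>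
        (\<exists>k. n = k * q \<and> m = real k *\<^sub>R p) \<or> (\<exists>k. n = n\<^sub>2 + k * q \<and> m = m\<^sub>2 + real k *\<^sub>R p)"
    and D: "\<And>x y. x \<in> D \<Longrightarrow> y \<in> D \<Longrightarrow> norm (x - y) \<le> \<Delta>" and "\<Delta> < norm w"
    and x: "x \<in> D" "\<And>i. 1 \<le> i \<Longrightarrow> x + real i *\<^sub>R e \<notin> D" "x + w + real k *\<^sub>R e \<in> D"
      "\<And>i. i < k \<Longrightarrow> x + w + real i *\<^sub>R e \<notin> D" "k \<le> M"
  shows "first_return \<alpha> ((\<lambda>x. inverse R *\<^sub>R x) ` D) (inverse R *\<^sub>R x) = n\<^sub>2 + k * q"
proof -
  let ?D = "(\<lambda>x. inverse R *\<^sub>R x) ` D"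
  define P where "P n \<longleftrightarrow> 1 \<le> n \<and> inverse R *\<^sub>R x + real n *\<^sub>R \<alpha> \<in> lattice_lift ?D" for n :: nat
  have P: "P n \<longleftrightarrow> 1 \<le> n \<and> (\<exists>m\<in>int_lattice. x + R *\<^sub>R (real n *\<^sub>R \<alpha> + m) \<in> D)" for n
    unfolding P_def mem_lattice_lift mem_scaled[OF \<open>0 < R\<close>]
    using \<open>0 < R\<close> by (simp add: scaleR_add_right add.assoc)
  have ke: "real k *\<^sub>R e = R *\<^sub>R (real (k * q) *\<^sub>R \<alpha> + real k *\<^sub>R p)" for k
    by (simp add: e algebra_simps)
  have wke: "w + real k *\<^sub>R e = R *\<^sub>R (real (n\<^sub>2 + k * q) *\<^sub>R \<alpha> + (m\<^sub>2 + real k *\<^sub>R p))" for k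
    unfolding ke by (simp add: w algebra_simps)
  \<comment> \<open>\<open>n\<^sub>2\<close> may be 0, whereas a return time is positive. The jump
    alone is longer than any difference of points of \<open>D\<close>.\<close>
  have "k \<noteq> 0"
  proof
    assume "k = 0"
    then have "norm ((x + w) - x) \<le> \<Delta>" using x(1,3) by (intro D) auto
    then show False using \<open>\<Delta> < norm w\<close> by simp
  qed
  then have "1 \<le> n\<^sub>2 + k * q" using \<open>0 < q\<close> by (simp add: Suc_le_eq)
  moreover have "x + R *\<^sub>R (real (n\<^sub>2 + k * q) *\<^sub>R \<alpha> + (m\<^sub>2 + real k *\<^sub>R p)) \<in> D"
    using x(3) unfolding wke[symmetric] by (simp add: add.assoc)
  ultimately have "P (n\<^sub>2 + k * q)"
    unfolding P using int_lattice_add[OF assms(4) int_lattice_scale_nat[OF assms(3)]] by blast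
  moreover have "n\<^sub>2 + k * q \<le> n" if "P n" for n
  proof (rule ccontr)
    assume less: "\<not> n\<^sub>2 + k * q \<le> n"
    obtain m where m: "1 \<le> n" "m \<in> int_lattice" "x + R *\<^sub>R (real n *\<^sub>R \<alpha> + m) \<in> D"
      using \<open>P n\<close> unfolding P by blast
    have "k * q \<le> M * q" using x(5) by simp
    then have "n \<le> n\<^sub>2 + M * q" using less by linarith
    moreover have "norm (R *\<^sub>R (real n *\<^sub>R \<alpha> + m)) \<le> \<Delta>" using D[OF m(3) x(1)] by simp
    \<comment> \<open>Two kinds of candidates remain: pure drifts, which have left \<open>D\<close>
      for good, and the jump followed by fewer than \<open>k\<close> drifts, which has not yet
      re-entered.\<close>
    ultimately consider i where "n = i * q" "m = real i *\<^sub>R p" | i where "n = n\<^sub>2 + i * q" "m = m\<^sub>2 + real i *\<^sub>R p"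
      using short[OF m(1) _ m(2)] by blast
    then show False
    proof cases
      case 1
      then have "1 \<le> i" using m(1) by (cases i) auto
      then show False using x(2) m(3) unfolding 1 ke[symmetric] by blast
    next
      case 2
      then have "i * q < k * q" using less by simp
      then have "i < k" by simp
      moreover have "x + (w + real i *\<^sub>R e) \<in> D" using m(3) unfolding 2 wke .
      ultimately show False using x(4)[of i] by (simp add: add.assoc)
    qed
  qed
  ultimately have "(LEAST n. P n) = n\<^sub>2 + k * q" by (intro Least_equality)
  then show ?thesis by (simp add: first_return_def P_def)
qed

text \<open>Chord length is continuous and not constant on the connected interior, so it takes
  \<open>K\<close> equally spaced values. Only finitely many points are involved, so a common
  tolerance can be fixed before \<alpha> and \<open>R\<close> are given.\<close>

lemma many_return_times:
  fixes D :: "(real ^ 'n) set"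
  assumes "2 \<le> CARD('n)" "bounded D" "convex D" "interior D \<noteq> {}"
  obtains \<theta> \<eta> \<Delta> where "norm \<theta> = 1" "0 < \<eta>" "\<eta> \<le> 1" "0 < \<Delta>"
    "\<And>\<alpha> R. 0 < R \<Longrightarrow> tube_return \<alpha> R \<theta> \<eta> \<Delta> \<Longrightarrow>
       enat K \<le> num_return_times \<alpha> ((\<lambda>x. inverse R *\<^sub>R x) ` D)"
proof -
  let ?C = "closure D"
  have C: "compact ?C" "convex ?C" using assms by (simp_all add: compact_closure convex_closure)
  have intC: "interior ?C = interior D" using assms by (simp add: convex_interior_closure)
  obtain \<theta> y z where \<theta>: "norm \<theta> = 1" and yz: "y \<in> interior D" "z \<in> interior D"
    "reach ?C \<theta> y + reach ?C (- \<theta>) y < reach ?C \<theta> z + reach ?C (- \<theta>) z"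
    using chord_length_nonconstant[OF C] assms unfolding intC by auto
  have \<theta>': "norm (- \<theta>) = 1" using \<theta> by simp
  define f where "f p = reach ?C \<theta> p + reach ?C (- \<theta>) p" for p
  have sub: "interior D \<subseteq> ?C" using interior_subset closure_subset by blast
  have "continuous_on (interior D) f"
    unfolding f_def using assms sub \<theta> \<theta>'
    by (intro continuous_on_add continuous_on_reach[OF C]) (auto simp: convex_interior)
  then have "connected (f ` interior D)"
    using assms by (intro connected_continuous_image convex_connected convex_interior)
  then have Icc: "{f y..f z} \<subseteq> f ` interior D" using yz by (intro connected_contains_Icc) auto
  define \<delta> where "\<delta> = (f z - f y) / (real K + 1)"
  have "\<delta> > 0" using yz by (simp add: \<delta>_def f_def)
  have "\<exists>p\<in>interior D. f p = f y + \<delta> * real j" if "j < K" for j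
  proof -
    have "\<delta> * real j \<le> \<delta> * (real K + 1)" using \<open>\<delta> > 0\<close> that by (intro mult_left_mono) auto
    also have "\<dots> = f z - f y" by (simp add: \<delta>_def)
    finally have "f y + \<delta> * real j \<in> {f y..f z}" using \<open>\<delta> > 0\<close> by simp
    then show ?thesis using Icc by (metis imageE subsetD)
  qed
  then obtain p where p: "\<And>j. j < K \<Longrightarrow> p j \<in> interior D" "\<And>j. j < K \<Longrightarrow> f (p j) = f y + \<delta> * real j"
    by metis
  define b a where "b j = reach ?C \<theta> (p j)" and "a j = reach ?C (- \<theta>) (p j)" for j
  have reach_pos: "0 < reach ?C \<phi> x" if x: "x \<in> interior D" and \<phi>: "norm \<phi> = 1" for x \<phi>
  proof -
    obtain r where r: "r > 0" "ball x r \<subseteq> D" using x by (metis mem_interior)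
    have "x + (r / 2) *\<^sub>R \<phi> \<in> ball x r" using r \<phi> by (simp add: dist_norm)
    then have "r / 2 \<le> reach ?C \<phi> x"
      using r closure_subset sub x by (intro reach_mem(2)[OF C(1) _ \<phi>]) blast+
    then show ?thesis using r by simp
  qed
  have ab: "0 < a j" "0 < b j" if "j < K" for j
    using reach_pos p(1)[OF that] \<theta> \<theta>' by (auto simp: a_def b_def)
  \<comment> \<open>Each re-entry step determines its chord length up to 3g, so values at least 8g
    apart are told apart. The terms a j/2 and b j/2 leave room at both ends of every chord.\<close>
  define g where "g = Min (insert (\<delta> / 8) ((\<lambda>j. a j / 2) ` {..<K} \<union> (\<lambda>j. b j / 2) ` {..<K}))"
  have "g > 0" unfolding g_def using ab \<open>\<delta> > 0\<close> by (subst Min_gr_iff) auto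
  have g: "g \<le> \<delta> / 8" and gab: "\<And>j. j < K \<Longrightarrow> g \<le> a j / 2" "\<And>j. j < K \<Longrightarrow> g \<le> b j / 2"
    unfolding g_def by (intro Min_le; auto)+
  have "\<exists>\<eta>>0. (\<forall>\<epsilon> e. norm \<epsilon> < \<eta> \<longrightarrow> norm (e - \<phi>) < \<eta> \<longrightarrow> p j + \<epsilon> + (reach ?C \<phi> (p j) - g) *\<^sub>R e \<in> D)
    \<and> (\<forall>\<epsilon> e s. norm \<epsilon> < \<eta> \<longrightarrow> norm (e - \<phi>) < \<eta> \<longrightarrow> reach ?C \<phi> (p j) + g \<le> s \<longrightarrow> p j + \<epsilon> + s *\<^sub>R e \<notin> D)"
    if "j < K" "\<phi> = \<theta> \<or> \<phi> = - \<theta>" for j \<phi>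
  proof -
    have "g \<le> reach ?C \<phi> (p j)" "norm \<phi> = 1"
      using that gab[OF that(1)] ab[OF that(1)] \<theta> by (auto simp: a_def b_def)
    then show ?thesis using reach_stable[OF assms(2,3) p(1)[OF that(1)] _ \<open>g > 0\<close>] by metis
  qed
  then obtain \<eta>\<^sub>1 where \<eta>1: "\<And>j \<phi>. j < K \<Longrightarrow> \<phi> = \<theta> \<or> \<phi> = - \<theta> \<Longrightarrow> 0 < \<eta>\<^sub>1 j \<phi> \<and>
    (\<forall>\<epsilon> e. norm \<epsilon> < \<eta>\<^sub>1 j \<phi> \<longrightarrow> norm (e - \<phi>) < \<eta>\<^sub>1 j \<phi> \<longrightarrow> p j + \<epsilon> + (reach ?C \<phi> (p j) - g) *\<^sub>R e \<in> D)
    \<and> (\<forall>\<epsilon> e s. norm \<epsilon> < \<eta>\<^sub>1 j \<phi> \<longrightarrow> norm (e - \<phi>) < \<eta>\<^sub>1 j \<phi> \<longrightarrow> reach ?C \<phi> (p j) + g \<le> s \<longrightarrow> p j + \<epsilon> + s *\<^sub>R e \<notin> D)"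
    by metis
  \<comment> \<open>The entry g/2 keeps a drift step below the length tolerance; the entry 1 turns
    M|e| > \<Delta> + 1 into |w| > \<Delta>.\<close>
  define \<eta> where "\<eta> = Min ({1, g / 2} \<union> (\<lambda>j. \<eta>\<^sub>1 j \<theta>) ` {..<K} \<union> (\<lambda>j. \<eta>\<^sub>1 j (- \<theta>)) ` {..<K})"
  have "\<eta> > 0" unfolding \<eta>_def using \<eta>1 \<open>g > 0\<close> by (subst Min_gr_iff) auto
  have \<eta>: "\<eta> \<le> 1" "\<eta> \<le> g / 2" "\<And>j. j < K \<Longrightarrow> \<eta> \<le> \<eta>\<^sub>1 j \<theta>" "\<And>j. j < K \<Longrightarrow> \<eta> \<le> \<eta>\<^sub>1 j (- \<theta>)"
    unfolding \<eta>_def by (intro Min_le; auto)+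
  obtain B where B: "B > 0" "\<And>x. x \<in> D \<Longrightarrow> norm x \<le> B" using \<open>bounded D\<close> bounded_pos by metis
  have B2: "norm (x - y) \<le> 2 * B" if "x \<in> D" "y \<in> D" for x y
    using norm_triangle_ineq4[of x y] B(2)[OF that(1)] B(2)[OF that(2)] by linarith
  \<comment> \<open>The first term bounds differences of points of \<open>D\<close>, the second the
    chord lengths, which must not exceed the total drift M|e|.\<close>
  define \<Delta> where "\<Delta> = 2 * B + \<bar>f z\<bar>"
  have "\<Delta> > 0" using B by (simp add: \<Delta>_def)
  have fp_le: "a j + b j \<le> \<Delta>" if "j < K" for j
  proof -
    have "\<delta> * real j \<le> \<delta> * (real K + 1)" using \<open>\<delta> > 0\<close> that by (intro mult_left_mono) auto
    also have "\<dots> = f z - f y" by (simp add: \<delta>_def)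
    finally have "f (p j) \<le> f z" using p(2)[OF that] by simp
    then show ?thesis using B by (simp add: \<Delta>_def f_def a_def b_def)
  qed
  have "enat K \<le> num_return_times \<alpha> ((\<lambda>x. inverse R *\<^sub>R x) ` D)"
    if "0 < R" and tr: "tube_return \<alpha> R \<theta> \<eta> \<Delta>" for \<alpha> R
  proof -
    let ?D = "(\<lambda>x. inverse R *\<^sub>R x) ` D"
    obtain q n\<^sub>2 M P m\<^sub>2 e w where t: "0 < q" "P \<in> int_lattice" "m\<^sub>2 \<in> int_lattice"
      "e = R *\<^sub>R (real q *\<^sub>R \<alpha> + P)" "w = R *\<^sub>R (real n\<^sub>2 *\<^sub>R \<alpha> + m\<^sub>2)"
      "norm e < \<eta>" "norm (e /\<^sub>R norm e - \<theta>) < \<eta>" "norm (w + real M *\<^sub>R e) < \<eta>" "\<Delta> + 1 < real M * norm e"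
      and short: "\<And>n m. 1 \<le> n \<Longrightarrow> n \<le> n\<^sub>2 + M * q \<Longrightarrow> m \<in> int_lattice \<Longrightarrow> norm (R *\<^sub>R (real n *\<^sub>R \<alpha> + m)) \<le> \<Delta> \<Longrightarrow>
        (\<exists>k. n = k * q \<and> m = real k *\<^sub>R P) \<or> (\<exists>k. n = n\<^sub>2 + k * q \<and> m = m\<^sub>2 + real k *\<^sub>R P)"
      using tr unfolding tube_return_def by blast
    have "e \<noteq> 0" using t(9) \<open>\<Delta> > 0\<close> by auto
    define u where "u = e /\<^sub>R norm e"
    have u: "norm (u - \<theta>) < \<eta>" "norm (- u - - \<theta>) < \<eta>"
      using t(7) by (auto simp: u_def norm_minus_commute)
    have "\<Delta> < norm w"
    proof -
      have "real M * norm e \<le> norm (w + real M *\<^sub>R e) + norm w"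
        using norm_triangle_ineq4[of "w + real M *\<^sub>R e" w] by simp
      then show ?thesis using t(8,9) \<eta>(1) by linarith
    qed
    have "\<exists>x k. x \<in> D \<and> (\<forall>i\<ge>1. x + real i *\<^sub>R e \<notin> D) \<and> x + w + real k *\<^sub>R e \<in> D \<and>
      (\<forall>i<k. x + w + real i *\<^sub>R e \<notin> D) \<and> k \<le> M \<and> \<bar>real k * norm e - (real M * norm e - (a j + b j))\<bar> \<le> 3 * g"
      if j: "j < K" for j
    proof -
      define \<epsilon> where "\<epsilon> = w + real M *\<^sub>R e"
      have \<epsilon>: "norm \<epsilon> < \<eta>" using t(8) by (simp add: \<epsilon>_def)
      have lt: "\<And>x. x < \<eta> \<Longrightarrow> x < \<eta>\<^sub>1 j \<theta>" "\<And>x. x < \<eta> \<Longrightarrow> x < \<eta>\<^sub>1 j (- \<theta>)"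
        using \<eta>(3,4)[OF j] by linarith+
      have z0: "norm (0 :: real ^ 'n) < \<eta>" using \<open>\<eta> > 0\<close> by simp
      have in\<theta>: "p j + x + (b j - g) *\<^sub>R u \<in> D" if "norm x < \<eta>" for x
        using \<eta>1[OF j, of \<theta>] lt(1)[OF that] lt(1)[OF u(1)] by (simp add: b_def)
      have out\<theta>: "p j + x + s *\<^sub>R u \<notin> D" if "norm x < \<eta>" "b j + g \<le> s" for x s
        using \<eta>1[OF j, of \<theta>] lt(1)[OF that(1)] lt(1)[OF u(1)] that(2) by (simp add: b_def)
      have in\<theta>': "p j + x + (a j - g) *\<^sub>R (- u) \<in> D" if "norm x < \<eta>" for x
        using \<eta>1[OF j, of "- \<theta>"] lt(2)[OF that] lt(2)[OF u(2)] unfolding a_def by blast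
      have out\<theta>': "p j + x + s *\<^sub>R (- u) \<notin> D" if "norm x < \<eta>" "a j + g \<le> s" for x s
        using \<eta>1[OF j, of "- \<theta>"] lt(2)[OF that(1)] lt(2)[OF u(2)] that(2) unfolding a_def by blast
      have 1: "p j \<in> D" using p(1)[OF j] interior_subset by blast
      have 2: "norm e \<le> g / 2" using t(6) \<eta>(2) by linarith
      have 3: "2 * g \<le> a j" "2 * g \<le> b j" using gab[OF j] by linarith+
      have 4: "a j + b j \<le> real M * norm e" using fp_le[OF j] t(9) by linarith
      have 5: "p j + (b j - g) *\<^sub>R u \<in> D" using in\<theta>[OF z0] by simp
      have 6: "p j + s *\<^sub>R u \<notin> D" if "b j + g \<le> s" for s using out\<theta>[OF z0 that] by simp
      have 7: "p j + (w + real M *\<^sub>R e) + (b j - g) *\<^sub>R u \<in> D" using in\<theta>[OF \<epsilon>] by (simp add: \<epsilon>_def)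
      have 8: "p j + (w + real M *\<^sub>R e) - (a j - g) *\<^sub>R u \<in> D" using in\<theta>'[OF \<epsilon>] by (simp add: \<epsilon>_def)
      have 9: "p j + (w + real M *\<^sub>R e) - s *\<^sub>R u \<notin> D" if "a j + g \<le> s" for s
        using out\<theta>'[OF \<epsilon> that] by (simp add: \<epsilon>_def)
      show ?thesis
        by (rule chord_entry_step[OF assms(3) 1 \<open>e \<noteq> 0\<close> 2 u_def 3 4 5 6 7 8 9]) blast+
    qed
    then obtain x k where xk: "\<And>j. j < K \<Longrightarrow> x j \<in> D \<and> (\<forall>i\<ge>1. x j + real i *\<^sub>R e \<notin> D) \<and> x j + w + real (k j) *\<^sub>R e \<in> D \<and>
      (\<forall>i<k j. x j + w + real i *\<^sub>R e \<notin> D) \<and> k j \<le> M \<and> \<bar>real (k j) * norm e - (real M * norm e - (a j + b j))\<bar> \<le> 3 * g"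
      by metis
    have fr: "first_return \<alpha> ?D (inverse R *\<^sub>R x j) = n\<^sub>2 + k j * q" if "j < K" for j
    proof (rule first_return_tube[OF \<open>0 < R\<close> t(1-5) short _ \<open>\<Delta> < norm w\<close>])
      show "norm (x - y) \<le> \<Delta>" if "x \<in> D" "y \<in> D" for x y using B2[OF that] by (simp add: \<Delta>_def)
    qed (use xk[OF that] in auto)
    have inj: "inj_on (\<lambda>j. n\<^sub>2 + k j * q) {..<K}"
    proof (rule linorder_inj_onI')
      fix i j assume ij: "i \<in> {..<K}" "j \<in> {..<K}" "i < j"
      have "\<delta> * 1 \<le> \<delta> * (real j - real i)" using \<open>\<delta> > 0\<close> ij by (intro mult_left_mono) auto
      also have "\<dots> = f (p j) - f (p i)" using p(2) ij by (simp add: algebra_simps)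
      also have "\<dots> = (a j + b j) - (a i + b i)" by (simp add: f_def a_def b_def)
      finally have "8 * g \<le> (a j + b j) - (a i + b i)" using g by linarith
      moreover have "\<bar>real (k j) * norm e - (real M * norm e - (a j + b j))\<bar> \<le> 3 * g"
        "\<bar>real (k i) * norm e - (real M * norm e - (a i + b i))\<bar> \<le> 3 * g" using xk ij by auto
      ultimately have "k i \<noteq> k j" using \<open>g > 0\<close> by (auto simp: abs_le_iff)
      then show "n\<^sub>2 + k i * q \<noteq> n\<^sub>2 + k j * q" using t(1) by simp
    qed
    have sub: "(\<lambda>j. n\<^sub>2 + k j * q) ` {..<K} \<subseteq> first_return \<alpha> ?D ` ?D"
      using fr xk by (force simp: image_iff)
    show ?thesis
    proof (cases "finite (first_return \<alpha> ?D ` ?D)")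
      case True
      have "card {..<K} \<le> card (first_return \<alpha> ?D ` ?D)"
        using card_mono[OF True sub] card_image[OF inj] by simp
      then show ?thesis using True by (simp add: num_return_times_def Let_def)
    qed (simp add: num_return_times_def Let_def)
  qed
  then show thesis using that \<theta> \<open>\<eta> > 0\<close> \<eta>(1) \<open>\<Delta> > 0\<close> by blast
qed

subsection \<open>Generic parameters\<close>

text \<open>This reduces arbitrary directions, tolerances and lengths to a countable family; a
  change of direction is paid for with tolerance.\<close>

lemma tube_return_mono:
  assumes "tube_return \<alpha> R \<theta> \<eta> \<Delta>" "norm (\<theta> - \<theta>') + \<eta> \<le> \<eta>'" "\<Delta>' \<le> \<Delta>"
  shows "tube_return \<alpha> R \<theta>' \<eta>' \<Delta>'"
proof -
  obtain q n\<^sub>2 M p m\<^sub>2 e w where t: "0 < q" "p \<in> int_lattice" "m\<^sub>2 \<in> int_lattice"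
    "e = R *\<^sub>R (real q *\<^sub>R \<alpha> + p)" "w = R *\<^sub>R (real n\<^sub>2 *\<^sub>R \<alpha> + m\<^sub>2)"
    "norm e < \<eta>" "norm (e /\<^sub>R norm e - \<theta>) < \<eta>" "norm (w + real M *\<^sub>R e) < \<eta>" "\<Delta> + 1 < real M * norm e"
    and short: "\<And>n m. 1 \<le> n \<Longrightarrow> n \<le> n\<^sub>2 + M * q \<Longrightarrow> m \<in> int_lattice \<Longrightarrow> norm (R *\<^sub>R (real n *\<^sub>R \<alpha> + m)) \<le> \<Delta> \<Longrightarrow>
      (\<exists>k. n = k * q \<and> m = real k *\<^sub>R p) \<or> (\<exists>k. n = n\<^sub>2 + k * q \<and> m = m\<^sub>2 + real k *\<^sub>R p)"
    using assms(1) unfolding tube_return_def by blast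
  have "\<eta> \<le> \<eta>'" using assms(2) norm_ge_zero[of "\<theta> - \<theta>'"] by linarith
  have "norm (e /\<^sub>R norm e - \<theta>') \<le> norm (e /\<^sub>R norm e - \<theta>) + norm (\<theta> - \<theta>')"
    using norm_triangle_ineq[of "e /\<^sub>R norm e - \<theta>" "\<theta> - \<theta>'"] by simp
  then have dir: "norm (e /\<^sub>R norm e - \<theta>') < \<eta>'" using t(7) assms(2) by linarith
  have small: "norm e < \<eta>'" "norm (w + real M *\<^sub>R e) < \<eta>'" "\<Delta>' + 1 < real M * norm e"
    using t(6,8,9) \<open>\<eta> \<le> \<eta>'\<close> assms(3) by linarith+
  have short': "\<forall>n m. 1 \<le> n \<longrightarrow> n \<le> n\<^sub>2 + M * q \<longrightarrow> m \<in> int_lattice \<longrightarrow> norm (R *\<^sub>R (real n *\<^sub>R \<alpha> + m)) \<le> \<Delta>' \<longrightarrow>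
      (\<exists>k. n = k * q \<and> m = real k *\<^sub>R p) \<or> (\<exists>k. n = n\<^sub>2 + k * q \<and> m = m\<^sub>2 + real k *\<^sub>R p)"
    using short assms(3) order_trans by blast
  show ?thesis unfolding tube_return_def using t(1-5) small dir short' by blast
qed

definition nonsingular :: "(real ^ 'n) set" where
  "nonsingular = - {\<alpha>. \<forall>B>0. \<exists>N0. \<forall>N\<ge>N0. \<alpha> \<in> singular_set B N}"

lemma nonsingularE:
  fixes \<alpha> :: "real ^ 'n"
  assumes "\<alpha> \<in> nonsingular"
  obtains K where "1 \<le> K" "\<And>N0. \<exists>N\<ge>N0. \<exists>q \<beta>. good_approx K N q \<beta> \<alpha>"
proof -
  obtain B where B: "0 < B" "\<And>N0. \<exists>N\<ge>N0. \<alpha> \<notin> singular_set B N"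
    using assms by (auto simp: nonsingular_def)
  let ?J = "(2 * CARD('n) * B) ^ CARD('n)"
  show thesis
  proof
    have "1 \<le> 2 * ?J * B" using B(1) by (simp add: Suc_le_eq)
    then have "real 1 \<le> real (2 * ?J * B)" by (rule of_nat_mono)
    then show "1 \<le> real (2 * ?J * B)" by (simp only: of_nat_1)
    fix N0
    obtain N where N: "N \<ge> max 1 N0" "\<alpha> \<notin> singular_set B N" using B(2) by blast
    then have "0 < N" by simp
    obtain q \<beta> where "good_approx (real (2 * ?J * B)) N q \<beta> \<alpha>"
      by (rule good_approx_exists[OF N(2) B(1) \<open>0 < N\<close>])
    then show "\<exists>N\<ge>N0. \<exists>q \<beta>. good_approx (real (2 * ?J * B)) N q \<beta> \<alpha>" using N(1) by auto
  qed
qed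

text \<open>A whole window of scales is required because the sequence that has to meet it is not
  known when the set is formed; \<rho> puts the window where consecutive terms of the sequence have
  ratio below 2.\<close>

definition tube_set :: "real ^ 'n \<Rightarrow> real \<Rightarrow> real \<Rightarrow> real \<Rightarrow> (real ^ 'n) set" where
  "tube_set \<theta> \<eta> \<Delta> \<rho> = {\<alpha>. \<exists>R\<^sub>1\<ge>\<rho>. \<forall>R\<in>{R\<^sub>1..2 * R\<^sub>1}. tube_return \<alpha> R \<theta> \<eta> \<Delta>}"

text \<open>Near a non-singular \<alpha> every good approximation yields a ball of good parameters
  whose radius is a fixed fraction c/C of the surrounding ball, so the exceptional set is porous
  there. The interior is taken because \<open>porous_imp_negligible\<close> asks for an open set,
  and a ball inside \<open>tube_set\<close> lies in its interior.\<close>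

lemma negligible_not_tube:
  fixes \<theta> :: "real ^ 'n"
  assumes "norm \<theta> = 1" "0 < \<eta>" "\<eta> \<le> 1" "0 < \<Delta>"
  shows "negligible (- tube_set \<theta> \<eta> \<Delta> \<rho>)"
proof -
  let ?G = "interior (tube_set \<theta> \<eta> \<Delta> \<rho>)"
  have "negligible (nonsingular - ?G)"
  proof (rule porous_imp_negligible)
    fix \<alpha> :: "real ^ 'n" assume "\<alpha> \<in> nonsingular - ?G"
    then have "\<alpha> \<in> nonsingular" by blast
    then obtain K where K: "1 \<le> K" "\<And>N0. \<exists>N\<ge>N0. \<exists>q \<beta>. good_approx K N q \<beta> \<alpha>"
      by (rule nonsingularE) blast
    have "0 < K" using K(1) by simp
    define L where "L = (8 / \<eta> + 1) * covering_const CARD('n) K"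
    have "covering_const CARD('n) K > 0" using K(1) unfolding covering_const_def
      by (intro divide_pos_pos zero_less_power add_nonneg_pos) auto
    then have "L > 0" using assms by (auto simp: L_def intro!: mult_pos_pos add_pos_pos)
    obtain J :: nat where J: "2 * K * L \<le> real J" using real_arch_simple by blast
    have "0 < 2 * K * L" using K(1) \<open>L > 0\<close> by simp
    then have "0 < J" using J by linarith
    define R\<^sub>0 where "R\<^sub>0 = 8 * K * real J * (\<Delta> + 4)"
    have "1 * 1 * 1 \<le> K * real J * (\<Delta> + 4)" using K(1) \<open>0 < J\<close> assms by (intro mult_mono) auto
    then have "1 \<le> R\<^sub>0" by (simp add: R\<^sub>0_def)
    obtain M :: nat where M: "max 2 (16 * R\<^sub>0 * L / \<eta>) \<le> real M" using real_arch_simple by blast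
    define c where "c = \<eta> / (16 * R\<^sub>0 * (real M + 1) * K * real J)"
    have "c > 0" using assms \<open>1 \<le> R\<^sub>0\<close> K(1) \<open>0 < J\<close> by (simp add: c_def)
    \<comment> \<open>In units of 1/(N q): \<open>L\<close> bounds the shift along \<gamma>, 1 the
      distance from \<alpha> to \<beta>, and \<open>c\<close> is the radius of the ball of good
      parameters.\<close>
    define C where "C = L + 1 + c"
    have "C > 0" using \<open>L > 0\<close> \<open>c > 0\<close> by (simp add: C_def)
    have "\<exists>z s. 0 < s \<and> s < r \<and> ball z (c / C * s) \<subseteq> ball \<alpha> s \<inter> ?G" if "r > 0" for r
    proof -
      \<comment> \<open>A large \<open>N\<close> gives s < r and also puts the start
        \<open>R\<^sub>0 * N\<close> of the window beyond \<rho>.\<close>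
      obtain N0 :: nat where N0: "max (\<bar>\<rho>\<bar>) (C / r) < real N0" using reals_Archimedean2 by blast
      obtain N q \<beta> where "N \<ge> N0" and ga: "good_approx K N q \<beta> \<alpha>" using K(2) by blast
      have N: "0 < N" "0 < q" and \<alpha>\<beta>: "norm (\<alpha> - \<beta>) \<le> 1 / (real N * real q)"
        using ga by (auto simp: good_approx_def)
      have NN: "max (\<bar>\<rho>\<bar>) (C / r) < real N" using N0 \<open>N \<ge> N0\<close> by (meson less_le_trans of_nat_le_iff)
      obtain \<gamma> where \<gamma>: "\<gamma> \<in> rational_net \<beta>" "\<gamma> \<noteq> 0" "norm (\<gamma> /\<^sub>R norm \<gamma> - \<theta>) \<le> \<eta> / 4"
        "norm \<gamma> \<le> L / real N" "\<And>t. 0 < t \<Longrightarrow> t < 1 \<Longrightarrow> t *\<^sub>R \<gamma> \<notin> rational_net \<beta>"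
      proof (rule rational_net_primitive_in_cone[OF ga \<open>0 < K\<close> assms(1-3), folded L_def])
        fix \<gamma> assume \<gamma>: "\<gamma> \<in> rational_net \<beta>" "\<gamma> \<noteq> 0" "norm (\<gamma> /\<^sub>R norm \<gamma> - \<theta>) \<le> \<eta> / 4"
          "norm \<gamma> \<le> L / real N" "\<And>t. 0 < t \<Longrightarrow> t < 1 \<Longrightarrow> t *\<^sub>R \<gamma> \<notin> rational_net \<beta>"
        show thesis by (rule that[OF \<gamma>])
      qed
      define z where "z = \<beta> + (1 / (real M * real q)) *\<^sub>R \<gamma>"
      define s where "s = C / (real N * real q)"
      have cs: "c / C * s = c / (real N * real q)" using \<open>C > 0\<close> by (simp add: s_def)
      have "s > 0" using \<open>C > 0\<close> N by (simp add: s_def)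
      moreover have "s < r"
      proof -
        have "s \<le> C / real N" unfolding s_def using \<open>C > 0\<close> N by (intro divide_left_mono) auto
        also have "\<dots> < r" using NN N \<open>r > 0\<close> by (simp add: field_simps)
        finally show ?thesis .
      qed
      moreover have "ball z (c / C * s) \<subseteq> ball \<alpha> s"
      proof -
        have "dist z \<alpha> \<le> norm ((1 / (real M * real q)) *\<^sub>R \<gamma>) + norm (\<alpha> - \<beta>)"
          using norm_triangle_ineq4[of "(1 / (real M * real q)) *\<^sub>R \<gamma>" "\<alpha> - \<beta>"] by (simp add: z_def dist_norm algebra_simps)
        also have "norm ((1 / (real M * real q)) *\<^sub>R \<gamma>) \<le> L / (real N * real q)"
        proof -
          have "norm ((1 / (real M * real q)) *\<^sub>R \<gamma>) = norm \<gamma> / (real M * real q)" by simp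
          also have "\<dots> \<le> norm \<gamma> / (1 * real q)" using M N by (intro divide_left_mono mult_right_mono) auto
          also have "\<dots> \<le> (L / real N) / (1 * real q)" using \<gamma>(4) by (intro divide_right_mono) auto
          finally show ?thesis by simp
        qed
        finally have "dist z \<alpha> + c / (real N * real q) \<le> s"
          using \<alpha>\<beta> by (simp add: s_def C_def add_divide_distrib)
        then show ?thesis unfolding cs by (auto simp: ball_subset_ball_iff)
      qed
      moreover have "ball z (c / C * s) \<subseteq> ?G"
      proof (rule interior_maximal)
        show "ball z (c / C * s) \<subseteq> tube_set \<theta> \<eta> \<Delta> \<rho>"
        proof
          fix \<alpha>' assume "\<alpha>' \<in> ball z (c / C * s)"
          then have \<alpha>': "norm (\<alpha>' - (\<beta> + (1 / (real M * real q)) *\<^sub>R \<gamma>)) < c / (real N * real q)"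
            unfolding cs by (simp add: z_def dist_norm norm_minus_commute)
          have "\<rho> \<le> R\<^sub>0 * real N"
          proof -
            have "\<bar>\<rho>\<bar> < real N" using NN by simp
            then have "\<rho> \<le> 1 * real N" by simp
            also have "\<dots> \<le> R\<^sub>0 * real N" using \<open>1 \<le> R\<^sub>0\<close> by (intro mult_right_mono) auto
            finally show ?thesis .
          qed
          moreover have "tube_return \<alpha>' R \<theta> \<eta> \<Delta>" if "R \<in> {R\<^sub>0 * real N..2 * (R\<^sub>0 * real N)}" for R
          proof (rule tube_returnI[OF ga K(1) assms(2-4) \<gamma> \<open>0 < J\<close> J R\<^sub>0_def _ _ c_def \<alpha>'])
            show "2 \<le> M" "16 * R\<^sub>0 * L / \<eta> \<le> real M" using M by auto
            show "R\<^sub>0 * real N \<le> R" "R \<le> 2 * R\<^sub>0 * real N" using that by auto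
          qed
          ultimately show "\<alpha>' \<in> tube_set \<theta> \<eta> \<Delta> \<rho>" unfolding tube_set_def by blast
        qed
      qed auto
      ultimately show ?thesis by blast
    qed
    then show "\<exists>c>0. \<forall>r>0. \<exists>z s. 0 < s \<and> s < r \<and> ball z (c * s) \<subseteq> ball \<alpha> s \<inter> ?G"
      using \<open>c > 0\<close> \<open>C > 0\<close> by (intro exI[of _ "c / C"]) auto
  qed auto
  moreover have "negligible (- nonsingular :: (real ^ 'n) set)"
    unfolding nonsingular_def double_compl by (rule negligible_singular)
  ultimately have "negligible ((nonsingular - ?G) \<union> - nonsingular)" by (rule negligible_Un)
  then show ?thesis by (rule negligible_subset) (use interior_subset in blast)
qed

section \<open>Subexponential sequences and the two bounds\<close>

lemma subexponential_window:
  assumes "subexponential R"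
  obtains \<rho> where "0 < \<rho>" "\<And>R\<^sub>1. \<rho> \<le> R\<^sub>1 \<Longrightarrow> \<exists>i. i > I \<and> R\<^sub>1 \<le> R i \<and> R i \<le> 2 * R\<^sub>1"
proof -
  have R: "0 < R 0" "strict_mono R" "filterlim R at_top sequentially"
    "(\<lambda>i. R (Suc i) / R i) \<longlonglongrightarrow> 1"
    using assms by (auto simp: subexponential_def)
  have pos: "0 < R i" for i
    using R(1) strict_mono_less_eq[OF R(2), of 0 i] by simp
  have "eventually (\<lambda>i. R (Suc i) / R i < 2) sequentially"
    using R(4) by (rule order_tendstoD) simp
  then obtain i\<^sub>0 where i0: "\<And>i. i \<ge> i\<^sub>0 \<Longrightarrow> R (Suc i) / R i < 2"
    unfolding eventually_sequentially by blast
  \<comment> \<open>The first index with \<open>R\<^sub>1 \<le> R i\<close> then exceeds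
    \<open>I\<close> and \<open>i\<^sub>0\<close>. Its predecessor has a value below
    \<open>R\<^sub>1\<close>, and the ratio is below 2.\<close>
  define \<rho> where "\<rho> = R (max I i\<^sub>0) + 1"
  have "\<exists>i. i > I \<and> R\<^sub>1 \<le> R i \<and> R i \<le> 2 * R\<^sub>1" if "\<rho> \<le> R\<^sub>1" for R\<^sub>1
  proof -
    have "\<exists>i. R\<^sub>1 \<le> R i"
      using R(3) unfolding filterlim_at_top eventually_sequentially by blast
    then have ex: "R\<^sub>1 \<le> R (LEAST i. R\<^sub>1 \<le> R i)" by (rule LeastI_ex)
    define i where "i = (LEAST i. R\<^sub>1 \<le> R i)"
    have Ri: "R\<^sub>1 \<le> R i" using ex by (simp only: i_def)
    have "R (max I i\<^sub>0) < R i" using Ri that by (simp add: \<rho>_def)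
    then have less: "max I i\<^sub>0 < i" using strict_mono_less[OF R(2)] by blast
    then obtain j where j: "i = Suc j" by (cases i) auto
    have "R j < R\<^sub>1" using not_less_Least[of j "\<lambda>i. R\<^sub>1 \<le> R i"] j by (simp add: i_def[symmetric])
    moreover have "R i < 2 * R j" using i0[of j] less pos[of j] j by (simp add: field_simps)
    ultimately have "R i \<le> 2 * R\<^sub>1" by linarith
    then show ?thesis using less Ri by auto
  qed
  moreover have "0 < \<rho>" using pos by (simp add: \<rho>_def add_pos_pos)
  ultimately show thesis using that by blast
qed

lemma liminf_num_return_times:
  fixes \<alpha> :: "real ^ 'n"
  assumes "\<alpha> \<in> nonsingular" "bounded D" "interior D \<noteq> {}" "subexponential R"
  shows "liminf (\<lambda>i. num_return_times \<alpha> ((\<lambda>x. inverse (R i) *\<^sub>R x) ` D)) < \<infinity>"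
proof -
  obtain K where K: "1 \<le> K" "\<And>N0. \<exists>N\<ge>N0. \<exists>q \<beta>. good_approx K N q \<beta> \<alpha>"
    using assms(1) by (rule nonsingularE) blast
  have "K > 0" using K(1) by simp
  obtain y\<^sub>0 where "y\<^sub>0 \<in> interior D" using assms(3) by blast
  then obtain r where r: "0 < r" "cball y\<^sub>0 r \<subseteq> D" by (metis mem_interior_cball)
  obtain B where B: "\<And>x. x \<in> D \<Longrightarrow> norm x \<le> B" using \<open>bounded D\<close> bounded_iff by metis
  have B2: "norm (x - y) \<le> 2 * B" if "x \<in> D" "y \<in> D" for x y
    using norm_triangle_ineq4[of x y] B[OF that(1)] B[OF that(2)] by linarith
  let ?C = "covering_const CARD('n) K"
  have "?C > 0" using K(1) unfolding covering_const_def
    by (intro divide_pos_pos zero_less_power add_nonneg_pos) auto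
  \<comment> \<open>With this value the whole window from c N to 2 c N is admissible in
    \<open>num_return_times_le\<close>; its upper end meets the ball condition with
    equality.\<close>
  define c where "c = r / (2 * (?C + 1))"
  have "c > 0" using r \<open>?C > 0\<close> by (simp add: c_def)
  obtain b where b: "\<And>N q \<beta> R. good_approx K N q \<beta> \<alpha> \<Longrightarrow> c * real N \<le> R \<Longrightarrow> R * (?C + 1) \<le> r * real N \<Longrightarrow>
      num_return_times \<alpha> ((\<lambda>x. inverse R *\<^sub>R x) ` D) \<le> enat b"
    using num_return_times_le[OF _ \<open>K > 0\<close> r(2,1) B2 \<open>c > 0\<close>] by metis
  have "\<exists>i>I. num_return_times \<alpha> ((\<lambda>x. inverse (R i) *\<^sub>R x) ` D) \<le> enat b" for I
  proof -
    obtain \<rho> where \<rho>: "0 < \<rho>" "\<And>R\<^sub>1. \<rho> \<le> R\<^sub>1 \<Longrightarrow> \<exists>i. i > I \<and> R\<^sub>1 \<le> R i \<and> R i \<le> 2 * R\<^sub>1"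
      using subexponential_window[OF assms(4)] by metis
    obtain N0 :: nat where N0: "\<rho> / c \<le> real N0" using real_arch_simple by blast
    obtain N q \<beta> where "N \<ge> N0" and ga: "good_approx K N q \<beta> \<alpha>" using K(2) by blast
    have "\<rho> / c \<le> real N" using N0 \<open>N \<ge> N0\<close> by (meson of_nat_le_iff order_trans)
    then have "\<rho> \<le> c * real N" using \<open>c > 0\<close> by (simp add: pos_divide_le_eq mult.commute)
    then obtain i where i: "i > I" "c * real N \<le> R i" "R i \<le> 2 * (c * real N)" using \<rho>(2) by blast
    have "R i * (?C + 1) \<le> 2 * (c * real N) * (?C + 1)"
      using i(3) \<open>?C > 0\<close> by (intro mult_right_mono) auto
    also have "\<dots> = (2 * (?C + 1) * c) * real N" by (simp only: mult_ac)
    also have "2 * (?C + 1) * c = r"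
    proof -
      have "0 < 2 * (?C + 1)" using \<open>?C > 0\<close> by simp
      then have "2 * (?C + 1) \<noteq> 0" by (rule less_imp_neq[symmetric])
      then show ?thesis unfolding c_def times_divide_eq_right by (rule nonzero_mult_div_cancel_left)
    qed
    finally show ?thesis using b[OF ga i(2)] i(1) by blast
  qed
  have "liminf (\<lambda>i. num_return_times \<alpha> ((\<lambda>x. inverse (R i) *\<^sub>R x) ` D)) \<le> enat b"
    unfolding liminf_SUP_INF
  proof (intro SUP_least)
    fix n
    obtain i where "i > n" "num_return_times \<alpha> ((\<lambda>x. inverse (R i) *\<^sub>R x) ` D) \<le> enat b"
      using \<open>\<And>I. \<exists>i>I. num_return_times \<alpha> ((\<lambda>x. inverse (R i) *\<^sub>R x) ` D) \<le> enat b\<close> by blast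
    then show "(INF i\<in>{n..}. num_return_times \<alpha> ((\<lambda>x. inverse (R i) *\<^sub>R x) ` D)) \<le> enat b"
      by (intro INF_lower2[of i]) auto
  qed
  also have "enat b < \<infinity>" by simp
  finally show ?thesis .
qed

text \<open>The direction, tolerance and length depend on \<open>D\<close> and on the number
  \<open>K\<close> of return times asked for. Half of \<eta> is spent on replacing \<theta> by the
  direction of a point of the dense set \<open>T\<close>, the other half on the tolerance 1/(k +
  1).\<close>

lemma SUP_num_return_times:
  fixes D :: "(real ^ 'n) set"
  assumes "2 \<le> CARD('n)" "bounded D" "convex D" "interior D \<noteq> {}" "subexponential R"
    and T: "\<And>U. open U \<Longrightarrow> U \<noteq> {} \<Longrightarrow> \<exists>v\<in>T. v \<in> U"
    and \<alpha>: "\<And>v k l j. v \<in> T \<Longrightarrow> v \<noteq> 0 \<Longrightarrow> \<alpha> \<in> tube_set (v /\<^sub>R norm v) (1 / real (Suc k)) (real (Suc l)) (real j)"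
  shows "(SUP i. num_return_times \<alpha> ((\<lambda>x. inverse (R i) *\<^sub>R x) ` D)) = \<infinity>"
proof -
  have "\<exists>i. enat K \<le> num_return_times \<alpha> ((\<lambda>x. inverse (R i) *\<^sub>R x) ` D)" for K
  proof -
    obtain \<theta> :: "real ^ 'n" and \<eta> \<Delta> where \<theta>: "norm \<theta> = 1" "0 < \<eta>" "\<eta> \<le> 1" "0 < \<Delta>"
      "\<And>\<alpha> R. 0 < R \<Longrightarrow> tube_return \<alpha> R \<theta> \<eta> \<Delta> \<Longrightarrow> enat K \<le> num_return_times \<alpha> ((\<lambda>x. inverse R *\<^sub>R x) ` D)"
      using many_return_times[OF assms(1-4)] by metis
    obtain v where v: "v \<in> T" "v \<in> ball \<theta> (\<eta> / 4)" using T[of "ball \<theta> (\<eta> / 4)"] \<theta> by auto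
    have "v \<noteq> 0" using v \<theta> by auto
    have dir: "norm (v /\<^sub>R norm v - \<theta>) \<le> \<eta> / 2"
      using normalize_diff_le[OF \<theta>(1) zero_less_one \<open>v \<noteq> 0\<close>] v by (simp add: dist_norm norm_minus_commute)
    obtain k where "inverse (real (Suc k)) < \<eta> / 2" using reals_Archimedean[of "\<eta> / 2"] \<theta> by auto
    then have k: "1 / real (Suc k) \<le> \<eta> / 2" by (simp add: inverse_eq_divide)
    obtain l :: nat where "\<Delta> \<le> real l" using real_arch_simple by blast
    then have l: "\<Delta> \<le> real (Suc l)" by simp
    obtain \<rho> where \<rho>: "0 < \<rho>" "\<And>R\<^sub>1. \<rho> \<le> R\<^sub>1 \<Longrightarrow> \<exists>i. i > 0 \<and> R\<^sub>1 \<le> R i \<and> R i \<le> 2 * R\<^sub>1"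
      using subexponential_window[OF assms(5)] by metis
    obtain j :: nat where j: "\<rho> \<le> real j" using real_arch_simple by blast
    obtain R\<^sub>1 where R1: "real j \<le> R\<^sub>1" "\<And>r. r \<in> {R\<^sub>1..2 * R\<^sub>1} \<Longrightarrow> tube_return \<alpha> r (v /\<^sub>R norm v) (1 / real (Suc k)) (real (Suc l))"
      using \<alpha>[OF v(1) \<open>v \<noteq> 0\<close>, of k l j] unfolding tube_set_def by blast
    obtain i where i: "R\<^sub>1 \<le> R i" "R i \<le> 2 * R\<^sub>1" using \<rho>(2)[of R\<^sub>1] j R1(1) by auto
    have "tube_return \<alpha> (R i) \<theta> \<eta> \<Delta>"
    proof (rule tube_return_mono)
      show "tube_return \<alpha> (R i) (v /\<^sub>R norm v) (1 / real (Suc k)) (real (Suc l))"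
        using i by (intro R1(2)) simp
      show "norm (v /\<^sub>R norm v - \<theta>) + 1 / real (Suc k) \<le> \<eta>" using k dir by linarith
    qed (rule l)
    moreover have "0 < R i" using i(1) R1(1) j \<rho>(1) by linarith
    ultimately show ?thesis using \<theta>(5) by blast
  qed
  then have ge: "enat K \<le> (SUP i. num_return_times \<alpha> ((\<lambda>x. inverse (R i) *\<^sub>R x) ` D))" for K
    by (meson SUP_upper2 UNIV_I)
  show ?thesis
  proof (rule ccontr)
    assume "(SUP i. num_return_times \<alpha> ((\<lambda>x. inverse (R i) *\<^sub>R x) ` D)) \<noteq> \<infinity>"
    then obtain n where "(SUP i. num_return_times \<alpha> ((\<lambda>x. inverse (R i) *\<^sub>R x) ` D)) = enat n" by auto
    then show False using ge[of "Suc n"] by simp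
  qed
qed

theorem theorem1p5:
  assumes "CARD('n::finite) \<ge> 2"
  shows "\<exists>P :: (real ^ 'n) set.
           - P \<in> null_sets lebesgue \<and> uminus ` P = P \<and>
           (\<forall>D \<alpha> R. bounded D \<and> convex D \<and> interior D \<noteq> {} \<and> \<alpha> \<in> P \<and> subexponential R \<longrightarrow>
              (SUP i. num_return_times \<alpha> ((\<lambda>x. inverse (R i) *\<^sub>R x) ` D)) = \<infinity> \<and>
              liminf (\<lambda>i. num_return_times \<alpha> ((\<lambda>x. inverse (R i) *\<^sub>R x) ` D)) < \<infinity>)"
proof -
  obtain T :: "(real ^ 'n) set" where T: "countable T" "\<And>U. open U \<Longrightarrow> U \<noteq> {} \<Longrightarrow> \<exists>v\<in>T. v \<in> U"
    by (rule countable_dense_setE) blast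
  \<comment> \<open>Besides non-singularity these are the only conditions on \<alpha>: countably
    many, and none mentions \<open>D\<close> or \<open>R\<close>.\<close>
  define G where "G = (\<lambda>(v :: real ^ 'n, k, l, j). tube_set (v /\<^sub>R norm v) (1 / real (Suc k)) (real (Suc l)) (real j))"
  define I where "I = (T - {0}) \<times> (UNIV :: (nat \<times> nat \<times> nat) set)"
  define P\<^sub>0 where "P\<^sub>0 = nonsingular \<inter> (\<Inter>i\<in>I. G i)"
  have "negligible (- G i)" if "i \<in> I" for i
    using that unfolding G_def I_def
    by (auto intro!: negligible_not_tube simp: divide_le_eq simp del: of_nat_Suc)
  moreover have "countable I" using T(1) by (auto simp: I_def)
  ultimately have "negligible (\<Union>i\<in>I. - G i)" by (intro negligible_countable_Union) auto
  moreover have "negligible (- nonsingular :: (real ^ 'n) set)"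
    unfolding nonsingular_def double_compl by (rule negligible_singular)
  ultimately have "negligible ((\<Union>i\<in>I. - G i) \<union> - nonsingular)" by (rule negligible_Un)
  then have neg: "negligible (- P\<^sub>0)" by (rule negligible_subset) (auto simp: P\<^sub>0_def)
  have neg': "negligible (uminus ` (- P\<^sub>0))"
    by (rule negligible_differentiable_image_negligible[OF _ neg]) (auto intro!: derivative_intros)
  \<comment> \<open>Symmetry is obtained by intersecting with the mirror image; negation preserves
    null sets.\<close>
  define P where "P = P\<^sub>0 \<inter> uminus ` P\<^sub>0"
  have "- P \<subseteq> - P\<^sub>0 \<union> uminus ` (- P\<^sub>0)"
  proof
    fix x assume "x \<in> - P"
    then have "x \<notin> P\<^sub>0 \<or> - x \<notin> P\<^sub>0" unfolding P_def by (metis ComplD IntI image_eqI minus_minus)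
    then show "x \<in> - P\<^sub>0 \<union> uminus ` (- P\<^sub>0)" by (metis ComplI UnI1 UnI2 image_eqI minus_minus)
  qed
  then have "negligible (- P)" using negligible_Un[OF neg neg'] negligible_subset by blast
  then have "- P \<in> null_sets lebesgue" by (simp add: negligible_iff_null_sets)
  moreover have "uminus ` P = P" unfolding P_def by (simp add: image_Int image_image Int_commute)
  moreover have "(SUP i. num_return_times \<alpha> ((\<lambda>x. inverse (R i) *\<^sub>R x) ` D)) = \<infinity> \<and>
      liminf (\<lambda>i. num_return_times \<alpha> ((\<lambda>x. inverse (R i) *\<^sub>R x) ` D)) < \<infinity>"
    if "bounded D \<and> convex D \<and> interior D \<noteq> {} \<and> \<alpha> \<in> P \<and> subexponential R" for D \<alpha> R
  proof
    have D: "bounded D" "convex D" "interior D \<noteq> {}" "subexponential R" using that by auto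
    have \<alpha>: "\<alpha> \<in> nonsingular" "\<And>i. i \<in> I \<Longrightarrow> \<alpha> \<in> G i" using that by (auto simp: P_def P\<^sub>0_def)
    have "\<alpha> \<in> tube_set (v /\<^sub>R norm v) (1 / real (Suc k)) (real (Suc l)) (real j)" if "v \<in> T" "v \<noteq> 0" for v k l j
      using \<alpha>(2)[of "(v, k, l, j)"] that by (simp add: G_def I_def)
    then show "(SUP i. num_return_times \<alpha> ((\<lambda>x. inverse (R i) *\<^sub>R x) ` D)) = \<infinity>"
      using SUP_num_return_times[OF assms D T(2)] by blast
    show "liminf (\<lambda>i. num_return_times \<alpha> ((\<lambda>x. inverse (R i) *\<^sub>R x) ` D)) < \<infinity>"
      using liminf_num_return_times[OF \<alpha>(1) D(1,3,4)] .
  qed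
  ultimately show ?thesis by blast
qed

end
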